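(* Let $\mathbf R$ be a commutative ring with unity $1$ and zero $0$; let $x=(x_1,\ldots,x_n)$, $y=(y_1,\ldots,y_n)$, $f(x)=(f_1(x),\ldots,f_s(x))\in\mathbf R[x]^s$, $F(x)=(F_1(x),\ldots,F_t(x))\in\mathbf R[x]^t$, and suppose that for all $j=1,\ldots,t$, $F_j(x)=\sum_{i=1}^sf_i(x)G^i_j(x)$ with $G^i_j(x)\in\mathbf R[x]$. Let $\partial:\widehat f_x\mapsto f(x)$, $\widehat F_x\mapsto F(x)$, $\widehat f_y\mapsto f(y)$, $\widehat F_y\mapsto F(y)$. Then $$\mathop{\top}\limits_{\widehat F_x}\exp(\widehat f_xG(x)\widehat F^x_* )\det\left\|\begin{matrix}\nabla F(x,y)\\ \widehat F_x-\widehat F_y\end{matrix}\right\|=\det\left\|\begin{matrix}\nabla F(x,y)\\ \widehat f_xG(x)-\widehat F_y\end{matrix}\right\|\stackrel{\partial}{\simeq}\mathop{\top}\limits_{\widehat f_y}\det\left\|\begin{matrix}\nabla f(x,y)\\ \widehat f_x-\widehat f_y\end{matrix}\right\|\det\left\|\begin{matrix}G(y)&\widehat f^y_*\\ -\widehat F_y&0\end{matrix}\right\|;$$ moreover, $$\partial\left[\det\left\|\begin{matrix}\nabla F(x,y)\\ \widehat f_xG(x)-\widehat F_y\end{matrix}\right\|\right]=0,\qquad\partial\left[\det\left\|\begin{matrix}G(y)&\widehat f^y_*\\ -\widehat F_y&0\end{matrix}\right\|\right]=0.$$ In particular, for $L(x_*,\widehat F^x_* )\in\mathbf C(x_*,\widehat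 F^x_* )$, if $\partial\left[L(x_*,\widehat F^x_* )\right]=0$, then $$\partial\left[\mathop{\bot}\limits_{x}\mathop{\top}\limits_{\widehat F_x}\det\left\|\begin{matrix}G(x)&\widehat f^x_*\\ -\widehat F_x&0\end{matrix}\right\|L(x_*,\widehat F^x_* )\right]=0$$ and $$\mathop{\top}\limits_{\widehat F_x}\exp(\widehat f_xG(x)\widehat F^x_* )\mathop{\top}\limits_{y}\mathop{\top}\limits_{\widehat F_y}\det\left\|\begin{matrix}\nabla F(x,y)\\ \widehat F_x-\widehat F_y\end{matrix}\right\|L(y_*,\widehat F^y_* )=\mathop{\top}\limits_{y}\mathop{\top}\limits_{\widehat F_y}\det\left\|\begin{matrix}\nabla F(x,y)\\ \widehat f_xG(x)-\widehat F_y\end{matrix}\right\|L(y_*,\widehat F^y_* )\stackrel{\partial}{\simeq}\mathop{\top}\limits_{y}\mathop{\top}\limits_{\widehat f_y}\det\left\|\begin{matrix}\nabla f(x,y)\\ \widehat f_x-\widehat f_y\end{matrix}\right\|\left(\mathop{\bot}\limits_{y}\mathop{\top}\limits_{\widehat F_y}\det\left\|\begin{matrix}G(y)&\widehat f^y_*\\ -\widehat F_y&0\end{matrix}\right\|L(y_*,\widehat F^y_* )\right).$$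
   Context: Variables. $\widehat f_x,\widehat f_y$ are collections of $s$, $\widehat F_x,\widehat F_y$ collections of $t$, and $\widehat u$ a collection of $n$ Grassmann (anticommuting, square-zero) variables; variables from different collections also anticommute. $\Lambda_A(\widehat v)$ is the Grassmann algebra in $\widehat v$ over a commutative ring $A$; $|w|\in\mathbb Z/2$ is the parity of a homogeneous element or linear map. Complexes. $\mathbf C(x,\widehat f_x)=\Lambda_{\mathbf R[x]}(\widehat f_x)$ with differential the odd $\mathbf R[x]$-linear derivation $\partial(ab)=\partial(a)b+(-1)^{|a|}a\,\partial(b)$ with $\partial(\widehat f_{i,x})=f_i(x)$; similarly $\mathbf C(x,\widehat F_x)=\Lambda_{\mathbf R[x]}(\widehat F_x)$ with $\partial(\widehat F_{j,x})=F_j(x)$, and $\mathbf C(x,y,\widehat f_x,\widehat F_y)=\Lambda_{\mathbf R[x,y]}(\widehat f_x,\widehat F_y)$ with $\partial(\widehat f_{i,x})=f_i(x)$, $\partial(\widehat F_{j,y})=F_j(y)$, etc. The dual complexes are $\mathbf C(x_*,\widehat F^x_* )=\mathrm{Hom}_{\mathbf R}(\mathbf C(x,\widehat F_x),\mathbf R)$ and $\mathbf C(x_*,\widehat f^x_* )=\mathrm{Hom}_{\mathbf R}(\mathbf C(x,\widehat f_x),\mathbf R)$; $L(y_*,\widehat F^y_* )$ is $L(x_*,\widehat F^x_* )$ with $x$ renamed to $y$. For a homogeneous linear map $\varphi$ between complexes, $\partial[\varphi]=\partial\circ\varphi-(-1)^{|\varphi|}\varphi\circ\partial$; in particular $\partial[L]=-(-1)^{|L|}L\circ\partial$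 for a functional with values in $\mathbf R$. For elements $c',c''$ of a complex, $c'\stackrel{\partial}{\simeq} c''$ means $c'-c''=\partial[c]$ for some $c$ in the complex; the first equivalence of the theorem is in $\mathbf C(x,y,\widehat f_x,\widehat F_y)$, the second in $\mathbf C(x,\widehat f_x)$. Difference quotients. For $H(x)\in\mathbf R[x]$, $\widehat u\nabla H(x,y)=\sum_{k=1}^n\widehat u_k\nabla^kH(x,y)$ is a fixed choice of element with $\nabla^kH(x,y)\in\mathbf R[x,y]$ and $\sum_{k=1}^n(x_k-y_k)\nabla^kH(x,y)=H(x)-H(y)$. Functionals and contraction. A homogeneous linear map $\varphi$ on functions of variables $v$ is extended linearly over the polynomial variables other than $v$ and, for additional Grassmann parameters $\theta$, by $\varphi(\theta w)=(-1)^{|\varphi||\theta|}\theta\varphi(w)$. Contraction is $\mathop{\top}\limits_v\varphi\,w=\varphi(w)$ and, with the function written first, $\mathop{\top}\limits_v w\,\varphi=(-1)^{|w||\varphi|}\varphi(w)$; everything is extended additively to inhomogeneous elements. $\mathop{\bot}\limits_x$ indicates that functions of $x$ act on functionals in $x$ by $(a\cdot l)(h)=l(ah)$. $\exp(\widehat f_xG(x)\widehat F^x_* )$ is the $\mathbf R[x]$-linear algebra homomorphism substituting $\widehat F_{j,x}\mapsto\sum_{i=1}^s\widehat f_{i,x}G^i_j(x)$. $\widehat f_xG(x)$ denotes the collection $\left(\sum_{i}\widehat f_{i,x}G^i_j(x)\right)_{j=1,\ldots,t}$. Determinants with a Grassmann row. For polynomials $H_1,\ldots,H_m$ and odd elements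 $\widehat w_1,\ldots,\widehat w_m$ not involving $\widehat u$, $\det\left\|\begin{matrix}\nabla H(x,y)\\ \widehat w\end{matrix}\right\|$ is the element $Q$ not involving $\widehat u$ such that $\widehat u_1\widehat u_2\cdots\widehat u_n\,Q$ is the component of top degree $n$ in $\widehat u$ of the ordered product $\prod_{j=1}^m\left(\sum_{k=1}^n\widehat u_k\nabla^kH_j(x,y)+\widehat w_j\right)$; it has parity $m-n$. The determinant with a dual column. $B(y)=\det\left\|\begin{matrix}G(y)&\widehat f^y_*\\ -\widehat F_y&0\end{matrix}\right\|$ is the $\mathbf R[y]$-linear map $\Lambda_{\mathbf R[y]}(\widehat f_y)\to\Lambda_{\mathbf R[y]}(\widehat F_y)$ of parity $s+t$ given by $$B(y).h=\det\|\widehat f^y_*\|.\left(\prod_{j=1}^t\left(\sum_{i=1}^s\widehat f_{i,y}G^i_j(y)-\widehat F_{j,y}\right)h\right)$$ (product in the order $j=1,\ldots,t$), where $\det\|\widehat f^y_*\|$ is the functional in $\widehat f_y$, of parity $s\bmod 2$, equal to $1$ on $\widehat f_{1,y}\cdots\widehat f_{s,y}$ and $0$ on the other monomials in $\widehat f_y$ (extended to the parameters $\widehat F_y$ with the sign rule above); $B(x)$ is the same with $y$ renamed to $x$. For a homogeneous functional $L\in\mathbf C(x_*,\widehat F^x_* )$, $\mathop{\bot}\limits_x\mathop{\top}\limits_{\widehat F_x}B(x)L\in\mathbf C(x_*,\widehat f^x_* )$ is the functional $h\mapsto(-1)^{|L||B|}L\left(B(x).h\right)$, where $|B|=s+t\bmod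 2$ (the sign comes from interchanging $B$ and $L$); the same with $x$ renamed to $y$. *)

theory Defs
  imports "HOL-Library.Poly_Mapping"
begin

section \<open>Grassmann algebras\<close>

text \<open>
  An element of the Grassmann algebra over \<open>'a\<close> in the variables \<open>'g\<close> is a finite sum of terms
  \<open>c\<^sub>S \<cdot> e\<^sub>S\<close>, where \<open>S\<close> is a finite set of variables and \<open>e\<^sub>S\<close> is the product of the elements
  of \<open>S\<close> in increasing order.  For disjoint \<open>S\<close> and \<open>T\<close>, \<open>e\<^sub>S e\<^sub>T\<close> is \<open>e\<close> of the union
  times the sign of the shuffle.
\<close>

definition shuffle_sign :: "'g::linorder set \<Rightarrow> 'g set \<Rightarrow> 'a::comm_ring_1" where
  "shuffle_sign S T = (-1) ^ card {(a, b). a \<in> S \<and> b \<in> T \<and> b < a}"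

typedef (overloaded) ('g, 'a) grassmann =
  "{c :: 'g set \<Rightarrow> 'a::zero. finite {S. c S \<noteq> 0} \<and> (\<forall>S. c S \<noteq> 0 \<longrightarrow> finite S)}"
  morphisms coef Grassmann
  by (rule exI[of _ "\<lambda>_. 0"]) simp

setup_lifting type_definition_grassmann

definition supp :: "('g, 'a::zero) grassmann \<Rightarrow> 'g set set" where
  "supp w = {S. coef w S \<noteq> 0}"

lemma finite_supp [simp]: "finite (supp w)"
  unfolding supp_def by transfer simp

lemma finite_of_supp: "S \<in> supp w \<Longrightarrow> finite S"
  unfolding supp_def by transfer simp

lemma coef_infinite: "infinite S \<Longrightarrow> coef w S = 0"
  using finite_of_supp[of S w] by (auto simp: supp_def)

lemma grassmann_eqI: "(\<And>S. finite S \<Longrightarrow> coef v S = coef w S) \<Longrightarrow> v = w"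
  by (metis coef_infinite coef_inject ext)

lift_definition gmonom :: "'g set \<Rightarrow> 'a \<Rightarrow> ('g, 'a::zero) grassmann"
  is "\<lambda>S c T. if T = S \<and> finite S then c else 0"
  by (auto intro: finite_subset[of _ "{_}"])

abbreviation gconst :: "'a \<Rightarrow> ('g, 'a::zero) grassmann" where
  "gconst c \<equiv> gmonom {} c"

abbreviation gen :: "'g \<Rightarrow> ('g, 'a::zero_neq_one) grassmann" where
  "gen g \<equiv> gmonom {g} 1"

instantiation grassmann :: (type, ab_group_add) ab_group_add
begin

lift_definition zero_grassmann :: "('a, 'b) grassmann" is "\<lambda>_. 0"
  by simp

lift_definition plus_grassmann :: "('a, 'b) grassmann \<Rightarrow> ('a, 'b) grassmann \<Rightarrow> ('a, 'b) grassmann"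
  is "\<lambda>v w S. v S + w S"
proof -
  fix v w :: "'a set \<Rightarrow> 'b"
  assume "finite {S. v S \<noteq> 0} \<and> (\<forall>S. v S \<noteq> 0 \<longrightarrow> finite S)"
    and "finite {S. w S \<noteq> 0} \<and> (\<forall>S. w S \<noteq> 0 \<longrightarrow> finite S)"
  moreover have "{S. v S + w S \<noteq> 0} \<subseteq> {S. v S \<noteq> 0} \<union> {S. w S \<noteq> 0}" by auto
  ultimately show "finite {S. v S + w S \<noteq> 0} \<and> (\<forall>S. v S + w S \<noteq> 0 \<longrightarrow> finite S)"
    by (metis (no_types, lifting) add_0 finite_UnI finite_subset)
qed

lift_definition uminus_grassmann :: "('a, 'b) grassmann \<Rightarrow> ('a, 'b) grassmann"
  is "\<lambda>v S. - v S"
  by simp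

definition minus_grassmann :: "('a, 'b) grassmann \<Rightarrow> ('a, 'b) grassmann \<Rightarrow> ('a, 'b) grassmann" where
  "minus_grassmann v w = v + - w"

instance
  by standard (simp add: minus_grassmann_def | (transfer, auto simp: algebra_simps))+

end

lemma coef_zero [simp]: "coef 0 S = 0"
  by transfer simp

lemma coef_add [simp]: "coef (v + w) S = coef v S + coef w S"
  by transfer simp

lemma coef_uminus [simp]: "coef (- v) S = - coef v S"
  by transfer simp

lemma coef_diff [simp]: "coef (v - w) S = coef v S - coef w S"
  by (simp add: minus_grassmann_def del: add_uminus_conv_diff)

lemma coef_sum [simp]: "coef (sum f A) S = (\<Sum>a\<in>A. coef (f a) S)"
  by (induction A rule: infinite_finite_induct) auto

lemma coef_gmonom: "coef (gmonom S c) T = (if T = S \<and> finite S then c else 0)"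
  by transfer simp

instantiation grassmann :: (linorder, comm_ring_1) ring_1
begin

definition one_grassmann :: "('a, 'b) grassmann" where
  "one_grassmann = gconst 1"

lift_definition times_grassmann :: "('a, 'b) grassmann \<Rightarrow> ('a, 'b) grassmann \<Rightarrow> ('a, 'b) grassmann"
  is "\<lambda>v w S. \<Sum>T\<in>Pow S. shuffle_sign T (S - T) * v T * w (S - T)"
proof -
  fix v w :: "'a set \<Rightarrow> 'b"
  assume v: "finite {S. v S \<noteq> 0} \<and> (\<forall>S. v S \<noteq> 0 \<longrightarrow> finite S)"
    and w: "finite {S. w S \<noteq> 0} \<and> (\<forall>S. w S \<noteq> 0 \<longrightarrow> finite S)"
  let ?p = "\<lambda>S. \<Sum>T\<in>Pow S. shuffle_sign T (S - T) * v T * w (S - T)"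
  have sub: "{S. ?p S \<noteq> 0} \<subseteq> (\<lambda>(A, B). A \<union> B) ` ({S. v S \<noteq> 0} \<times> {S. w S \<noteq> 0})"
  proof
    fix S assume "S \<in> {S. ?p S \<noteq> 0}"
    then obtain T where "T \<subseteq> S" and nz: "shuffle_sign T (S - T) * v T * w (S - T) \<noteq> 0"
      by (auto elim: sum.not_neutral_contains_not_neutral)
    from nz have "v T \<noteq> 0" "w (S - T) \<noteq> 0" by auto
    moreover have "S = T \<union> (S - T)" using \<open>T \<subseteq> S\<close> by auto
    ultimately show "S \<in> (\<lambda>(A, B). A \<union> B) ` ({S. v S \<noteq> 0} \<times> {S. w S \<noteq> 0})"
      by (intro image_eqI[of _ _ "(T, S - T)"]) auto
  qed
  have "finite ({S. v S \<noteq> 0} \<times> {S. w S \<noteq> 0})" using v w by auto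
  then have "finite {S. ?p S \<noteq> 0}" using sub finite_surj by blast
  moreover have "finite S" if "?p S \<noteq> 0" for S
    using that by (metis finite_Pow_iff sum.infinite)
  ultimately show "finite {S. ?p S \<noteq> 0} \<and> (\<forall>S. ?p S \<noteq> 0 \<longrightarrow> finite S)" by blast
qed

lemma coef_mult: "coef (v * w) S = (\<Sum>T\<in>Pow S. shuffle_sign T (S - T) * coef v T * coef w (S - T))"
  for v w :: "('a, 'b) grassmann"
  by transfer simp

lemma shuffle_sign_empty [simp]: "shuffle_sign {} T = 1" "shuffle_sign T {} = 1"
  by (simp_all add: shuffle_sign_def)

lemma shuffle_sign_Un_left:
  assumes "finite A" "finite B" "finite C" "A \<inter> B = {}"
  shows "shuffle_sign (A \<union> B) C = (shuffle_sign A C * shuffle_sign B C :: 'c::comm_ring_1)"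
proof -
  have eq: "{(a, b). a \<in> A \<union> B \<and> b \<in> C \<and> b < a} =
    {(a, b). a \<in> A \<and> b \<in> C \<and> b < a} \<union> {(a, b). a \<in> B \<and> b \<in> C \<and> b < a}" by auto
  have "finite {(a, b). a \<in> A \<and> b \<in> C \<and> b < a}" "finite {(a, b). a \<in> B \<and> b \<in> C \<and> b < a}"
    by (rule finite_subset[of _ "A \<times> C"], auto simp: assms)
      (rule finite_subset[of _ "B \<times> C"], auto simp: assms)
  then have "card {(a, b). a \<in> A \<union> B \<and> b \<in> C \<and> b < a} =
    card {(a, b). a \<in> A \<and> b \<in> C \<and> b < a} + card {(a, b). a \<in> B \<and> b \<in> C \<and> b < a}"
    unfolding eq using assms(4) by (intro card_Un_disjoint) auto
  then show ?thesis by (simp add: shuffle_sign_def power_add)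
qed

lemma shuffle_sign_Un_right:
  assumes "finite A" "finite B" "finite C" "B \<inter> C = {}"
  shows "shuffle_sign A (B \<union> C) = (shuffle_sign A B * shuffle_sign A C :: 'c::comm_ring_1)"
proof -
  have eq: "{(a, b). a \<in> A \<and> b \<in> B \<union> C \<and> b < a} =
    {(a, b). a \<in> A \<and> b \<in> B \<and> b < a} \<union> {(a, b). a \<in> A \<and> b \<in> C \<and> b < a}" by auto
  have "finite {(a, b). a \<in> A \<and> b \<in> B \<and> b < a}" "finite {(a, b). a \<in> A \<and> b \<in> C \<and> b < a}"
    by (rule finite_subset[of _ "A \<times> B"], auto simp: assms)
      (rule finite_subset[of _ "A \<times> C"], auto simp: assms)
  then have "card {(a, b). a \<in> A \<and> b \<in> B \<union> C \<and> b < a} =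
    card {(a, b). a \<in> A \<and> b \<in> B \<and> b < a} + card {(a, b). a \<in> A \<and> b \<in> C \<and> b < a}"
    unfolding eq using assms(4) by (intro card_Un_disjoint) auto
  then show ?thesis by (simp add: shuffle_sign_def power_add)
qed

lemma grassmann_mult_assoc: "u * v * w = u * (v * w)" for u v w :: "('a, 'b) grassmann"
proof (rule grassmann_eqI)
  fix S :: "'a set" assume fin: "finite S"
  let ?e = "shuffle_sign :: 'a set \<Rightarrow> 'a set \<Rightarrow> 'b"
  have fin_sub: "finite T" if "T \<subseteq> S" for T using that fin finite_subset by blast
  have "coef (u * v * w) S = (\<Sum>T\<in>Pow S. \<Sum>A\<in>Pow T.
      ?e T (S - T) * ?e A (T - A) * coef u A * coef v (T - A) * coef w (S - T))"
    by (simp add: coef_mult sum_distrib_left sum_distrib_right mult.assoc)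
  also have "\<dots> = (\<Sum>(T, A)\<in>Sigma (Pow S) Pow.
      ?e T (S - T) * ?e A (T - A) * coef u A * coef v (T - A) * coef w (S - T))"
    using fin fin_sub by (subst sum.Sigma) auto
  also have "\<dots> = (\<Sum>(A, B)\<in>Sigma (Pow S) (\<lambda>A. Pow (S - A)).
      ?e A (S - A) * ?e B (S - A - B) * coef u A * coef v B * coef w (S - A - B))"
  proof (rule sum.reindex_bij_witness[of _ "\<lambda>(A, B). (A \<union> B, A)" "\<lambda>(T, A). (A, T - A)"])
    fix p assume "p \<in> Sigma (Pow S) Pow"
    then obtain T A where p: "p = (T, A)" "A \<subseteq> T" "T \<subseteq> S" by auto
    have f: "finite A" "finite (T - A)" "finite (S - T)" using p fin_sub by auto
    have "?e T (S - T) = ?e A (S - T) * ?e (T - A) (S - T)"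
      using shuffle_sign_Un_left[OF f, where 'c = 'b] p by (auto simp: Un_absorb1)
    moreover have "?e A (S - A) = ?e A (T - A) * ?e A (S - T)"
    proof -
      have "S - A = (T - A) \<union> (S - T)" using p by auto
      then show ?thesis using shuffle_sign_Un_right[OF f, where 'c = 'b] by auto
    qed
    moreover have "S - A - (T - A) = S - T" using p by auto
    ultimately show "(case case p of (T, A) \<Rightarrow> (A, T - A) of (A, B) \<Rightarrow>
        ?e A (S - A) * ?e B (S - A - B) * coef u A * coef v B * coef w (S - A - B)) =
      (case p of (T, A) \<Rightarrow>
        ?e T (S - T) * ?e A (T - A) * coef u A * coef v (T - A) * coef w (S - T))"
      by (simp add: p(1) ac_simps)
  qed (auto; fail)+
  also have "\<dots> = (\<Sum>A\<in>Pow S. \<Sum>B\<in>Pow (S - A).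
      ?e A (S - A) * ?e B (S - A - B) * coef u A * coef v B * coef w (S - A - B))"
    using fin by (subst sum.Sigma) auto
  also have "\<dots> = coef (u * (v * w)) S"
    by (simp add: coef_mult sum_distrib_left ac_simps)
  finally show "coef (u * v * w) S = coef (u * (v * w)) S" .
qed

lemma grassmann_mult_one: "1 * w = w" "w * 1 = w" for w :: "('a, 'b) grassmann"
proof -
  show "1 * w = w"
  proof (rule grassmann_eqI)
    fix S :: "'a set" assume "finite S"
    have "coef (1 * w) S =
        (\<Sum>T\<in>Pow S. if T = {} then shuffle_sign T (S - T) * coef w (S - T) else 0)"
      by (auto simp: coef_mult one_grassmann_def coef_gmonom intro!: sum.cong)
    then show "coef (1 * w) S = coef w S" using \<open>finite S\<close> by (simp add: sum.delta)
  qed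
  show "w * 1 = w"
  proof (rule grassmann_eqI)
    fix S :: "'a set" assume "finite S"
    have "coef (w * 1) S =
        (\<Sum>T\<in>Pow S. if T = S then shuffle_sign T (S - T) * coef w T else 0)"
      by (auto simp: coef_mult one_grassmann_def coef_gmonom intro!: sum.cong)
    then show "coef (w * 1) S = coef w S" using \<open>finite S\<close> by (simp add: sum.delta)
  qed
qed

instance
proof
  show "(0 :: ('a, 'b) grassmann) \<noteq> 1"
    by (metis coef_gmonom coef_zero finite.emptyI one_grassmann_def zero_neq_one)
  fix u v w :: "('a, 'b) grassmann"
  show "(u + v) * w = u * w + v * w"
    by (rule grassmann_eqI) (simp add: coef_mult algebra_simps sum.distrib)
  show "u * (v + w) = u * v + u * w"
    by (rule grassmann_eqI) (simp add: coef_mult algebra_simps sum.distrib)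
qed (simp_all add: grassmann_mult_assoc grassmann_mult_one)

end


lemma grassmann_expand: "w = (\<Sum>S\<in>supp w. gmonom S (coef w S))"
  for w :: "('g, 'a::ab_group_add) grassmann"
proof (rule grassmann_eqI)
  fix S :: "'g set" assume "finite S"
  have "coef (\<Sum>S\<in>supp w. gmonom S (coef w S)) S = (\<Sum>T\<in>supp w. if T = S then coef w T else 0)"
    by (auto simp: coef_gmonom finite_of_supp intro!: sum.cong)
  also have "\<dots> = coef w S" by (simp add: sum.delta') (simp add: supp_def)
  finally show "coef w S = coef (\<Sum>S\<in>supp w. gmonom S (coef w S)) S" ..
qed

lemma gmonom_mult:
  fixes c d :: "'a::comm_ring_1"
  assumes "finite S" "finite T"
  shows "gmonom S c * gmonom T d =
    (if S \<inter> T = {} then gmonom (S \<union> T) (shuffle_sign S T * c * d) else 0)"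
proof (rule grassmann_eqI)
  fix A :: "'b set" assume "finite A"
  have "coef (gmonom S c * gmonom T d) A =
      (\<Sum>B\<in>Pow A. if B = S then (if A - S = T then shuffle_sign S T * c * d else 0) else 0)"
    unfolding coef_mult using assms by (intro sum.cong) (auto simp: coef_gmonom)
  also have "\<dots> = (if S \<subseteq> A \<and> A - S = T then shuffle_sign S T * c * d else 0)"
    using \<open>finite A\<close> by (simp add: sum.delta)
  also have "S \<subseteq> A \<and> A - S = T \<longleftrightarrow> S \<inter> T = {} \<and> A = S \<union> T" by auto
  finally show "coef (gmonom S c * gmonom T d) A = coef (if S \<inter> T = {}
      then gmonom (S \<union> T) (shuffle_sign S T * c * d) else 0) A"
    using assms by (simp add: coef_gmonom)
qed

lemma gen_square: "gen g * gen g = (0 :: ('g::linorder, 'a::comm_ring_1) grassmann)"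
  by (simp add: gmonom_mult)

lemma shuffle_sign_singleton:
  "shuffle_sign {g} {h} = (if h < g then -1 else 1 :: 'a::comm_ring_1)"
proof -
  have "{(a, b). a = g \<and> b = h \<and> b < a} = (if h < g then {(g, h)} else {})" by auto
  then show ?thesis by (simp add: shuffle_sign_def)
qed

lemma shuffle_sign_square [simp]: "shuffle_sign S T * shuffle_sign S T = (1 :: 'a::comm_ring_1)"
  by (simp add: shuffle_sign_def flip: power_mult_distrib)

lemma gmonom_uminus: "gmonom S (- c) = - gmonom S (c :: 'a::ab_group_add)"
  by (rule grassmann_eqI) (simp add: coef_gmonom)

lemma gmonom_add: "gmonom S (c + d) = gmonom S c + gmonom S (d :: 'a::ab_group_add)"
  by (rule grassmann_eqI) (simp add: coef_gmonom)

lemma gmonom_zero [simp]: "gmonom S 0 = (0 :: ('g, 'a::ab_group_add) grassmann)"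
  by (rule grassmann_eqI) (simp add: coef_gmonom)

lemma gen_anticommute:
  "gen g * gen h = - (gen h * gen g :: ('g::linorder, 'a::comm_ring_1) grassmann)"
  by (cases g h rule: linorder_cases)
    (auto simp: gmonom_mult shuffle_sign_singleton insert_commute gmonom_uminus)

text \<open>The basis monomial of \<open>S\<close> is the increasing product of the variables in \<open>S\<close>:\<close>

lemma gmonom_eq_prod:
  fixes c :: "'a::comm_ring_1"
  assumes "finite S"
  shows "gmonom S c = gconst c * prod_list (map gen (sorted_list_of_set S))"
  using assms
proof (induction S rule: finite_linorder_min_induct)
  case empty
  then show ?case by (simp flip: one_grassmann_def)
next
  case (insert g S)
  then have g: "g \<notin> S" by auto
  have "gen g * gconst c = (gconst c * gen g :: ('b, 'a) grassmann)"
    by (simp add: gmonom_mult)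
  moreover have "shuffle_sign {g} S = (1 :: 'a)"
  proof -
    have none: "{(a, b). a \<in> {g} \<and> b \<in> S \<and> b < a} = {}" using insert(2) by fastforce
    show ?thesis unfolding shuffle_sign_def none by simp
  qed
  then have "gmonom (insert g S) c = gen g * gmonom S c"
    using insert(1) g by (simp add: gmonom_mult)
  moreover have "sorted_list_of_set (insert g S) = g # sorted_list_of_set S"
  proof -
    have "insort g (sorted_list_of_set S) = g # sorted_list_of_set S"
      using insert by (intro insort_is_Cons) (auto intro: less_imp_le)
    then show ?thesis using insert g by (simp add: sorted_list_of_set_insert_remove)
  qed
  ultimately show ?case using insert.IH by (simp add: mult.assoc[symmetric])
qed

lemma linear_extension_add:
  fixes T :: "'g set \<Rightarrow> 'a::ab_group_add \<Rightarrow> 'b::ab_group_add"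
  assumes "\<And>S c d. T S (c + d) = T S c + T S d"
  shows "(\<Sum>S\<in>supp (v + w). T S (coef (v + w) S)) =
    (\<Sum>S\<in>supp v. T S (coef v S)) + (\<Sum>S\<in>supp w. T S (coef w S))"
proof -
  have T0: "T S 0 = 0" for S using assms[of S 0 0] by simp
  let ?A = "supp v \<union> supp w"
  have ext: "(\<Sum>S\<in>supp u. T S (coef u S)) = (\<Sum>S\<in>?A. T S (coef u S))" if "supp u \<subseteq> ?A" for u
    using that by (intro sum.mono_neutral_left) (simp_all, auto simp: supp_def T0)
  have "supp (v + w) \<subseteq> ?A" by (auto simp: supp_def)
  then show ?thesis using ext[of "v + w"] ext[of v] ext[of w] by (simp add: assms sum.distrib)
qed

lemma linear_extension_gmonom:
  assumes "T S 0 = 0" "finite S"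
  shows "(\<Sum>A\<in>supp (gmonom S c). T A (coef (gmonom S c) A)) = T S c"
proof (cases "c = 0")
  case True
  then show ?thesis using assms by (simp add: supp_def coef_gmonom)
next
  case False
  then have "supp (gmonom S c) = {S}" using assms by (auto simp: supp_def coef_gmonom split: if_splits)
  then show ?thesis using assms by (simp add: coef_gmonom)
qed

text \<open>
  The Koszul differential: the odd derivation, linear over the coefficients, that sends each
  variable \<open>g\<close> to the scalar \<open>v g\<close> (see \<open>koszul_gen\<close>, \<open>koszul_const_mult\<close> and
  \<open>koszul_leibniz\<close>).
\<close>

definition koszul_term :: "('g::linorder \<Rightarrow> 'a) \<Rightarrow> 'g set \<Rightarrow> 'a \<Rightarrow> ('g, 'a::comm_ring_1) grassmann" where
  "koszul_term v S c = (\<Sum>g\<in>S. gmonom (S - {g}) (shuffle_sign {g} (S - {g}) * c * v g))"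

definition koszul :: "('g::linorder \<Rightarrow> 'a) \<Rightarrow> ('g, 'a) grassmann \<Rightarrow> ('g, 'a::comm_ring_1) grassmann" where
  "koszul v w = (\<Sum>S\<in>supp w. koszul_term v S (coef w S))"

lemma koszul_term_add: "koszul_term v S (c + d) = koszul_term v S c + koszul_term v S d"
  by (simp add: koszul_term_def gmonom_add algebra_simps sum.distrib)

lemma koszul_add: "koszul v (a + b) = koszul v a + koszul v b"
  unfolding koszul_def by (rule linear_extension_add) (rule koszul_term_add)

lemma koszul_zero [simp]: "koszul v 0 = 0"
  using koszul_add[of v 0 0] by simp

lemma koszul_sum: "koszul v (sum h A) = (\<Sum>a\<in>A. koszul v (h a))"
  by (induction A rule: infinite_finite_induct) (simp_all add: koszul_add)

lemma koszul_gmonom: "finite S \<Longrightarrow> koszul v (gmonom S c) = koszul_term v S c"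
  unfolding koszul_def by (rule linear_extension_gmonom) (simp_all add: koszul_term_def)

lemma koszul_gen: "koszul v (gen g) = gconst (v g)"
  by (simp add: koszul_gmonom koszul_term_def)

lemma grassmann_induct [case_names zero add gmonom]:
  fixes w :: "('g, 'a::ab_group_add) grassmann"
  assumes "P 0" "\<And>a b. P a \<Longrightarrow> P b \<Longrightarrow> P (a + b)" "\<And>S c. finite S \<Longrightarrow> P (gmonom S c)"
  shows "P w"
proof -
  have "P (\<Sum>S\<in>A. gmonom S (coef w S))" if "finite A" "\<And>S. S \<in> A \<Longrightarrow> finite S" for A
    using that by (induction A rule: finite_induct) (auto intro: assms)
  from this[of "supp w"] show ?thesis
    using grassmann_expand[of w] finite_of_supp[of _ w] by simp
qed

lemma koszul_const_mult: "koszul v (gconst c * w) = gconst c * koszul v w"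
proof (induction w rule: grassmann_induct)
  case (gmonom S d)
  then show ?case
    by (auto simp: gmonom_mult koszul_gmonom koszul_term_def sum_distrib_left mult.left_commute
        mult.assoc intro!: sum.cong)
qed (simp_all add: koszul_add distrib_left)

lemma koszul_gen_mult: "koszul v (gen g * w) = gconst (v g) * w - gen g * koszul v w"
proof (induction w rule: grassmann_induct)
  case (gmonom S c)
  have fin: "finite (S - {h})" for h using gmonom by simp
  show ?case
  proof (cases "g \<in> S")
    case True
    have "gen g * koszul v (gmonom S c) = (\<Sum>h\<in>S. if h = g then gmonom S (c * v g) else 0)"
      using gmonom True
      by (auto simp: koszul_gmonom koszul_term_def sum_distrib_left gmonom_mult insert_absorb
          mult.assoc[symmetric] intro!: sum.cong)
    then show ?thesis using gmonom True by (simp add: gmonom_mult sum.delta mult.commute)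
  next
    case False
    have sgn: "shuffle_sign {h} (insert g (S - {h})) * shuffle_sign {g} S =
        - (shuffle_sign {g} (S - {h}) * shuffle_sign {h} (S - {h}) :: 'b)" if "h \<in> S" for h
    proof -
      have 1: "shuffle_sign {h} ({g} \<union> (S - {h})) =
          (shuffle_sign {h} {g} * shuffle_sign {h} (S - {h}) :: 'b)"
        using fin False by (intro shuffle_sign_Un_right) auto
      have 2: "shuffle_sign {g} ({h} \<union> (S - {h})) =
          (shuffle_sign {g} {h} * shuffle_sign {g} (S - {h}) :: 'b)"
        using fin by (intro shuffle_sign_Un_right) auto
      have 3: "{h} \<union> (S - {h}) = S" using that by auto
      have "h \<noteq> g" using that False by auto
      then have 4: "shuffle_sign {h} {g} * shuffle_sign {g} {h} = (-1 :: 'b)"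
        by (auto simp: shuffle_sign_singleton)
      have "shuffle_sign {h} (insert g (S - {h})) * shuffle_sign {g} S =
          (shuffle_sign {h} {g} * shuffle_sign {g} {h}) *
          (shuffle_sign {g} (S - {h}) * shuffle_sign {h} (S - {h}) :: 'b)"
        using 1 2 3 by (simp add: ac_simps)
      then show ?thesis using 4 by simp
    qed
    have "gen g * koszul v (gmonom S c) = (\<Sum>h\<in>S.
        gmonom (insert g (S - {h})) (shuffle_sign {g} (S - {h}) * shuffle_sign {h} (S - {h}) * c * v h))"
      using gmonom False
      by (auto simp: koszul_gmonom koszul_term_def sum_distrib_left gmonom_mult mult.assoc intro!: sum.cong)
    also have "\<dots> = - (\<Sum>h\<in>S. gmonom (insert g S - {h})
        (shuffle_sign {h} (insert g S - {h}) * (shuffle_sign {g} S * c) * v h))"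
      unfolding sum_negf[symmetric]
    proof (rule sum.cong[OF refl])
      fix h assume h: "h \<in> S"
      then have "insert g (S - {h}) = insert g S - {h}" using False by auto
      then show "gmonom (insert g (S - {h}))
          (shuffle_sign {g} (S - {h}) * shuffle_sign {h} (S - {h}) * c * v h) =
        - gmonom (insert g S - {h})
          (shuffle_sign {h} (insert g S - {h}) * (shuffle_sign {g} S * c) * v h)"
        using sgn[OF h] by (simp add: gmonom_uminus[symmetric] mult.assoc[symmetric])
    qed
    finally have "gen g * koszul v (gmonom S c) = \<dots>" .
    moreover have "insert g S - {g} = S" using False by auto
    ultimately show ?thesis using gmonom False
      by (simp add: gmonom_mult koszul_gmonom koszul_term_def mult.assoc[symmetric] mult.commute[of c])
  qed
qed (simp_all add: koszul_add distrib_left)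

definition homogeneous :: "nat \<Rightarrow> ('g, 'a::zero) grassmann \<Rightarrow> bool" where
  "homogeneous p w \<longleftrightarrow> (\<forall>S\<in>supp w. even (card S) = even p)"

lemma koszul_leibniz:
  assumes "homogeneous p a"
  shows "koszul v (a * b) = koszul v a * b + (-1) ^ p * a * koszul v b"
proof -
  have *: "koszul v (gmonom S c * b) =
      koszul v (gmonom S c) * b + (-1) ^ card S * gmonom S c * koszul v b" if "finite S" for S c
    using that
  proof (induction S arbitrary: c rule: finite_induct)
    case empty
    then show ?case by (simp add: koszul_const_mult koszul_gmonom koszul_term_def)
  next
    case (insert g S)
    have eq: "gmonom (insert g S) c = gen g * gmonom S (shuffle_sign {g} S * c)"
      using insert by (simp add: gmonom_mult mult.assoc[symmetric])
    have comm: "gen g * (-1) ^ k = (-1) ^ k * gen g" for k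
      by (induction k) auto
    show ?case unfolding eq using insert
      by (simp add: mult.assoc koszul_gen_mult algebra_simps)
        (simp add: mult.assoc[symmetric] comm)
  qed
  have sgn: "(-1) ^ card S = ((-1) ^ p :: ('a, 'b) grassmann)" if "S \<in> supp a" for S
    using assms that by (metis homogeneous_def neg_one_even_power neg_one_odd_power)
  have "koszul v (a * b) = (\<Sum>S\<in>supp a. koszul v (gmonom S (coef a S) * b))"
    by (subst grassmann_expand[of a]) (simp add: sum_distrib_right koszul_sum)
  also have "\<dots> = (\<Sum>S\<in>supp a. koszul v (gmonom S (coef a S)) * b +
      (-1) ^ p * gmonom S (coef a S) * koszul v b)"
    using sgn by (intro sum.cong) (auto simp: * finite_of_supp)
  also have "\<dots> = koszul v (\<Sum>S\<in>supp a. gmonom S (coef a S)) * b +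
      (-1) ^ p * (\<Sum>S\<in>supp a. gmonom S (coef a S)) * koszul v b"
    by (simp add: sum.distrib koszul_sum sum_distrib_left sum_distrib_right)
  finally show ?thesis by (simp flip: grassmann_expand)
qed


text \<open>
  The algebra homomorphism that acts on the coefficients by \<open>\<alpha>\<close> and substitutes \<open>\<sigma> g\<close> for each
  variable \<open>g\<close>; the elements \<open>\<sigma> g\<close> are meant to anticommute and to have square zero.
\<close>

definition gsubst :: "('a \<Rightarrow> 'b) \<Rightarrow> ('g::linorder \<Rightarrow> ('h::linorder, 'b) grassmann) \<Rightarrow>
    ('g, 'a::comm_ring_1) grassmann \<Rightarrow> ('h, 'b::comm_ring_1) grassmann" where
  "gsubst \<alpha> \<sigma> w =
    (\<Sum>S\<in>supp w. gconst (\<alpha> (coef w S)) * prod_list (map \<sigma> (sorted_list_of_set S)))"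

text \<open>The component of \<open>w\<close> of parity \<open>p mod 2\<close>:\<close>

definition gpart :: "nat \<Rightarrow> ('g, 'a::ab_group_add) grassmann \<Rightarrow> ('g, 'a) grassmann" where
  "gpart p w = (\<Sum>S\<in>{S \<in> supp w. even (card S) = even p}. gmonom S (coef w S))"

text \<open>
  The contraction of a function \<open>w\<close>, written first, with a linear map \<open>\<phi>\<close> of parity \<open>p\<close>, that is
  \<open>(-1)\<^bsup>|w| p\<^esup> \<phi> w\<close> for homogeneous \<open>w\<close>:
\<close>

definition contract_map :: "nat \<Rightarrow>
    (('g, 'a) grassmann \<Rightarrow> ('h, 'b) grassmann) \<Rightarrow>
    ('g, 'a::ab_group_add) grassmann \<Rightarrow> ('h::linorder, 'b::comm_ring_1) grassmann" where
  "contract_map p \<phi> w = (\<Sum>q\<in>{0, 1}. (-1) ^ (q * p) * \<phi> (gpart q w))"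

text \<open>The boundary \<open>\<partial>[\<phi>]\<close> of a linear map \<open>\<phi>\<close> of parity \<open>p\<close>:\<close>

definition map_boundary :: "(('g, 'a) grassmann \<Rightarrow> ('g, 'a) grassmann) \<Rightarrow> nat \<Rightarrow>
    (('g, 'a) grassmann \<Rightarrow> ('g, 'a) grassmann) \<Rightarrow>
    ('g::linorder, 'a::comm_ring_1) grassmann \<Rightarrow> ('g, 'a) grassmann" where
  "map_boundary d p \<phi> h = d (\<phi> h) - (-1) ^ p * \<phi> (d h)"

definition homologous :: "('g, 'a) grassmann set \<Rightarrow>
    (('g, 'a) grassmann \<Rightarrow> ('g, 'a) grassmann) \<Rightarrow>
    ('g, 'a::ab_group_add) grassmann \<Rightarrow> ('g, 'a) grassmann \<Rightarrow> bool" where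
  "homologous C d c' c'' \<longleftrightarrow> c' \<in> C \<and> c'' \<in> C \<and> (\<exists>c\<in>C. c' - c'' = d c)"


section \<open>Polynomials\<close>

type_synonym ('v, 'r) mpoly = "('v \<Rightarrow>\<^sub>0 nat) \<Rightarrow>\<^sub>0 'r"

definition pvar :: "'v \<Rightarrow> ('v, 'r::comm_ring_1) mpoly" where
  "pvar v = Poly_Mapping.single (Poly_Mapping.single v 1) 1"

definition pconst :: "'r \<Rightarrow> ('v, 'r::comm_ring_1) mpoly" where
  "pconst r = Poly_Mapping.single 0 r"

definition polys :: "'v set \<Rightarrow> ('v, 'r::comm_ring_1) mpoly set" where
  "polys V = {p. \<forall>m\<in>Poly_Mapping.keys p. Poly_Mapping.keys m \<subseteq> V}"

definition psubst :: "('v \<Rightarrow> ('w, 'r) mpoly) \<Rightarrow> ('v, 'r) mpoly \<Rightarrow> ('w, 'r::comm_ring_1) mpoly" where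
  "psubst \<sigma> p = (\<Sum>m\<in>Poly_Mapping.keys p. pconst (Poly_Mapping.lookup p m) *
    (\<Prod>v\<in>Poly_Mapping.keys m. \<sigma> v ^ Poly_Mapping.lookup m v))"

definition mono_part :: "'v set \<Rightarrow> ('v \<Rightarrow>\<^sub>0 nat) \<Rightarrow> 'v \<Rightarrow>\<^sub>0 nat" where
  "mono_part P m = (\<Sum>v\<in>Poly_Mapping.keys m \<inter> P.
    Poly_Mapping.single v (Poly_Mapping.lookup m v))"

text \<open>
  \<open>Lambda P V\<close> is the Grassmann algebra in the variables \<open>V\<close> over the polynomials in \<open>P\<close>.
\<close>

definition Lambda :: "'v set \<Rightarrow> 'g set \<Rightarrow> ('g, ('v, 'r::comm_ring_1) mpoly) grassmann set" where
  "Lambda P V = {w. \<forall>S\<in>supp w. S \<subseteq> V \<and> coef w S \<in> polys P}"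

definition scalar :: "'r \<Rightarrow> ('g, ('v, 'r::comm_ring_1) mpoly) grassmann" where
  "scalar r = gconst (pconst r)"

text \<open>
  Let \<open>\<phi>\<close> be a linear map of parity \<open>p\<close> on the functions of the polynomial variables \<open>P\<close> and the
  Grassmann variables \<open>V\<close>.  Its extension to functions with further variables is linear in the
  other polynomial variables and satisfies \<open>\<phi> (\<theta> w) = (-1)\<^bsup>p |\<theta>|\<^esup> \<theta> \<phi> w\<close> for products \<open>\<theta>\<close> of
  the other Grassmann variables.  Accordingly, each term of the argument is written as
  \<open>\<plusminus> q \<theta> w\<close> with \<open>w\<close> a term in \<open>P\<close> and \<open>V\<close> and \<open>q\<close> a monomial in the other polynomial
  variables; the sign is that of moving \<open>\<theta>\<close> in front of \<open>w\<close>.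
\<close>

definition extend_map :: "'v set \<Rightarrow> 'g set \<Rightarrow> nat \<Rightarrow>
    (('g, ('v, 'r) mpoly) grassmann \<Rightarrow> ('g, ('v, 'r) mpoly) grassmann) \<Rightarrow>
    ('g::linorder, ('v, 'r::comm_ring_1) mpoly) grassmann \<Rightarrow> ('g, ('v, 'r) mpoly) grassmann" where
  "extend_map P V p \<phi> u = (\<Sum>S\<in>supp u. \<Sum>m\<in>Poly_Mapping.keys (coef u S).
    (-1) ^ (p * card (S - V)) *
    gmonom (S - V) (shuffle_sign (S - V) (S \<inter> V) * Poly_Mapping.single (mono_part (- P) m) 1) *
    \<phi> (gmonom (S \<inter> V) (Poly_Mapping.single (mono_part P m) (Poly_Mapping.lookup (coef u S) m))))"


section \<open>Functionals\<close>

text \<open>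
  A functional on a complex \<open>C\<close> is a function on the whole algebra of which only the restriction
  to \<open>C\<close> matters.  As \<open>\<R>\<close> is purely even, the component of parity \<open>p\<close> of a functional \<open>L\<close> is
  \<open>\<lambda>w. L (gpart p w)\<close>.
\<close>

definition dual_complex :: "('g, ('v, 'r) mpoly) grassmann set \<Rightarrow>
    (('g::linorder, ('v, 'r::comm_ring_1) mpoly) grassmann \<Rightarrow> 'r) set" where
  "dual_complex C = {L. (\<forall>a\<in>C. \<forall>b\<in>C. L (a + b) = L a + L b) \<and> (\<forall>r. \<forall>a\<in>C. L (scalar r * a) = r * L a)}"

text \<open>
  For \<open>L\<close> of parity \<open>p\<close> this is \<open>-(-1)\<^sup>p L \<circ> d\<close>, since \<open>\<R>\<close> carries the zero differential.
\<close>

definition functional_boundary :: "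
    (('g, ('v, 'r) mpoly) grassmann \<Rightarrow> ('g, ('v, 'r) mpoly) grassmann) \<Rightarrow>
    (('g, ('v, 'r) mpoly) grassmann \<Rightarrow> 'r) \<Rightarrow>
    ('g, ('v, 'r::comm_ring_1) mpoly) grassmann \<Rightarrow> 'r" where
  "functional_boundary d L h = - (\<Sum>p\<in>{0, 1}. (-1) ^ p * L (gpart p (d h)))"

text \<open>Contraction of a function, written first, with a functional in the variables \<open>P\<close> and \<open>V\<close>:\<close>

definition functional_contract :: "'v set \<Rightarrow> 'g set \<Rightarrow>
    ('g::linorder, ('v, 'r::comm_ring_1) mpoly) grassmann \<Rightarrow>
    (('g, ('v, 'r) mpoly) grassmann \<Rightarrow> 'r) \<Rightarrow> ('g, ('v, 'r) mpoly) grassmann" where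
  "functional_contract P V w L =
    (\<Sum>p\<in>{0, 1}. contract_map p (extend_map P V p (\<lambda>u. scalar (L (gpart p u)))) w)"


section \<open>The variables and the complexes\<close>

datatype side = Xv | Yv

text \<open>
  \<open>hat_u k\<close>, \<open>hat_f c i\<close>, \<open>hat_F c j\<close> stand for the variables of the collections named after \<open>u\<close>, \<open>f\<close>
  and \<open>F\<close>, the latter two with index \<open>c = x\<close> or \<open>c = y\<close>; \<open>(c, k)\<close> is the \<open>k\<close>-th polynomial
  variable of \<open>x\<close> or \<open>y\<close>.  All indices start from 0.  The elements of the theory live in the
  Grassmann algebra in all these variables over the polynomials in \<open>x\<close> and \<open>y\<close>, each complex being
  a subalgebra.
\<close>

datatype gvar = hat_u nat | hat_f side nat | hat_F side nat

fun gvar_rank :: "gvar \<Rightarrow> nat \<times> nat" where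
  "gvar_rank (hat_u k) = (0, k)"
| "gvar_rank (hat_f Xv i) = (1, i)"
| "gvar_rank (hat_f Yv i) = (2, i)"
| "gvar_rank (hat_F Xv j) = (3, j)"
| "gvar_rank (hat_F Yv j) = (4, j)"

lemma gvar_rank_inject: "gvar_rank g = gvar_rank h \<Longrightarrow> g = h"
  by (cases g rule: gvar_rank.cases; cases h rule: gvar_rank.cases) auto

instantiation gvar :: linorder
begin

definition less_gvar :: "gvar \<Rightarrow> gvar \<Rightarrow> bool" where
  "g < h \<longleftrightarrow> fst (gvar_rank g) < fst (gvar_rank h) \<or>
    fst (gvar_rank g) = fst (gvar_rank h) \<and> snd (gvar_rank g) < snd (gvar_rank h)"

definition less_eq_gvar :: "gvar \<Rightarrow> gvar \<Rightarrow> bool" where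
  "g \<le> h \<longleftrightarrow> g < h \<or> g = (h :: gvar)"

instance
proof
  fix g h :: gvar
  show "g \<le> h \<or> h \<le> g"
    unfolding less_eq_gvar_def less_gvar_def
    by (metis gvar_rank_inject nat_neq_iff prod_eqI)
qed (auto simp: less_gvar_def less_eq_gvar_def)

end

type_synonym 'r poly_n = "(nat, 'r) mpoly"
type_synonym 'r poly_xy = "(side \<times> nat, 'r) mpoly"
type_synonym 'r elem = "(gvar, 'r poly_xy) grassmann"

definition at_side :: "side \<Rightarrow> 'r poly_n \<Rightarrow> 'r::comm_ring_1 poly_xy" where
  "at_side c H = psubst (\<lambda>k. pvar (c, k)) H"

definition pvars :: "side \<Rightarrow> nat \<Rightarrow> (side \<times> nat) set" where
  "pvars c n = {c} \<times> {..<n}"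

definition small_vars :: "side \<Rightarrow> nat \<Rightarrow> gvar set" where
  "small_vars c s = hat_f c ` {..<s}"

definition big_vars :: "side \<Rightarrow> nat \<Rightarrow> gvar set" where
  "big_vars c t = hat_F c ` {..<t}"

definition differential :: "(nat \<Rightarrow> 'r poly_n) \<Rightarrow> (nat \<Rightarrow> 'r poly_n) \<Rightarrow> 'r elem \<Rightarrow> 'r::comm_ring_1 elem" where
  "differential f F = koszul (\<lambda>g. case g of hat_u k \<Rightarrow> 0 | hat_f c i \<Rightarrow> at_side c (f i) | hat_F c j \<Rightarrow> at_side c (F j))"

definition difference_quotients :: "nat \<Rightarrow> ('r::comm_ring_1 poly_n \<Rightarrow> nat \<Rightarrow> 'r poly_xy) \<Rightarrow> bool" where
  "difference_quotients n nabla \<longleftrightarrow> (\<forall>H\<in>polys {..<n}.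
    (\<forall>k<n. nabla H k \<in> polys (pvars Xv n \<union> pvars Yv n)) \<and>
    (\<Sum>k<n. (pvar (Xv, k) - pvar (Yv, k)) * nabla H k) = at_side Xv H - at_side Yv H)"

text \<open>\<open>in_y L\<close> is \<open>L\<close>, a functional in the variables with index \<open>x\<close>, with \<open>x\<close> renamed to \<open>y\<close>.\<close>

fun y_to_x :: "gvar \<Rightarrow> gvar" where
  "y_to_x (hat_u k) = hat_u k"
| "y_to_x (hat_f c i) = hat_f Xv i"
| "y_to_x (hat_F c j) = hat_F Xv j"

definition in_y :: "('r elem \<Rightarrow> 'r) \<Rightarrow> 'r::comm_ring_1 elem \<Rightarrow> 'r" where
  "in_y L w = L (gsubst (psubst (\<lambda>(c, k). pvar (Xv, k))) (\<lambda>g. gen (y_to_x g)) w)"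


section \<open>Determinants\<close>

definition u_product :: "nat \<Rightarrow> 'r::comm_ring_1 elem" where
  "u_product n = prod_list (map (\<lambda>k. gen (hat_u k)) [0..<n])"

lemma not_less_hat_u: "h \<notin> range hat_u \<Longrightarrow> \<not> h < hat_u k"
  by (cases h rule: gvar_rank.cases) (auto simp: less_gvar_def)

lemma shuffle_sign_ordered:
  assumes "\<And>a b. a \<in> S \<Longrightarrow> b \<in> T \<Longrightarrow> \<not> b < a"
  shows "shuffle_sign S T = (1 :: 'a::comm_ring_1)"
proof -
  have none: "{(a, b). a \<in> S \<and> b \<in> T \<and> b < a} = {}" using assms by auto
  show ?thesis unfolding shuffle_sign_def none by simp
qed

lemma u_product_eq: "u_product n = (gmonom (hat_u ` {..<n}) 1 :: 'r::comm_ring_1 elem)"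
proof (induction n)
  case 0
  then show ?case by (simp add: u_product_def one_grassmann_def)
next
  case (Suc n)
  have "shuffle_sign (hat_u ` {..<n}) {hat_u n} = (1 :: 'r poly_xy)"
    by (intro shuffle_sign_ordered) (auto simp: less_gvar_def)
  moreover have "hat_u ` {..<n} \<union> {hat_u n} = hat_u ` {..<Suc n}"
    by (auto simp: lessThan_Suc)
  moreover have "u_product (Suc n) = u_product n * (gen (hat_u n) :: 'r elem)"
    by (simp add: u_product_def)
  ultimately show ?case using Suc by (auto simp: gmonom_mult)
qed

lemma Lambda_UNIV: "w \<in> Lambda UNIV V \<longleftrightarrow> (\<forall>S\<in>supp w. S \<subseteq> V)"
  by (simp add: Lambda_def polys_def)

lemma Lambda_add: "v \<in> Lambda UNIV V \<Longrightarrow> w \<in> Lambda UNIV V \<Longrightarrow> v + w \<in> Lambda UNIV V"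
  unfolding Lambda_UNIV supp_def by (metis (mono_tags, lifting) add_0 coef_add mem_Collect_eq)

lemma Lambda_zero: "0 \<in> Lambda UNIV V"
  by (simp add: Lambda_UNIV supp_def)

lemma Lambda_sum: "(\<And>a. a \<in> A \<Longrightarrow> h a \<in> Lambda UNIV V) \<Longrightarrow> sum h A \<in> Lambda UNIV V"
  by (induction A rule: infinite_finite_induct) (auto intro: Lambda_add Lambda_zero)

lemma Lambda_gmonom: "S \<subseteq> V \<Longrightarrow> gmonom S c \<in> Lambda UNIV V"
  by (auto simp: Lambda_UNIV supp_def coef_gmonom split: if_splits)

lemma Lambda_mult:
  assumes "v \<in> Lambda UNIV V" "w \<in> Lambda UNIV V"
  shows "v * w \<in> Lambda UNIV V"
  unfolding Lambda_UNIV
proof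
  fix S assume "S \<in> supp (v * w)"
  then have "(\<Sum>T\<in>Pow S. shuffle_sign T (S - T) * coef v T * coef w (S - T)) \<noteq> 0"
    by (simp add: supp_def coef_mult)
  then obtain T where T: "T \<subseteq> S" "shuffle_sign T (S - T) * coef v T * coef w (S - T) \<noteq> 0"
    by (auto elim: sum.not_neutral_contains_not_neutral)
  then have "coef v T \<noteq> 0" "coef w (S - T) \<noteq> 0" by auto
  then have "T \<subseteq> V" "S - T \<subseteq> V" using assms by (auto simp: Lambda_UNIV supp_def)
  then show "S \<subseteq> V" using T by blast
qed

lemma Lambda_prod_list: "\<forall>a\<in>set as. a \<in> Lambda UNIV V \<Longrightarrow> prod_list as \<in> Lambda UNIV V"
  by (induction as) (auto intro: Lambda_mult Lambda_gmonom simp: one_grassmann_def)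

definition u_component :: "nat \<Rightarrow> 'r elem \<Rightarrow> 'r::comm_ring_1 elem" where
  "u_component n w = (\<Sum>S\<in>{S \<in> supp w. card (S \<inter> range hat_u) = n}. gmonom S (coef w S))"

definition nabla_product ::
    "nat \<Rightarrow> nat \<Rightarrow> (nat \<Rightarrow> nat \<Rightarrow> 'r poly_xy) \<Rightarrow> (nat \<Rightarrow> 'r elem) \<Rightarrow> 'r::comm_ring_1 elem" where
  "nabla_product n m D w =
    prod_list (map (\<lambda>j. (\<Sum>k<n. gen (hat_u k) * gconst (D j k)) + w j) [0..<m])"

text \<open>
  The determinant with the row \<open>\<nabla>H\<^sub>j\<close>, given by \<open>D j k\<close> for \<open>k < n\<close>, above the row \<open>w j\<close> (\<open>j < m\<close>).
  It is well defined by \<open>nabla_det_ex1\<close>.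
\<close>

definition nabla_det ::
    "nat \<Rightarrow> nat \<Rightarrow> (nat \<Rightarrow> nat \<Rightarrow> 'r poly_xy) \<Rightarrow> (nat \<Rightarrow> 'r elem) \<Rightarrow> 'r::comm_ring_1 elem" where
  "nabla_det n m D w =
    (THE Q. Q \<in> Lambda UNIV (- range hat_u) \<and> u_product n * Q = u_component n (nabla_product n m D w))"

lemma nabla_det_ex1:
  assumes "\<forall>j<m. w j \<in> Lambda UNIV (- range hat_u)"
  shows "\<exists>!Q. Q \<in> Lambda UNIV (- range hat_u) \<and>
    u_product n * Q = u_component n (nabla_product n m D w)"
proof -
  let ?P = "nabla_product n m D w" and ?U = "hat_u ` {..<n}"
  let ?I = "{S \<in> supp ?P. card (S \<inter> range hat_u) = n}"
  have u_mult: "u_product n * gmonom T c = gmonom (?U \<union> T) c"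
    if "finite T" "T \<inter> range hat_u = {}" for T and c :: "'a poly_xy"
  proof -
    have "shuffle_sign ?U T = (1 :: 'a poly_xy)"
      using that by (intro shuffle_sign_ordered) (metis disjoint_iff imageE not_less_hat_u)
    then show ?thesis using that by (auto simp: u_product_eq gmonom_mult)
  qed
  have U: "S \<inter> range hat_u = ?U" "?U \<union> (S - range hat_u) = S" "finite S" if "S \<in> ?I" for S
  proof -
    have "?P \<in> Lambda UNIV (?U \<union> - range hat_u)"
      unfolding nabla_product_def
    proof (intro Lambda_prod_list ballI)
      fix a assume "a \<in> set (map (\<lambda>j. (\<Sum>k<n. gen (hat_u k) * gconst (D j k)) + w j) [0..<m])"
      then obtain j where j: "j < m" "a = (\<Sum>k<n. gen (hat_u k) * gconst (D j k)) + w j" by auto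
      have "w j \<in> Lambda UNIV (?U \<union> - range hat_u)"
        using assms j by (auto simp: Lambda_UNIV)
      then show "a \<in> Lambda UNIV (?U \<union> - range hat_u)"
        unfolding j(2) by (intro Lambda_add Lambda_sum Lambda_mult Lambda_gmonom) auto
    qed
    then have "S \<inter> range hat_u \<subseteq> ?U" using that by (auto simp: Lambda_UNIV)
    moreover have "card ?U = n" by (simp add: card_image inj_on_def)
    ultimately show "S \<inter> range hat_u = ?U" using that by (intro card_subset_eq) auto
    then show "?U \<union> (S - range hat_u) = S" by auto
    show "finite S" using that finite_of_supp by blast
  qed
  let ?Q = "\<Sum>S\<in>?I. gmonom (S - range hat_u) (coef ?P S)"
  have "?Q \<in> Lambda UNIV (- range hat_u)" "u_product n * ?Q = u_component n ?P"
  proof -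
    show "?Q \<in> Lambda UNIV (- range hat_u)" by (intro Lambda_sum Lambda_gmonom) auto
    show "u_product n * ?Q = u_component n ?P"
      unfolding u_component_def sum_distrib_left
      proof (intro sum.cong refl)
      fix S assume S: "S \<in> ?I"
      have "u_product n * gmonom (S - range hat_u) (coef ?P S) =
          gmonom (?U \<union> (S - range hat_u)) (coef ?P S)"
        using U(3)[OF S] by (intro u_mult) auto
      then show "u_product n * gmonom (S - range hat_u) (coef ?P S) = gmonom S (coef ?P S)"
        by (simp only: U(2)[OF S])
    qed
  qed
  then obtain Q0 where Q0: "Q0 \<in> Lambda UNIV (- range hat_u)" "u_product n * Q0 = u_component n ?P"
    by blast
  show ?thesis
  proof (rule ex1I)
    show "Q0 \<in> Lambda UNIV (- range hat_u) \<and> u_product n * Q0 = u_component n ?P"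
      using Q0 by blast
    have coef: "coef (u_product n * Q) (?U \<union> T) = coef Q T"
      if "finite T" "T \<inter> range hat_u = {}" for Q :: "'a elem" and T
    proof -
      have "coef (u_product n * Q) (?U \<union> T) =
          (\<Sum>A\<in>Pow (?U \<union> T). if A = ?U then shuffle_sign ?U T * coef Q T else 0)"
        unfolding coef_mult u_product_eq
      proof (intro sum.cong refl)
        fix A
        have "?U \<union> T - ?U = T" using that by auto
        then show "shuffle_sign A (?U \<union> T - A) * coef (gmonom ?U 1) A * coef Q (?U \<union> T - A) =
            (if A = ?U then shuffle_sign ?U T * coef Q T else 0)"
          by (simp add: coef_gmonom)
      qed
      moreover have "shuffle_sign ?U T = (1 :: 'a poly_xy)"
        using that by (intro shuffle_sign_ordered) (metis disjoint_iff imageE not_less_hat_u)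
      ultimately show ?thesis using that by (simp add: sum.delta)
    qed
    fix Q :: "'a elem"
    assume Q: "Q \<in> Lambda UNIV (- range hat_u) \<and> u_product n * Q = u_component n ?P"
    show "Q = Q0"
    proof (rule grassmann_eqI)
      fix T :: "gvar set" assume "finite T"
      show "coef Q T = coef Q0 T"
      proof (cases "T \<inter> range hat_u = {}")
        case True
        then show ?thesis using coef[OF \<open>finite T\<close> True, of Q] coef[OF \<open>finite T\<close> True, of Q0] Q Q0 by simp
      next
        case False
        then have "T \<notin> supp Q" "T \<notin> supp Q0" using Q Q0(1) unfolding Lambda_UNIV by blast+
        then show ?thesis by (simp add: supp_def)
      qed
    qed
  qed
qed

definition fG :: "side \<Rightarrow> nat \<Rightarrow> (nat \<Rightarrow> nat \<Rightarrow> 'r poly_n) \<Rightarrow> nat \<Rightarrow> 'r::comm_ring_1 elem" where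
  "fG c s G j = (\<Sum>i<s. gen (hat_f c i) * gconst (at_side c (G i j)))"

text \<open>The substitution of \<open>fG Xv s G j\<close> for \<open>hat_F Xv j\<close>, the other variables being parameters:\<close>

definition exp_fG :: "nat \<Rightarrow> nat \<Rightarrow> (nat \<Rightarrow> nat \<Rightarrow> 'r poly_n) \<Rightarrow> 'r elem \<Rightarrow> 'r::comm_ring_1 elem" where
  "exp_fG s t G = extend_map {} (big_vars Xv t) 0
    (gsubst id (\<lambda>g. case g of hat_F Xv j \<Rightarrow> fG Xv s G j | _ \<Rightarrow> gen g))"

text \<open>The functional in the variables \<open>hat_f c i\<close>, \<open>i < s\<close>, that takes the coefficient of their product:\<close>

definition det_f :: "side \<Rightarrow> nat \<Rightarrow> 'r elem \<Rightarrow> 'r::comm_ring_1 elem" where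
  "det_f c s = extend_map {} (small_vars c s) s (\<lambda>w. gconst (coef w (small_vars c s)))"

text \<open>The determinant with the dual column, as a linear map of parity \<open>s + t\<close>:\<close>

definition dual_det ::
    "side \<Rightarrow> nat \<Rightarrow> nat \<Rightarrow> (nat \<Rightarrow> nat \<Rightarrow> 'r poly_n) \<Rightarrow> 'r elem \<Rightarrow> 'r::comm_ring_1 elem" where
  "dual_det c s t G h =
    det_f c s (prod_list (map (\<lambda>j. fG c s G j - gen (hat_F c j)) [0..<t]) * h)"

text \<open>
  The functional \<open>h \<mapsto> (-1)\<^bsup>|L| |B|\<^esup> L (B h)\<close>, where \<open>B\<close> is the preceding determinant:
\<close>

definition dual_det_functional ::
    "side \<Rightarrow> nat \<Rightarrow> nat \<Rightarrow> (nat \<Rightarrow> nat \<Rightarrow> 'r poly_n) \<Rightarrow>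
      ('r elem \<Rightarrow> 'r) \<Rightarrow> 'r elem \<Rightarrow> 'r::comm_ring_1" where
  "dual_det_functional c s t G L h =
    (\<Sum>p\<in>{0, 1}. (-1) ^ (p * (s + t)) * L (gpart p (dual_det c s t G h)))"

end

theory Submission
  imports Defs
begin

text \<open>
  The idea is to treat the auxiliary variables \<open>hat_u k\<close> like the others and to give them the values
  \<open>y\<^sub>k - x\<^sub>k\<close> under a total Koszul differential \<open>D\<close>.  A determinant with a row \<open>\<nabla>H\<close> is the integral
  over the \<open>hat_u k\<close>, in the sense of Berezin, of a product of odd factors
  \<open>\<Sum>\<^sub>k hat_u k \<nabla>\<^sup>kH\<^sub>j + w\<^sub>j\<close>.  The first part of a factor contributes \<open>H\<^sub>j(y) - H\<^sub>j(x)\<close> to its value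
  under \<open>D\<close>, and in the determinants below \<open>w\<^sub>j\<close> contributes the opposite; so every factor is a cycle.
  Since the integral commutes with the differentials up to sign (\<open>koszul_berezin\<close>), the determinants
  are cycles, and homologies between the products become homologies between the determinants.

  The contraction of \<open>det \<parallel>\<nabla>f, f\<^sub>x - f\<^sub>y\<parallel>\<close> with the dual column is again such a determinant: the
  product of the factors \<open>a\<^sub>i - hat_f Yv i\<close>, where \<open>a\<^sub>i = \<Sum>\<^sub>k hat_u k \<nabla>\<^sup>kf\<^sub>i + hat_f Xv i\<close>, is a delta
  function in the variables \<open>hat_f Yv i\<close> and substitutes \<open>a\<^sub>i\<close> for \<open>hat_f Yv i\<close> in the product of the
  \<open>\<Sum>\<^sub>i hat_f Yv i G\<^sub>i\<^sub>j(y) - hat_F Yv j\<close> (\<open>delta_substitution\<close>, \<open>dual_contraction_nabla_det\<close>).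
  Since \<open>D\<close> sends \<open>a\<^sub>i\<close> to \<open>f\<^sub>i(y)\<close>, the factors that result from the substitution are cycles as well.
  So two products of cycles remain to be compared, with the factors
  \<open>\<Sum>\<^sub>k hat_u k \<nabla>\<^sup>kF\<^sub>j + \<Sum>\<^sub>i hat_f Xv i G\<^sub>i\<^sub>j(x) - hat_F Yv j\<close> and \<open>\<Sum>\<^sub>i a\<^sub>i G\<^sub>i\<^sub>j(y) - hat_F Yv j\<close>.  Corresponding
  factors are homologous: the difference \<open>G\<^sub>i\<^sub>j(x) - G\<^sub>i\<^sub>j(y)\<close> in the coefficient of \<open>hat_f Xv i\<close> is
  removed by the boundary of \<open>\<Sum>\<^sub>k hat_u k \<nabla>\<^sup>kG\<^sub>i\<^sub>j hat_f Xv i\<close>, and what is left is a cycle that is linear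
  in the \<open>hat_u k\<close>, hence a boundary, because \<open>x\<^sub>1 - y\<^sub>1, \<dots>, x\<^sub>n - y\<^sub>n\<close> is a regular sequence
  (\<open>koszul_u_cycle_is_boundary\<close>, \<open>rows_homologous\<close>).  Replacing the factors one by one makes the
  products homologous (\<open>prod_list_homotopic\<close>).

  For a functional \<open>L\<close> in the variables with index \<open>y\<close>, contraction is \<open>\<theta> w \<mapsto> \<plusminus> \<theta> L(w)\<close>, where \<open>\<theta>\<close>
  involves the variables with index \<open>x\<close> and \<open>w\<close> those with index \<open>y\<close>
  (\<open>functional_contract_mult\<close>).  It therefore commutes with substitutions in \<open>\<theta>\<close> and, if \<open>L\<close> vanishes on
  boundaries, with the differential, so that it carries the first part of the theorem over to the
  functionals.
\<close>

section \<open>Polynomials and substitution\<close>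

lemma poly_mapping_expand: "p = (\<Sum>m\<in>Poly_Mapping.keys p. Poly_Mapping.single m (Poly_Mapping.lookup p m))"
  for p :: "'k \<Rightarrow>\<^sub>0 'b::comm_monoid_add"
proof (rule poly_mapping_eqI)
  fix k
  show "Poly_Mapping.lookup p k = Poly_Mapping.lookup
      (\<Sum>m\<in>Poly_Mapping.keys p. Poly_Mapping.single m (Poly_Mapping.lookup p m)) k"
    by (simp add: lookup_sum lookup_single when_def sum.delta in_keys_iff)
qed

lemma polys_single: "Poly_Mapping.keys m \<subseteq> V \<Longrightarrow> Poly_Mapping.single m c \<in> polys V"
  by (auto simp: polys_def split: if_splits)

lemma polys_zero [simp]: "0 \<in> polys V"
  by (simp add: polys_def)

lemma polys_one [simp]: "1 \<in> polys V"
  using polys_single[of 0 V 1] by simp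

lemma polys_add: "p \<in> polys V \<Longrightarrow> q \<in> polys V \<Longrightarrow> p + q \<in> polys V"
  unfolding polys_def using keys_add[of p q] by blast

lemma polys_uminus: "p \<in> polys V \<Longrightarrow> - p \<in> polys V"
  by (simp add: polys_def in_keys_iff)

lemma polys_diff: "p \<in> polys V \<Longrightarrow> q \<in> polys V \<Longrightarrow> p - q \<in> polys V"
  using polys_add[of p V "- q"] polys_uminus[of q V] by simp

lemma polys_sum: "(\<And>a. a \<in> A \<Longrightarrow> h a \<in> polys V) \<Longrightarrow> sum h A \<in> polys V"
  by (induction A rule: infinite_finite_induct) (auto intro: polys_add)

lemma polys_mult: "p \<in> polys V \<Longrightarrow> q \<in> polys V \<Longrightarrow> p * q \<in> polys V"
proof -
  assume p: "p \<in> polys V" and q: "q \<in> polys V"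
  show ?thesis unfolding polys_def
  proof (intro CollectI ballI)
    fix m assume "m \<in> Poly_Mapping.keys (p * q)"
    then obtain a b where "m = a + b" "a \<in> Poly_Mapping.keys p" "b \<in> Poly_Mapping.keys q"
      using keys_mult[of p q] by blast
    then show "Poly_Mapping.keys m \<subseteq> V" using p q keys_add[of a b] unfolding polys_def by blast
  qed
qed

lemma polys_pvar: "v \<in> V \<Longrightarrow> pvar v \<in> polys V"
  unfolding pvar_def by (rule polys_single) auto

lemma polys_pconst [simp]: "pconst c \<in> polys V"
  unfolding pconst_def by (rule polys_single) auto

lemma polys_mono: "p \<in> polys V \<Longrightarrow> V \<subseteq> W \<Longrightarrow> p \<in> polys W"
  by (auto simp: polys_def)

lemma polys_induct [consumes 1, case_names zero add single]:
  assumes "p \<in> polys V" "Q 0"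
    and "\<And>a b. a \<in> polys V \<Longrightarrow> b \<in> polys V \<Longrightarrow> Q a \<Longrightarrow> Q b \<Longrightarrow> Q (a + b)"
    and single: "\<And>m c. Poly_Mapping.keys m \<subseteq> V \<Longrightarrow> Q (Poly_Mapping.single m c)"
  shows "Q p"
proof -
  have sums: "sum h A \<in> polys V \<and> Q (sum h A)" if "\<forall>m\<in>A. h m \<in> polys V \<and> Q (h m)" for h and A :: "('v \<Rightarrow>\<^sub>0 nat) set"
    using that by (induction A rule: infinite_finite_induct) (auto intro: assms polys_add)
  have "\<forall>m\<in>Poly_Mapping.keys p. Poly_Mapping.single m (Poly_Mapping.lookup p m) \<in> polys V \<and>
      Q (Poly_Mapping.single m (Poly_Mapping.lookup p m))"
    using assms(1) by (auto simp: polys_def[of V] intro!: single polys_single)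
  then have "Q (\<Sum>m\<in>Poly_Mapping.keys p. Poly_Mapping.single m (Poly_Mapping.lookup p m))"
    by (rule sums[THEN conjunct2])
  then show ?thesis by (simp only: poly_mapping_expand[symmetric])
qed

lemma single_monomial_induct [consumes 1, case_names zero var]:
  fixes m :: "'v \<Rightarrow>\<^sub>0 nat"
  assumes "Poly_Mapping.keys m \<subseteq> V" "Q 0"
    and var: "\<And>v m. v \<in> V \<Longrightarrow> Poly_Mapping.keys m \<subseteq> V \<Longrightarrow> Q m \<Longrightarrow> Q (Poly_Mapping.single v 1 + m)"
  shows "Q m"
  using assms(1)
proof (induction "\<Sum>v\<in>Poly_Mapping.keys m. Poly_Mapping.lookup m v" arbitrary: m rule: less_induct)
  case less
  show ?case
  proof (cases "m = 0")
    case False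
    then obtain v where v: "v \<in> Poly_Mapping.keys m"
      by (metis equals0I poly_mapping_eqI in_keys_iff lookup_zero)
    define m' where "m' = m - Poly_Mapping.single v 1"
    have look: "Poly_Mapping.lookup m' w = Poly_Mapping.lookup m w - (if w = v then 1 else 0)" for w
      by (simp add: m'_def lookup_minus lookup_single when_def)
    have m: "m = Poly_Mapping.single v 1 + m'"
      using v by (intro poly_mapping_eqI) (auto simp: lookup_add look lookup_single when_def in_keys_iff)
    have sub: "Poly_Mapping.keys m' \<subseteq> Poly_Mapping.keys m"
      by (auto simp: in_keys_iff look)
    have "(\<Sum>w\<in>Poly_Mapping.keys m'. Poly_Mapping.lookup m' w) = (\<Sum>w\<in>Poly_Mapping.keys m. Poly_Mapping.lookup m' w)"
      using sub by (intro sum.mono_neutral_left) (auto simp: in_keys_iff)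
    also have "\<dots> < (\<Sum>w\<in>Poly_Mapping.keys m. Poly_Mapping.lookup m w)"
      using v by (intro sum_strict_mono_ex1) (auto simp: look in_keys_iff)
    finally have "Q m'" using less sub by blast
    moreover have "v \<in> V" "Poly_Mapping.keys m' \<subseteq> V" using v sub less.prems by blast+
    ultimately show ?thesis using var[of v m'] by (simp only: m[symmetric])
  qed (use assms in simp)
qed

lemma polys_var_induct [consumes 1, case_names const add var]:
  assumes "p \<in> polys V" and const: "\<And>c. Q (pconst c)"
    and add: "\<And>a b. a \<in> polys V \<Longrightarrow> b \<in> polys V \<Longrightarrow> Q a \<Longrightarrow> Q b \<Longrightarrow> Q (a + b)"
    and var: "\<And>v a. v \<in> V \<Longrightarrow> a \<in> polys V \<Longrightarrow> Q a \<Longrightarrow> Q (pvar v * a)"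
  shows "Q p"
  using assms(1)
proof (induction rule: polys_induct)
  case zero
  show ?case using const[of 0] by (simp add: pconst_def)
next
  case (single m c)
  then show ?case
  proof (induction m rule: single_monomial_induct)
    case zero
    show ?case using const[of c] by (simp add: pconst_def)
  next
    case (var v m)
    have "Poly_Mapping.single (Poly_Mapping.single v 1 + m) c = pvar v * Poly_Mapping.single m c"
      by (simp add: pvar_def mult_single)
    then show ?case using assms(4)[of v] var polys_single by metis
  qed
qed (rule add)

definition monomial_subst :: "('v \<Rightarrow> ('w, 'r) mpoly) \<Rightarrow> ('v \<Rightarrow>\<^sub>0 nat) \<Rightarrow> ('w, 'r::comm_ring_1) mpoly" where
  "monomial_subst \<sigma> m = (\<Prod>v\<in>Poly_Mapping.keys m. \<sigma> v ^ Poly_Mapping.lookup m v)"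

lemma monomial_subst_superset:
  assumes "finite A" "Poly_Mapping.keys m \<subseteq> A"
  shows "monomial_subst \<sigma> m = (\<Prod>v\<in>A. \<sigma> v ^ Poly_Mapping.lookup m v)"
  unfolding monomial_subst_def using assms
  by (intro prod.mono_neutral_left) (auto simp: in_keys_iff)

lemma monomial_subst_add: "monomial_subst \<sigma> (m + m') = monomial_subst \<sigma> m * monomial_subst \<sigma> m'"
proof -
  let ?A = "Poly_Mapping.keys m \<union> Poly_Mapping.keys m'"
  have "Poly_Mapping.keys (m + m') \<subseteq> ?A" by (rule keys_add)
  then show ?thesis
    using monomial_subst_superset[of ?A m \<sigma>] monomial_subst_superset[of ?A m' \<sigma>]
      monomial_subst_superset[of ?A "m + m'" \<sigma>]
    by (simp add: lookup_add power_add prod.distrib)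
qed

lemma pconst_add: "pconst (a + b) = pconst a + pconst b"
  by (simp add: pconst_def single_add)

lemma pconst_mult: "pconst (a * b) = pconst a * pconst b"
  by (simp add: pconst_def mult_single)

lemma pconst_zero [simp]: "pconst 0 = 0"
  by (simp add: pconst_def)

lemma pconst_one [simp]: "pconst 1 = 1"
  by (simp add: pconst_def)

lemma psubst_alt: "psubst \<sigma> p = (\<Sum>m\<in>Poly_Mapping.keys p. pconst (Poly_Mapping.lookup p m) * monomial_subst \<sigma> m)"
  by (simp add: psubst_def monomial_subst_def)

lemma psubst_add: "psubst \<sigma> (p + q) = psubst \<sigma> p + psubst \<sigma> q"
proof -
  let ?A = "Poly_Mapping.keys p \<union> Poly_Mapping.keys q"
  have "psubst \<sigma> r = (\<Sum>m\<in>?A. pconst (Poly_Mapping.lookup r m) * monomial_subst \<sigma> m)"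
    if "Poly_Mapping.keys r \<subseteq> ?A" for r
    unfolding psubst_alt using that by (intro sum.mono_neutral_left) (auto simp: in_keys_iff)
  from this[of p] this[of q] this[of "p + q"] show ?thesis
    using keys_add[of p q]
    by (simp add: lookup_add pconst_add distrib_right sum.distrib)
qed

lemma psubst_zero [simp]: "psubst \<sigma> 0 = 0"
  by (simp add: psubst_alt)

lemma psubst_single: "psubst \<sigma> (Poly_Mapping.single m c) = pconst c * monomial_subst \<sigma> m"
  by (cases "c = 0") (simp_all add: psubst_alt)

lemma psubst_pconst [simp]: "psubst \<sigma> (pconst c) = pconst c"
proof -
  have "psubst \<sigma> (pconst c) = pconst c * monomial_subst \<sigma> 0"
    using psubst_single[of \<sigma> 0 c] by (simp only: pconst_def[symmetric])
  then show ?thesis by (simp add: monomial_subst_def)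
qed

lemma psubst_one [simp]: "psubst \<sigma> 1 = 1"
  using psubst_pconst[of \<sigma> 1] by simp

lemma psubst_pvar [simp]: "psubst \<sigma> (pvar v) = \<sigma> v"
  unfolding pvar_def[of v] psubst_single by (simp add: monomial_subst_def)

lemma psubst_mult: "psubst \<sigma> (p * q) = psubst \<sigma> p * psubst \<sigma> q"
proof -
  have "p \<in> polys UNIV" "q \<in> polys UNIV" by (auto simp: polys_def)
  then show ?thesis
  proof (induction p rule: polys_induct)
    case (single m c)
    from \<open>q \<in> polys UNIV\<close> show ?case
    proof (induction q rule: polys_induct)
      case (add a b)
      then show ?case by (simp only: distrib_left psubst_add)
    next
      case (single m' d)
      show ?case
        by (simp add: mult_single psubst_single pconst_mult monomial_subst_add mult_ac)
    qed simp
  qed (simp_all add: distrib_right psubst_add)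
qed

lemma psubst_uminus: "psubst \<sigma> (- p) = - psubst \<sigma> p"
proof -
  have "psubst \<sigma> p + psubst \<sigma> (- p) = 0"
    using psubst_add[of \<sigma> p "- p", symmetric] by simp
  then show ?thesis by (metis minus_unique)
qed

lemma psubst_diff: "psubst \<sigma> (p - q) = psubst \<sigma> p - psubst \<sigma> q"
  using psubst_add[of \<sigma> p "- q"] by (simp add: psubst_uminus)

lemma psubst_sum: "psubst \<sigma> (sum h A) = (\<Sum>a\<in>A. psubst \<sigma> (h a))"
  by (induction A rule: infinite_finite_induct) (simp_all add: psubst_add)

lemma psubst_polys:
  assumes "p \<in> polys V" "\<And>v. v \<in> V \<Longrightarrow> \<sigma> v \<in> polys W"
  shows "psubst \<sigma> p \<in> polys W"
  using assms(1)
  by (induction rule: polys_var_induct) (auto simp: psubst_add psubst_mult assms(2) intro: polys_add polys_mult)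

lemma psubst_psubst: "psubst \<sigma> (psubst \<tau> p) = psubst (\<lambda>v. psubst \<sigma> (\<tau> v)) p"
proof -
  have "p \<in> polys UNIV" by (auto simp: polys_def)
  then show ?thesis by (induction rule: polys_var_induct) (auto simp: psubst_add psubst_mult)
qed

lemma at_side_polys: "H \<in> polys {..<n} \<Longrightarrow> at_side c H \<in> polys (pvars c n)"
  unfolding at_side_def by (rule psubst_polys) (auto simp: pvars_def intro: polys_pvar)

lemma at_side_mult: "at_side c (p * q) = at_side c p * at_side c q"
  by (simp add: at_side_def psubst_mult)

lemma at_side_sum: "at_side c (sum h A) = (\<Sum>a\<in>A. at_side c (h a))"
  by (simp add: at_side_def psubst_sum)

lemmas at_side_simps = at_side_mult at_side_sum

text \<open>
  The coefficient of a monomial \<open>m\<close> in \<open>p\<close> is that of \<open>a m\<close> in \<open>a p = b p\<close>.  If \<open>b\<close> does not divide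
  \<open>m\<close>, this is zero; otherwise it is the coefficient of \<open>a m / b\<close> in \<open>p\<close>, where the exponent of \<open>b\<close>
  is smaller.
\<close>

lemma pvar_difference_cancel:
  fixes p :: "('v, 'r::comm_ring_1) mpoly"
  assumes "a \<noteq> b" "(pvar a - pvar b) * p = 0"
  shows "p = 0"
proof -
  let ?l = Poly_Mapping.lookup
  have look: "?l (pvar v * q) m = (if ?l m v = 0 then 0 else ?l q (m - Poly_Mapping.single v 1))"
    for v m and q :: "('v, 'r) mpoly"
  proof -
    have "q \<in> polys UNIV" by (auto simp: polys_def)
    then show ?thesis
    proof (induction rule: polys_induct)
      case (single k c)
      have "Poly_Mapping.single v 1 + k = m \<longleftrightarrow> ?l m v \<noteq> 0 \<and> k = m - Poly_Mapping.single v 1"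
      proof
        assume "Poly_Mapping.single v 1 + k = m"
        then show "?l m v \<noteq> 0 \<and> k = m - Poly_Mapping.single v 1" by (auto simp: lookup_add)
      next
        assume "?l m v \<noteq> 0 \<and> k = m - Poly_Mapping.single v 1"
        then show "Poly_Mapping.single v 1 + k = m"
          by (intro poly_mapping_eqI) (auto simp: lookup_add lookup_minus lookup_single when_def)
      qed
      then show ?case by (auto simp: pvar_def mult_single lookup_single when_def)
    qed (auto simp: distrib_left lookup_add)
  qed
  have eq: "pvar a * p = pvar b * p" using assms(2) by (simp add: left_diff_distrib)
  have "?l p m = 0" for m
  proof (induction "?l m b" arbitrary: m)
    case 0
    have "?l p m = ?l (pvar a * p) (m + Poly_Mapping.single a 1)"
      by (simp add: look lookup_add)
    also have "\<dots> = 0" unfolding eq look using 0 assms(1) by (simp add: lookup_add lookup_single)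
    finally show ?case .
  next
    case (Suc k)
    have "?l p m = ?l (pvar a * p) (m + Poly_Mapping.single a 1)"
      by (simp add: look lookup_add)
    also have "\<dots> = ?l p (m + Poly_Mapping.single a 1 - Poly_Mapping.single b 1)"
      unfolding eq look using Suc(2) by (simp add: lookup_add)
    also have "\<dots> = 0"
    proof (rule Suc(1))
      show "k = ?l (m + Poly_Mapping.single a 1 - Poly_Mapping.single b 1) b"
        using Suc(2) assms(1) by (simp add: lookup_add lookup_minus lookup_single)
    qed
    finally show ?case .
  qed
  then show ?thesis by (intro poly_mapping_eqI) simp
qed

text \<open>
  The polynomials with this property contain the constants and are closed under addition and under
  multiplication by variables.
\<close>

lemma difference_quotient_of_substitution:
  assumes "p \<in> polys W" "a \<in> W" "b \<in> W"
  shows "\<exists>q\<in>polys W. p - psubst (\<lambda>v. if v = a then pvar b else pvar v) p = (pvar a - pvar b) * q"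
  using assms(1)
proof (induction rule: polys_var_induct)
  case (const c)
  then show ?case by (intro bexI[of _ 0]) auto
next
  case (add p p')
  let ?\<rho> = "psubst (\<lambda>v. if v = a then pvar b else pvar v)"
  from add obtain q q' where q: "q \<in> polys W" "q' \<in> polys W"
    "p - ?\<rho> p = (pvar a - pvar b) * q" "p' - ?\<rho> p' = (pvar a - pvar b) * q'" by blast
  have "(p + p') - ?\<rho> (p + p') = (p - ?\<rho> p) + (p' - ?\<rho> p')"
    by (simp add: psubst_add)
  also have "\<dots> = (pvar a - pvar b) * (q + q')" unfolding q by (simp add: distrib_left)
  finally show ?case using q by (intro bexI[of _ "q + q'"]) (auto intro: polys_add)
next
  case (var v p)
  let ?\<rho> = "psubst (\<lambda>v. if v = a then pvar b else pvar v)"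
  from var obtain q where q: "q \<in> polys W" "p - ?\<rho> p = (pvar a - pvar b) * q" by blast
  show ?case
  proof (cases "v = a")
    case True
    have "pvar v * p - ?\<rho> (pvar v * p) = (pvar a - pvar b) * p + pvar b * (p - ?\<rho> p)"
      using True by (simp add: psubst_mult algebra_simps)
    also have "\<dots> = (pvar a - pvar b) * (p + pvar b * q)" unfolding q by (simp add: algebra_simps)
    finally show ?thesis using q var assms by (intro bexI[of _ "p + pvar b * q"]) (auto intro: polys_add polys_mult polys_pvar)
  next
    case False
    have "pvar v * p - ?\<rho> (pvar v * p) = pvar v * (p - ?\<rho> p)"
      using False by (simp add: psubst_mult algebra_simps)
    also have "\<dots> = (pvar a - pvar b) * (pvar v * q)" unfolding q by (simp add: algebra_simps)
    finally show ?thesis using q var by (intro bexI[of _ "pvar v * q"]) (auto intro: polys_mult polys_pvar)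
  qed
qed

section \<open>Parity and graded commutativity\<close>

lemma supp_iff: "S \<in> supp w \<longleftrightarrow> coef w S \<noteq> 0"
  by (simp add: supp_def)

lemma supp_multE:
  assumes "S \<in> supp (v * w)"
  obtains T T' where "T \<in> supp v" "T' \<in> supp w" "T \<inter> T' = {}" "S = T \<union> T'"
proof -
  from assms have "(\<Sum>T\<in>Pow S. shuffle_sign T (S - T) * coef v T * coef w (S - T)) \<noteq> 0"
    by (simp add: supp_iff coef_mult)
  then obtain T where T: "T \<subseteq> S" "shuffle_sign T (S - T) * coef v T * coef w (S - T) \<noteq> 0"
    by (auto elim: sum.not_neutral_contains_not_neutral)
  then have "coef v T \<noteq> 0" "coef w (S - T) \<noteq> 0" by auto
  then show thesis using T(1) by (intro that[of T "S - T"]) (auto simp: supp_iff)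
qed

lemma homogeneous_zero [simp]: "homogeneous p 0"
  by (simp add: homogeneous_def supp_def)

lemma homogeneous_add: "homogeneous p v \<Longrightarrow> homogeneous p w \<Longrightarrow> homogeneous p (v + w)"
  for v w :: "('g, 'a::ab_group_add) grassmann"
  unfolding homogeneous_def
proof
  assume *: "\<forall>S\<in>supp v. even (card S) = even p" "\<forall>S\<in>supp w. even (card S) = even p"
  fix S assume "S \<in> supp (v + w)"
  then have "S \<in> supp v \<or> S \<in> supp w" by (auto simp: supp_iff)
  then show "even (card S) = even p" using * by blast
qed

lemma homogeneous_uminus: "homogeneous p w \<Longrightarrow> homogeneous p (- w)"
  for w :: "('g, 'a::ab_group_add) grassmann"
  by (simp add: homogeneous_def supp_iff)

lemma homogeneous_diff: "homogeneous p v \<Longrightarrow> homogeneous p w \<Longrightarrow> homogeneous p (v - w)"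
  for v w :: "('g, 'a::ab_group_add) grassmann"
  using homogeneous_add[of p v "- w"] homogeneous_uminus[of p w] by simp

lemma homogeneous_sum: "(\<And>a. a \<in> A \<Longrightarrow> homogeneous p (h a)) \<Longrightarrow> homogeneous p (sum h A)"
  for h :: "'i \<Rightarrow> ('g, 'a::ab_group_add) grassmann"
  by (induction A rule: infinite_finite_induct) (auto intro: homogeneous_add)

lemma homogeneous_gmonom: "even (card S) = even p \<Longrightarrow> homogeneous p (gmonom S c)"
  by (auto simp: homogeneous_def supp_iff coef_gmonom split: if_splits)

lemma homogeneous_gen [simp]: "homogeneous (Suc 0) (gen g)"
  by (rule homogeneous_gmonom) simp

lemma homogeneous_mult:
  assumes "homogeneous p v" "homogeneous q w"
  shows "homogeneous (p + q) (v * w)"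
  unfolding homogeneous_def
proof
  fix S assume "S \<in> supp (v * w)"
  then obtain T T' where T: "T \<in> supp v" "T' \<in> supp w" "T \<inter> T' = {}" "S = T \<union> T'"
    by (rule supp_multE)
  then have "card S = card T + card T'" by (simp add: card_Un_disjoint finite_of_supp)
  then show "even (card S) = even (p + q)" using assms T by (auto simp: homogeneous_def)
qed

lemma homogeneous_mult_gconst: "homogeneous p w \<Longrightarrow> homogeneous p (w * gconst c)"
  using homogeneous_mult[of p w 0 "gconst c"] by (simp add: homogeneous_gmonom)

lemma homogeneous_one: "homogeneous 0 1"
  by (simp add: one_grassmann_def homogeneous_gmonom)

lemma homogeneous_prod_list:
  "(\<And>a. a \<in> set as \<Longrightarrow> homogeneous (Suc 0) a) \<Longrightarrow> homogeneous (length as) (prod_list as)"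
proof (induction as)
  case (Cons a as)
  then show ?case using homogeneous_mult[of "Suc 0" a "length as" "prod_list as"] by simp
qed (simp add: homogeneous_one)

lemma homogeneous_cong: "homogeneous p w \<Longrightarrow> even p = even q \<Longrightarrow> homogeneous q w"
  by (simp add: homogeneous_def)

lemma shuffle_sign_swap:
  assumes "finite S" "finite T" "S \<inter> T = {}"
  shows "shuffle_sign S T = (-1) ^ (card S * card T) * (shuffle_sign T S :: 'a::comm_ring_1)"
proof -
  let ?A = "{(a, b). a \<in> S \<and> b \<in> T \<and> b < a}" and ?B = "{(a, b). a \<in> S \<and> b \<in> T \<and> a < b}"
  have fin: "finite ?A" "finite ?B"
    using assms by (auto intro: finite_subset[of _ "S \<times> T"])
  have "?A \<union> ?B = S \<times> T" using assms(3) by auto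
  moreover have "card (?A \<union> ?B) = card ?A + card ?B"
    using fin by (intro card_Un_disjoint) auto
  ultimately have "card S * card T = card ?A + card ?B" by (simp add: card_cartesian_product)
  moreover have "card ?B = card {(a, b). a \<in> T \<and> b \<in> S \<and> b < a}"
    by (rule bij_betw_same_card[of "\<lambda>(a, b). (b, a)"]) (auto simp: bij_betw_def inj_on_def image_iff)
  ultimately show ?thesis
    by (simp add: shuffle_sign_def minus_one_power_iff)
qed

lemma gmonom_commute:
  fixes c d :: "'a::comm_ring_1"
  assumes "finite S" "finite T"
  shows "gmonom S c * gmonom T d = (-1) ^ (card S * card T) * (gmonom T d * gmonom S c)"
proof (cases "S \<inter> T = {}")
  case True
  then show ?thesis using assms shuffle_sign_swap[OF assms True, where 'a = 'a]
    by (cases "even (card S * card T)")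
      (auto simp: gmonom_mult Un_commute Int_commute gmonom_uminus[symmetric] mult_ac)
next
  case False
  then show ?thesis using assms by (simp add: gmonom_mult Int_commute)
qed

lemma homogeneous_induct [consumes 1, case_names zero add gmonom]:
  fixes w :: "('g, 'a::ab_group_add) grassmann"
  assumes "homogeneous p w" "Q 0"
    and "\<And>a b. homogeneous p a \<Longrightarrow> homogeneous p b \<Longrightarrow> Q a \<Longrightarrow> Q b \<Longrightarrow> Q (a + b)"
    and "\<And>S c. finite S \<Longrightarrow> even (card S) = even p \<Longrightarrow> Q (gmonom S c)"
  shows "Q w"
proof -
  have sums: "homogeneous p (sum h A) \<and> Q (sum h A)" if "\<forall>m\<in>A. homogeneous p (h m) \<and> Q (h m)"
    for h and A :: "'g set set"
    using that by (induction A rule: infinite_finite_induct) (auto intro: assms homogeneous_add)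
  have "\<forall>S\<in>supp w. homogeneous p (gmonom S (coef w S)) \<and> Q (gmonom S (coef w S))"
    using assms(1) by (auto simp: homogeneous_def[of p w] intro!: assms(4) homogeneous_gmonom finite_of_supp)
  then have "Q (\<Sum>S\<in>supp w. gmonom S (coef w S))" by (rule sums[THEN conjunct2])
  then show ?thesis by (simp only: grassmann_expand[symmetric])
qed

lemma graded_commute:
  assumes "homogeneous p a" "homogeneous q b"
  shows "a * b = (-1) ^ (p * q) * (b * a)"
  using assms(1)
proof (induction rule: homogeneous_induct)
  case (gmonom S c)
  from assms(2) show ?case
  proof (induction rule: homogeneous_induct)
    case (gmonom T d)
    then show ?case using gmonom_commute[of S T c d] \<open>finite S\<close> \<open>even (card S) = even p\<close>
      by (simp add: minus_one_power_iff)
  qed (simp_all add: distrib_left distrib_right)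
qed (simp_all add: distrib_left distrib_right)

text \<open>
  In characteristic two anticommutation does not give this; it holds because the square of each
  odd monomial vanishes and the mixed products cancel in pairs.
\<close>

lemma odd_square:
  assumes "homogeneous (Suc 0) a"
  shows "a * a = 0"
  using assms
proof (induction rule: homogeneous_induct)
  case (add a b)
  have "a * b = - (b * a)" using graded_commute[OF add(1,2)] by simp
  then show ?case using add by (simp add: distrib_left distrib_right)
next
  case (gmonom S c)
  then have "S \<noteq> {}" by auto
  then show ?case using gmonom by (simp add: gmonom_mult)
qed simp

lemma odd_anticommute:
  "homogeneous (Suc 0) a \<Longrightarrow> homogeneous (Suc 0) b \<Longrightarrow> a * b = - (b * a)"
  using graded_commute[of "Suc 0" a "Suc 0" b] by simp

lemma gconst_commute: "gconst c * w = w * gconst c"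
proof (induction w rule: grassmann_induct)
  case (gmonom S d)
  then show ?case by (simp add: gmonom_mult mult_ac)
qed (simp_all add: distrib_left distrib_right)

lemma coef_gpart: "coef (gpart p w) S = (if even (card S) = even p then coef w S else 0)"
proof -
  let ?A = "{S \<in> supp w. even (card S) = even p}"
  have "coef (gpart p w) S = (\<Sum>T\<in>?A. if T = S then coef w T else 0)"
    unfolding gpart_def coef_sum by (rule sum.cong) (auto simp: coef_gmonom finite_of_supp)
  also have "\<dots> = (if S \<in> ?A then coef w S else 0)" by (simp add: sum.delta')
  finally show ?thesis by (auto simp: supp_iff)
qed

lemma gpart_add: "gpart p (v + w) = gpart p v + gpart p w"
  by (rule grassmann_eqI) (simp add: coef_gpart)

lemma gpart_zero [simp]: "gpart p 0 = 0"
  by (rule grassmann_eqI) (simp add: coef_gpart)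

lemma gpart_homogeneous: "homogeneous q w \<Longrightarrow> gpart p w = (if even p = even q then w else 0)"
  by (rule grassmann_eqI) (auto simp: coef_gpart homogeneous_def supp_iff)

lemma homogeneous_gpart: "homogeneous p (gpart p w)"
  by (auto simp: homogeneous_def supp_iff coef_gpart split: if_splits)

lemma gpart_split: "w = gpart 0 w + gpart 1 w"
  by (rule grassmann_eqI) (simp add: coef_gpart)

definition grade_involution :: "('g, 'a::ab_group_add) grassmann \<Rightarrow> ('g, 'a) grassmann" where
  "grade_involution w = gpart 0 w - gpart 1 w"

lemma grade_involution_homogeneous:
  "homogeneous p w \<Longrightarrow> grade_involution w = (if even p then w else - w)"
  by (simp add: grade_involution_def gpart_homogeneous)

lemma grade_involution_add: "grade_involution (v + w) = grade_involution v + grade_involution w"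
  by (simp add: grade_involution_def gpart_add)

lemma grade_involution_zero [simp]: "grade_involution 0 = 0"
  by (simp add: grade_involution_def)


section \<open>The subalgebras \<open>Lambda P V\<close>\<close>

lemma Lambda_iff: "w \<in> Lambda P V \<longleftrightarrow> (\<forall>S. coef w S \<noteq> 0 \<longrightarrow> S \<subseteq> V \<and> coef w S \<in> polys P)"
  by (auto simp: Lambda_def supp_iff)

lemma Lambda_coef: "w \<in> Lambda P V \<Longrightarrow> coef w S \<in> polys P"
  by (cases "coef w S = 0") (auto simp: Lambda_iff)

lemma zero_in_Lambda [simp]: "0 \<in> Lambda P V"
  by (simp add: Lambda_iff)

lemma add_in_Lambda: "v \<in> Lambda P V \<Longrightarrow> w \<in> Lambda P V \<Longrightarrow> v + w \<in> Lambda P V"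
  unfolding Lambda_iff
proof (intro allI impI)
  assume *: "\<forall>S. coef v S \<noteq> 0 \<longrightarrow> S \<subseteq> V \<and> coef v S \<in> polys P"
    "\<forall>S. coef w S \<noteq> 0 \<longrightarrow> S \<subseteq> V \<and> coef w S \<in> polys P"
  fix S assume "coef (v + w) S \<noteq> 0"
  then have "coef v S \<noteq> 0 \<or> coef w S \<noteq> 0" by auto
  moreover have "coef v S \<in> polys P" "coef w S \<in> polys P" using * by (metis polys_zero)+
  ultimately show "S \<subseteq> V \<and> coef (v + w) S \<in> polys P" using * polys_add[of "coef v S" P "coef w S"] by auto
qed

lemma uminus_in_Lambda: "w \<in> Lambda P V \<Longrightarrow> - w \<in> Lambda P V"
  by (auto simp: Lambda_iff polys_uminus)

lemma diff_in_Lambda: "v \<in> Lambda P V \<Longrightarrow> w \<in> Lambda P V \<Longrightarrow> v - w \<in> Lambda P V"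
  using add_in_Lambda[of v P V "- w"] uminus_in_Lambda[of w P V] by simp

lemma sum_in_Lambda: "(\<And>a. a \<in> A \<Longrightarrow> h a \<in> Lambda P V) \<Longrightarrow> sum h A \<in> Lambda P V"
  by (induction A rule: infinite_finite_induct) (auto intro: add_in_Lambda)

lemma gmonom_in_Lambda: "S \<subseteq> V \<Longrightarrow> c \<in> polys P \<Longrightarrow> gmonom S c \<in> Lambda P V"
  by (auto simp: Lambda_iff coef_gmonom)

lemma gen_in_Lambda: "g \<in> V \<Longrightarrow> gen g \<in> Lambda P V"
  by (simp add: gmonom_in_Lambda)

lemma gconst_in_Lambda: "c \<in> polys P \<Longrightarrow> gconst c \<in> Lambda P V"
  by (simp add: gmonom_in_Lambda)

lemma one_in_Lambda [simp]: "1 \<in> Lambda P V"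
  by (simp add: one_grassmann_def gmonom_in_Lambda)

lemma scalar_in_Lambda [simp]: "scalar r \<in> Lambda P V"
  by (simp add: scalar_def gmonom_in_Lambda)

lemma mult_in_Lambda:
  assumes "v \<in> Lambda P V" "w \<in> Lambda P V"
  shows "v * w \<in> Lambda P V"
  unfolding Lambda_iff
proof (intro allI impI conjI)
  fix S assume "coef (v * w) S \<noteq> 0"
  then have "S \<in> supp (v * w)" by (simp add: supp_iff)
  then obtain T T' where "T \<in> supp v" "T' \<in> supp w" "T \<inter> T' = {}" "S = T \<union> T'"
    by (rule supp_multE)
  then show "S \<subseteq> V" using assms by (auto simp: Lambda_def)
  have "shuffle_sign T T' \<in> polys P" for T T' :: "'a set"
    by (simp add: shuffle_sign_def minus_one_power_iff polys_uminus)
  then show "coef (v * w) S \<in> polys P"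
    unfolding coef_mult by (intro polys_sum polys_mult Lambda_coef[OF assms(1)] Lambda_coef[OF assms(2)])
qed

lemma prod_list_in_Lambda: "(\<And>a. a \<in> set as \<Longrightarrow> a \<in> Lambda P V) \<Longrightarrow> prod_list as \<in> Lambda P V"
  by (induction as) (auto intro: mult_in_Lambda)

lemma Lambda_mono: "w \<in> Lambda P V \<Longrightarrow> P \<subseteq> P' \<Longrightarrow> V \<subseteq> V' \<Longrightarrow> w \<in> Lambda P' V'"
  unfolding Lambda_iff using polys_mono by blast

lemma gpart_in_Lambda: "w \<in> Lambda P V \<Longrightarrow> gpart p w \<in> Lambda P V"
  by (auto simp: Lambda_iff coef_gpart split: if_splits)

lemma grade_involution_in_Lambda: "w \<in> Lambda P V \<Longrightarrow> grade_involution w \<in> Lambda P V"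
  by (simp add: grade_involution_def diff_in_Lambda gpart_in_Lambda)

lemma neg_one_power_in_Lambda: "w \<in> Lambda P V \<Longrightarrow> (-1) ^ k * w \<in> Lambda P V"
  by (simp add: minus_one_power_iff uminus_in_Lambda)

lemma gmonom_sum: "gmonom S (sum h A) = (\<Sum>a\<in>A. gmonom S (h a :: 'a::ab_group_add))"
  by (induction A rule: infinite_finite_induct) (simp_all add: gmonom_add)

lemma Lambda_induct [consumes 1, case_names zero add gmonom]:
  assumes "w \<in> Lambda P V" "Q 0"
    and add: "\<And>a b. a \<in> Lambda P V \<Longrightarrow> b \<in> Lambda P V \<Longrightarrow> Q a \<Longrightarrow> Q b \<Longrightarrow> Q (a + b)"
    and gmonom: "\<And>S m c. finite S \<Longrightarrow> S \<subseteq> V \<Longrightarrow> Poly_Mapping.keys m \<subseteq> P \<Longrightarrow>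
      Q (gmonom S (Poly_Mapping.single m c))"
  shows "Q w"
proof -
  have sums: "sum h A \<in> Lambda P V \<and> Q (sum h A)" if "\<forall>m\<in>A. h m \<in> Lambda P V \<and> Q (h m)"
    for h and A :: "'i set"
    using that by (induction A rule: infinite_finite_induct) (auto intro: assms add_in_Lambda)
  have "gmonom S (coef w S) \<in> Lambda P V \<and> Q (gmonom S (coef w S))" if "S \<in> supp w" for S
  proof -
    have S: "finite S" "S \<subseteq> V" "coef w S \<in> polys P"
      using that assms(1) by (auto simp: finite_of_supp Lambda_def)
    from S(3) have "Q (gmonom S (coef w S))"
    proof (induction rule: polys_induct)
      case (add a b)
      then show ?case using S by (simp add: gmonom_add assms(3) gmonom_in_Lambda)
    qed (use S assms in auto)
    then show ?thesis using S by (simp add: gmonom_in_Lambda)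
  qed
  then have "Q (\<Sum>S\<in>supp w. gmonom S (coef w S))" by (intro sums[THEN conjunct2]) simp
  then show ?thesis by (simp only: grassmann_expand[symmetric])
qed

lemma keys_mono_part: "Poly_Mapping.keys (mono_part P m) = Poly_Mapping.keys m \<inter> P"
  and lookup_mono_part: "Poly_Mapping.lookup (mono_part P m) v = (if v \<in> P then Poly_Mapping.lookup m v else 0)"
proof -
  show look: "Poly_Mapping.lookup (mono_part P m) v = (if v \<in> P then Poly_Mapping.lookup m v else 0)" for v
    by (auto simp: mono_part_def lookup_sum lookup_single when_def sum.delta in_keys_iff)
  show "Poly_Mapping.keys (mono_part P m) = Poly_Mapping.keys m \<inter> P"
    by (auto simp: in_keys_iff look split: if_splits)
qed

lemma mono_part_split: "mono_part (- P) m + mono_part P m = m"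
  by (rule poly_mapping_eqI) (simp add: lookup_add lookup_mono_part)

lemma mono_part_add: "mono_part P (m + m') = mono_part P m + mono_part P m'"
  by (rule poly_mapping_eqI) (simp add: lookup_add lookup_mono_part)

lemma mono_part_id: "Poly_Mapping.keys m \<subseteq> P \<Longrightarrow> mono_part P m = m"
  by (rule poly_mapping_eqI) (auto simp: lookup_mono_part in_keys_iff)

lemma mono_part_none: "Poly_Mapping.keys m \<inter> P = {} \<Longrightarrow> mono_part P m = 0"
  by (rule poly_mapping_eqI) (auto simp: lookup_mono_part in_keys_iff)

text \<open>
  A function of two groups of variables is a sum of products of monomials, the factor with the
  first group of variables standing in front.
\<close>

lemma tensor_induct [consumes 1, case_names zero add tensor]:
  fixes w :: "('g::linorder, ('v, 'r::comm_ring_1) mpoly) grassmann"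
  assumes "w \<in> Lambda A B" "Q 0"
    and add: "\<And>a b. a \<in> Lambda A B \<Longrightarrow> b \<in> Lambda A B \<Longrightarrow> Q a \<Longrightarrow> Q b \<Longrightarrow> Q (a + b)"
    and tensor: "\<And>T m S m' c. finite T \<Longrightarrow> T \<subseteq> B - V \<Longrightarrow> Poly_Mapping.keys m \<subseteq> A - P \<Longrightarrow>
      finite S \<Longrightarrow> S \<subseteq> B \<inter> V \<Longrightarrow> Poly_Mapping.keys m' \<subseteq> A \<inter> P \<Longrightarrow>
      Q (gmonom T (Poly_Mapping.single m 1) * gmonom S (Poly_Mapping.single m' c))"
  shows "Q w"
  using assms(1)
proof (induction rule: Lambda_induct)
  case (gmonom S m c)
  let ?T = "S - V" and ?S = "S \<inter> V"
  let ?e = "shuffle_sign ?T ?S :: 'r"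
  have sign: "(shuffle_sign ?T ?S :: ('v, 'r) mpoly) = pconst ?e"
    by (simp add: shuffle_sign_def minus_one_power_iff pconst_def single_uminus)
  have disj: "(S - V) \<inter> (S \<inter> V) = {}" by blast
  have "gmonom ?T (Poly_Mapping.single (mono_part (- P) m) 1) *
      gmonom ?S (Poly_Mapping.single (mono_part P m) (?e * c)) = gmonom S (Poly_Mapping.single m c)"
    using gmonom(1) disj
    by (simp add: gmonom_mult sign pconst_def mult_single mono_part_split Un_Diff_Int Int_Diff
        mult.assoc[symmetric] Diff_Int_distrib2[symmetric])
  moreover have "Q (gmonom ?T (Poly_Mapping.single (mono_part (- P) m) 1) *
      gmonom ?S (Poly_Mapping.single (mono_part P m) (?e * c)))"
    using gmonom by (intro tensor) (auto simp: keys_mono_part)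
  ultimately show ?case by simp
qed (use assms in auto)


section \<open>Koszul differentials\<close>

lemma koszul_uminus: "koszul v (- w) = - koszul v w"
  using koszul_add[of v w "- w"] by (simp add: eq_neg_iff_add_eq_0 add.commute)

lemma koszul_diff: "koszul v (a - b) = koszul v a - koszul v b"
  using koszul_add[of v a "- b"] by (simp add: koszul_uminus)

lemma koszul_gconst [simp]: "koszul v (gconst c) = 0"
  by (simp add: koszul_gmonom koszul_term_def)

lemma koszul_one [simp]: "koszul v 1 = 0"
  by (simp add: one_grassmann_def)

text \<open>
  The sign in the Leibniz rule only affects the term with \<open>koszul v b\<close>, which is zero here; so the rule
  extends to inhomogeneous \<open>a\<close>.
\<close>

lemma koszul_mult_cycle:
  assumes "koszul v b = 0"
  shows "koszul v (a * b) = koszul v a * b"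
proof (induction a rule: grassmann_induct)
  case (gmonom S c)
  have "homogeneous (card S) (gmonom S c)" by (rule homogeneous_gmonom) simp
  then show ?case by (simp add: koszul_leibniz assms)
qed (simp_all add: koszul_add distrib_right)

lemma koszul_cycle_mult:
  "homogeneous p a \<Longrightarrow> koszul v a = 0 \<Longrightarrow> koszul v (a * b) = (-1) ^ p * (a * koszul v b)"
  by (simp add: koszul_leibniz mult.assoc)

lemma koszul_prod_list_cycle: "(\<And>a. a \<in> set as \<Longrightarrow> koszul v a = 0) \<Longrightarrow> koszul v (prod_list as) = 0"
  by (induction as) (simp_all add: koszul_mult_cycle)

lemma koszul_cong:
  assumes "w \<in> Lambda P V" "\<And>g. g \<in> V \<Longrightarrow> v g = v' g"
  shows "koszul v w = koszul v' w"
proof -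
  have "koszul_term v S (coef w S) = koszul_term v' S (coef w S)" if "S \<in> supp w" for S
  proof -
    have "S \<subseteq> V" using that assms(1) by (auto simp: Lambda_def)
    then show ?thesis unfolding koszul_term_def using assms(2) by (intro sum.cong) auto
  qed
  then show ?thesis by (simp add: koszul_def)
qed

lemma koszul_in_Lambda:
  assumes "w \<in> Lambda P V" "\<And>g. g \<in> V \<Longrightarrow> v g \<in> polys P"
  shows "koszul v w \<in> Lambda P V"
  unfolding koszul_def koszul_term_def
proof (intro sum_in_Lambda gmonom_in_Lambda)
  fix S g assume "S \<in> supp w" "g \<in> S"
  moreover have "g \<in> V" using calculation assms(1) by (auto simp: Lambda_def)
  moreover have "shuffle_sign T T' \<in> polys P" for T T' :: "'a set"
    by (simp add: shuffle_sign_def minus_one_power_iff polys_uminus)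
  ultimately show "shuffle_sign {g} (S - {g}) * coef w S * v g \<in> polys P"
    using assms by (intro polys_mult) (auto simp: Lambda_def)
  show "S - {g} \<subseteq> V" using \<open>S \<in> supp w\<close> assms(1) by (auto simp: Lambda_def)
qed

lemma homogeneous_koszul: "homogeneous p w \<Longrightarrow> homogeneous (Suc p) (koszul v w)"
proof (induction rule: homogeneous_induct)
  case (gmonom S c)
  have "homogeneous (Suc p) (koszul_term v S c)"
    unfolding koszul_term_def
  proof (intro homogeneous_sum homogeneous_gmonom)
    fix g assume "g \<in> S"
    then have "card S = Suc (card (S - {g}))" using gmonom(1) by (metis card_Suc_Diff1)
    then show "even (card (S - {g})) = even (Suc p)" using gmonom(2) by auto
  qed
  then show ?case using gmonom(1) by (simp add: koszul_gmonom)
qed (simp_all add: koszul_add homogeneous_add)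

lemma gpart_koszul: "gpart p (koszul v w) = koszul v (gpart (Suc p) w)"
proof -
  have "koszul v w = koszul v (gpart 0 w) + koszul v (gpart 1 w)"
    by (metis gpart_split koszul_add)
  then have "gpart p (koszul v w) = gpart p (koszul v (gpart 0 w)) + gpart p (koszul v (gpart 1 w))"
    by (simp add: gpart_add)
  moreover have "homogeneous 1 (koszul v (gpart 0 w))" "homogeneous 2 (koszul v (gpart 1 w))"
    using homogeneous_koszul[OF homogeneous_gpart[of 0 w], of v] homogeneous_koszul[OF homogeneous_gpart[of 1 w], of v]
    by (simp_all add: numeral_2_eq_2)
  moreover have "gpart (Suc p) w = (if even p then gpart 1 w else gpart 0 w)"
    by (rule grassmann_eqI) (simp add: coef_gpart)
  ultimately show ?thesis by (simp add: gpart_homogeneous)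
qed

lemma grade_involution_koszul: "grade_involution (koszul v w) = - koszul v (grade_involution w)"
proof -
  have "gpart (Suc (Suc 0)) w = gpart 0 w" by (rule grassmann_eqI) (simp add: coef_gpart)
  then show ?thesis by (simp add: grade_involution_def gpart_koszul koszul_diff)
qed


section \<open>Substitution homomorphisms\<close>

lemma gen_mult_induct [case_names zero add const gen]:
  fixes w :: "('g::linorder, 'a::comm_ring_1) grassmann"
  assumes "Q 0" "\<And>a b. Q a \<Longrightarrow> Q b \<Longrightarrow> Q (a + b)" "\<And>c. Q (gconst c)"
    and gen: "\<And>g w. Q w \<Longrightarrow> Q (gen g * w)"
  shows "Q w"
proof (induction w rule: grassmann_induct)
  case (gmonom S c)
  then show ?case
  proof (induction S arbitrary: c rule: finite_induct)
    case (insert g S)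
    have "gmonom (insert g S) c = gen g * gmonom S (shuffle_sign {g} S * c)"
      using insert by (simp add: gmonom_mult mult.assoc[symmetric])
    then show ?case using gen insert.IH by simp
  qed (use assms in simp)
qed (use assms in auto)

text \<open>
  Odd elements anticommute and have square zero, also in characteristic two (\<open>odd_square\<close>).  Oddness
  of the \<open>\<sigma> g\<close> thus provides all the relations needed for \<open>gsubst \<alpha> \<sigma>\<close> to be multiplicative.
\<close>

locale grassmann_substitution =
  fixes \<alpha> :: "'a::comm_ring_1 \<Rightarrow> 'b::comm_ring_1"
    and \<sigma> :: "'g::linorder \<Rightarrow> ('h::linorder, 'b) grassmann"
  assumes map_add: "\<alpha> (a + b) = \<alpha> a + \<alpha> b"
    and map_mult: "\<alpha> (a * b) = \<alpha> a * \<alpha> b"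
    and map_one: "\<alpha> 1 = 1"
    and odd: "homogeneous (Suc 0) (\<sigma> g)"
begin

lemma map_zero: "\<alpha> 0 = 0"
  using map_add[of 0 0] by simp

lemma map_uminus: "\<alpha> (- a) = - \<alpha> a"
  using map_add[of a "- a"] map_zero by (simp add: eq_neg_iff_add_eq_0 add.commute)

lemma map_shuffle_sign: "\<alpha> (shuffle_sign S T) = shuffle_sign S T"
  by (simp add: shuffle_sign_def minus_one_power_iff map_uminus map_one)

lemma gsubst_add: "gsubst \<alpha> \<sigma> (v + w) = gsubst \<alpha> \<sigma> v + gsubst \<alpha> \<sigma> w"
  unfolding gsubst_def
  by (rule linear_extension_add) (simp add: map_add gmonom_add distrib_right)

lemma gsubst_gmonom: "finite S \<Longrightarrow>
    gsubst \<alpha> \<sigma> (gmonom S c) = gconst (\<alpha> c) * prod_list (map \<sigma> (sorted_list_of_set S))"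
  unfolding gsubst_def by (rule linear_extension_gmonom) (simp_all add: map_zero)

lemma gsubst_zero [simp]: "gsubst \<alpha> \<sigma> 0 = 0"
  using gsubst_add[of 0 0] by simp

lemma gsubst_gconst: "gsubst \<alpha> \<sigma> (gconst c) = gconst (\<alpha> c)"
  by (simp add: gsubst_gmonom)

lemma gsubst_one: "gsubst \<alpha> \<sigma> 1 = 1"
  by (simp add: one_grassmann_def gsubst_gconst map_one)

lemma gsubst_gen: "gsubst \<alpha> \<sigma> (gen g) = \<sigma> g"
  by (simp add: gsubst_gmonom map_one one_grassmann_def[symmetric])

lemma gsubst_uminus: "gsubst \<alpha> \<sigma> (- w) = - gsubst \<alpha> \<sigma> w"
  using gsubst_add[of w "- w"] by (simp add: eq_neg_iff_add_eq_0 add.commute)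

lemma gsubst_diff: "gsubst \<alpha> \<sigma> (v - w) = gsubst \<alpha> \<sigma> v - gsubst \<alpha> \<sigma> w"
  using gsubst_add[of v "- w"] by (simp add: gsubst_uminus)

lemma gsubst_sum: "gsubst \<alpha> \<sigma> (sum h A) = (\<Sum>a\<in>A. gsubst \<alpha> \<sigma> (h a))"
  by (induction A rule: infinite_finite_induct) (simp_all add: gsubst_add)

abbreviation ordered_image :: "'g set \<Rightarrow> ('h, 'b) grassmann" where
  "ordered_image S \<equiv> prod_list (map \<sigma> (sorted_list_of_set S))"

lemma sorted_list_of_set_insert_least:
  assumes "finite S" "\<And>h. h \<in> S \<Longrightarrow> g < h"
  shows "sorted_list_of_set (insert g S) = g # sorted_list_of_set S"
proof -
  have "g \<notin> S" using assms(2) by blast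
  moreover have "insort g (sorted_list_of_set S) = g # sorted_list_of_set S"
    using assms by (intro insort_is_Cons) (auto intro: less_imp_le)
  ultimately show ?thesis using assms by (simp add: sorted_list_of_set_insert_remove)
qed

text \<open>
  Moving \<open>\<sigma> g\<close> to its place in the ordered product gives the same sign as for the variables
  themselves; if \<open>g\<close> already occurs, it meets a second factor \<open>\<sigma> g\<close> and the product vanishes.
\<close>

lemma gen_ordered_image:
  assumes "finite S"
  shows "\<sigma> g * ordered_image S =
    (if g \<in> S then 0 else gconst (shuffle_sign {g} S) * ordered_image (insert g S))"
  using assms
proof (induction S rule: finite_linorder_min_induct)
  case empty
  then show ?case by (simp add: one_grassmann_def[symmetric])
next
  case (insert h S)
  then have h: "h \<notin> S" by auto
  have hS: "ordered_image (insert h S) = \<sigma> h * ordered_image S"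
    using insert by (subst sorted_list_of_set_insert_least) auto
  show ?case
  proof (cases g h rule: linorder_cases)
    case less
    then have g: "g < k" if "k \<in> insert h S" for k using that insert(2) by auto
    then have "shuffle_sign {g} (insert h S) = (1 :: 'b)"
      by (intro shuffle_sign_ordered) (auto dest: order.asym)
    moreover have "g \<notin> insert h S" using g by blast
    moreover have "ordered_image (insert g (insert h S)) = \<sigma> g * ordered_image (insert h S)"
      using g insert(1) by (subst sorted_list_of_set_insert_least) auto
    ultimately show ?thesis by (simp add: one_grassmann_def[symmetric])
  next
    case equal
    then show ?thesis using odd_square[OF odd, of h] hS by (simp add: mult.assoc[symmetric])
  next
    case greater
    have "\<sigma> g * ordered_image (insert h S) = - (\<sigma> h * (\<sigma> g * ordered_image S))"
      using odd_anticommute[OF odd odd, of g h] hS by (simp add: mult.assoc[symmetric])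
    also have "\<dots> = (if g \<in> S then 0 else
        - (gconst (shuffle_sign {g} S) * (\<sigma> h * ordered_image (insert g S))))"
      using insert.IH gconst_commute[of "shuffle_sign {g} S" "\<sigma> h"] by (simp add: mult.assoc[symmetric])
    also have "\<dots> = (if g \<in> insert h S then 0 else
        gconst (shuffle_sign {g} (insert h S)) * ordered_image (insert g (insert h S)))"
    proof (cases "g \<in> S")
      case False
      have "shuffle_sign {g} ({h} \<union> S) = shuffle_sign {g} {h} * (shuffle_sign {g} S :: 'b)"
        using insert h by (intro shuffle_sign_Un_right) auto
      then have "shuffle_sign {g} (insert h S) = - (shuffle_sign {g} S :: 'b)"
        using greater by (simp add: shuffle_sign_singleton)
      moreover have "ordered_image (insert h (insert g S)) = \<sigma> h * ordered_image (insert g S)"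
        using insert greater by (subst sorted_list_of_set_insert_least) auto
      moreover have "g \<noteq> h" using greater by blast
      ultimately show ?thesis using False
        by (simp add: insert_commute[of g h] gmonom_uminus)
    qed (use greater in auto)
    finally show ?thesis .
  qed
qed

lemma gsubst_gen_mult: "gsubst \<alpha> \<sigma> (gen g * w) = \<sigma> g * gsubst \<alpha> \<sigma> w"
proof (induction w rule: grassmann_induct)
  case (gmonom S c)
  have "\<sigma> g * (gconst (\<alpha> c) * ordered_image S) = gconst (\<alpha> c) * (\<sigma> g * ordered_image S)"
    using gconst_commute[of "\<alpha> c" "\<sigma> g"] by (simp add: mult.assoc[symmetric])
  moreover have "gconst a * (gconst b * w) = gconst (a * b) * w" for a b :: 'b and w :: "('h, 'b) grassmann"
    by (simp add: mult.assoc[symmetric] gmonom_mult)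
  ultimately show ?case using gmonom
    by (simp add: gmonom_mult gsubst_gmonom gen_ordered_image map_mult map_shuffle_sign mult.commute)
qed (simp_all add: gsubst_add distrib_left)

lemma gsubst_gconst_mult: "gsubst \<alpha> \<sigma> (gconst c * w) = gconst (\<alpha> c) * gsubst \<alpha> \<sigma> w"
proof (induction w rule: grassmann_induct)
  case (gmonom S d)
  have "gconst a * (gconst b * w) = gconst (a * b) * w" for a b :: 'b and w :: "('h, 'b) grassmann"
    by (simp add: mult.assoc[symmetric] gmonom_mult)
  then show ?case using gmonom by (simp add: gmonom_mult gsubst_gmonom map_mult)
qed (simp_all add: gsubst_add distrib_left)

lemma gsubst_mult: "gsubst \<alpha> \<sigma> (v * w) = gsubst \<alpha> \<sigma> v * gsubst \<alpha> \<sigma> w"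
  by (induction v rule: gen_mult_induct)
    (simp_all add: gsubst_add distrib_right gsubst_gconst_mult gsubst_gconst gsubst_gen_mult mult.assoc)

lemma gsubst_prod_list: "gsubst \<alpha> \<sigma> (prod_list as) = prod_list (map (gsubst \<alpha> \<sigma>) as)"
  by (induction as) (simp_all add: gsubst_one gsubst_mult)

end

lemma gsubst_in_Lambda:
  assumes "w \<in> Lambda P V" "\<And>p. p \<in> polys P \<Longrightarrow> \<alpha> p \<in> polys Q" "\<And>g. g \<in> V \<Longrightarrow> \<sigma> g \<in> Lambda Q W"
  shows "gsubst \<alpha> \<sigma> w \<in> Lambda Q W"
  unfolding gsubst_def
proof (intro sum_in_Lambda mult_in_Lambda gconst_in_Lambda prod_list_in_Lambda)
  fix S assume S: "S \<in> supp w"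
  then show "\<alpha> (coef w S) \<in> polys Q" using assms by (auto simp: Lambda_def)
  fix a assume "a \<in> set (map \<sigma> (sorted_list_of_set S))"
  moreover have "S \<subseteq> V" using S assms(1) by (auto simp: Lambda_def)
  ultimately show "a \<in> Lambda Q W" using assms(3) finite_of_supp[OF S] by auto
qed

section \<open>Berezin integration\<close>

text \<open>
  The integral over the variables \<open>V\<close>, normalised from the left: the volume element \<open>gmonom V 1\<close>
  times \<open>\<theta>\<close> goes to \<open>\<theta>\<close> if \<open>\<theta>\<close> does not involve \<open>V\<close>, and monomials lacking a variable of \<open>V\<close> go to
  zero.  The determinants with a Grassmann row and the functional that defines the dual column are
  such integrals.
\<close>

definition berezin :: "'g::linorder set \<Rightarrow> ('g, 'a) grassmann \<Rightarrow> ('g, 'a::comm_ring_1) grassmann" where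
  "berezin V w = (\<Sum>S\<in>supp w. if V \<subseteq> S then gmonom (S - V) (shuffle_sign V (S - V) * coef w S) else 0)"

lemma berezin_add: "berezin V (a + b) = berezin V a + berezin V b"
  unfolding berezin_def by (rule linear_extension_add) (simp add: distrib_left gmonom_add)

lemma berezin_zero [simp]: "berezin V 0 = 0"
  by (simp add: berezin_def supp_def)

lemma berezin_uminus: "berezin V (- a) = - berezin V a"
  using berezin_add[of V a "- a"] by (simp add: eq_neg_iff_add_eq_0 add.commute)

lemma berezin_diff: "berezin V (a - b) = berezin V a - berezin V b"
  using berezin_add[of V a "- b"] by (simp add: berezin_uminus)

lemma berezin_sum: "berezin V (sum h A) = (\<Sum>a\<in>A. berezin V (h a))"
  by (induction A rule: infinite_finite_induct) (simp_all add: berezin_add)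

lemma berezin_neg_one_power: "berezin V ((-1) ^ k * a) = (-1) ^ k * berezin V a"
  by (simp add: minus_one_power_iff berezin_uminus)

lemma berezin_gmonom: "finite S \<Longrightarrow> berezin V (gmonom S c) =
    (if V \<subseteq> S then gmonom (S - V) (shuffle_sign V (S - V) * c) else 0)"
  unfolding berezin_def by (rule linear_extension_gmonom) simp_all

lemma gmonom_factor:
  fixes c :: "'a::comm_ring_1"
  assumes "finite S" "V \<subseteq> S"
  shows "gmonom S c = gmonom V 1 * gmonom (S - V) (shuffle_sign V (S - V) * c)"
proof -
  have "finite V" "V \<union> (S - V) = S" "V \<inter> (S - V) = {}" using assms finite_subset by auto
  then show ?thesis using assms by (simp add: gmonom_mult mult.assoc[symmetric])
qed

text \<open>
  By additivity, an identity between integrals can be checked on the two kinds of monomials that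
  describe the integral: multiples of the volume element, and monomials lacking a variable of \<open>V\<close>.
\<close>

lemma berezin_induct [consumes 1, case_names zero add volume missing]:
  fixes w :: "('g::linorder, 'a::comm_ring_1) grassmann"
  assumes "finite V" "Q 0" "\<And>a b. Q a \<Longrightarrow> Q b \<Longrightarrow> Q (a + b)"
    and "\<And>T c. finite T \<Longrightarrow> T \<inter> V = {} \<Longrightarrow> Q (gmonom V 1 * gmonom T c)"
    and "\<And>S c. finite S \<Longrightarrow> \<not> V \<subseteq> S \<Longrightarrow> Q (gmonom S c)"
  shows "Q w"
proof (induction w rule: grassmann_induct)
  case (gmonom S c)
  show ?case
  proof (cases "V \<subseteq> S")
    case True
    have "Q (gmonom V 1 * gmonom (S - V) (shuffle_sign V (S - V) * c))"
      using gmonom by (intro assms) auto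
    then show ?thesis using gmonom_factor[OF gmonom True, of c] by simp
  qed (use assms gmonom in auto)
qed (use assms in auto)

lemma in_polys_UNIV [simp]: "p \<in> polys UNIV"
  by (simp add: polys_def)

lemma berezin_missing: "w \<in> Lambda P W \<Longrightarrow> \<not> V \<subseteq> W \<Longrightarrow> berezin V w = 0"
  unfolding berezin_def by (intro sum.neutral) (auto simp: Lambda_def)

lemma berezin_volume_monomial:
  assumes "finite V" "finite T" "T \<inter> V = {}"
  shows "berezin V (gmonom V 1 * gmonom T c) = gmonom T c"
proof -
  have "V \<inter> T = {}" "V \<union> T - V = T" using assms by auto
  then show ?thesis
    using assms by (simp add: gmonom_mult berezin_gmonom mult.assoc[symmetric])
qed

lemma berezin_volume:
  assumes "finite V" "w \<in> Lambda UNIV (- V)"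
  shows "berezin V (gmonom V 1 * w) = w"
  using assms(2)
proof (induction rule: Lambda_induct)
  case (gmonom S m c)
  then show ?case using assms(1) by (intro berezin_volume_monomial) auto
qed (simp_all add: distrib_left berezin_add)

lemma berezin_in_Lambda:
  assumes "w \<in> Lambda P W"
  shows "berezin V w \<in> Lambda P (W - V)"
  unfolding berezin_def
proof (intro sum_in_Lambda)
  fix S assume S: "S \<in> supp w"
  have "shuffle_sign T T' \<in> polys P" for T T' :: "'a set"
    by (simp add: shuffle_sign_def minus_one_power_iff polys_uminus)
  then show "(if V \<subseteq> S then gmonom (S - V) (shuffle_sign V (S - V) * coef w S) else 0) \<in> Lambda P (W - V)"
    using S assms by (auto simp: Lambda_def[of P W] intro!: gmonom_in_Lambda polys_mult)
qed

text \<open>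
  As the volume element stands on the left, factors on the right come out without a sign; those on
  the left have to pass the volume element.
\<close>

lemma berezin_mult_right:
  assumes "finite V" "a \<in> Lambda UNIV (- V)"
  shows "berezin V (w * a) = berezin V w * a"
  using assms(1)
proof (induction w rule: berezin_induct)
  case (volume T c)
  have T: "gmonom T c \<in> Lambda UNIV (- V)" using volume by (intro gmonom_in_Lambda) auto
  then have "gmonom T c * a \<in> Lambda UNIV (- V)" using assms by (intro mult_in_Lambda)
  then show ?case using T assms(1) by (simp add: mult.assoc berezin_volume)
next
  case (missing S c)
  have "gmonom S c * a \<in> Lambda UNIV (S \<union> - V)"
    by (intro mult_in_Lambda gmonom_in_Lambda Lambda_mono[OF assms(2)]) auto
  then have "berezin V (gmonom S c * a) = 0" by (rule berezin_missing) (use missing in auto)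
  then show ?case using missing by (simp add: berezin_gmonom)
qed (simp_all add: distrib_right berezin_add)

lemma berezin_mult_left:
  assumes "finite V" "a \<in> Lambda UNIV (- V)" "homogeneous p a"
  shows "berezin V (a * w) = (-1) ^ (p * card V) * (a * berezin V w)"
  using assms(1)
proof (induction w rule: berezin_induct)
  case (volume T c)
  have T: "gmonom T c \<in> Lambda UNIV (- V)" using volume by (intro gmonom_in_Lambda) auto
  then have aT: "a * gmonom T c \<in> Lambda UNIV (- V)" using assms by (intro mult_in_Lambda)
  have "a * gmonom V 1 = (-1) ^ (p * card V) * (gmonom V 1 * a)"
    by (rule graded_commute[OF assms(3) homogeneous_gmonom]) simp
  then have "a * (gmonom V 1 * gmonom T c) = (-1) ^ (p * card V) * (gmonom V 1 * (a * gmonom T c))"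
    by (simp add: mult.assoc[symmetric])
  then show ?case using berezin_volume[OF assms(1) aT] berezin_volume[OF assms(1) T]
    by (simp add: berezin_neg_one_power)
next
  case (missing S c)
  have "a * gmonom S c \<in> Lambda UNIV (S \<union> - V)"
    by (intro mult_in_Lambda gmonom_in_Lambda Lambda_mono[OF assms(2)]) auto
  then have "berezin V (a * gmonom S c) = 0" by (rule berezin_missing) (use missing in auto)
  then show ?case using missing by (simp add: berezin_gmonom)
qed (simp_all add: distrib_left berezin_add)

text \<open>
  In \<open>koszul v (gmonom V 1 * \<theta>)\<close> the term with the derivative of the volume element lacks a variable
  of \<open>V\<close> and integrates to zero.  The other term carries the sign of moving the differential past the
  volume element.
\<close>

lemma koszul_berezin:
  fixes w :: "('g::linorder, ('v, 'r::comm_ring_1) mpoly) grassmann"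
  assumes "finite V"
  shows "koszul v (berezin V w) = (-1) ^ card V * berezin V (koszul v w)"
  using assms
proof (induction w rule: berezin_induct)
  case (volume T c)
  have T: "gmonom T c \<in> Lambda UNIV (- V)" using volume by (intro gmonom_in_Lambda) auto
  then have kT: "koszul v (gmonom T c) \<in> Lambda UNIV (- V)" by (rule koszul_in_Lambda) simp
  have "berezin V (koszul v (gmonom V 1) * gmonom T c) = berezin V (koszul v (gmonom V 1)) * gmonom T c"
    using assms T by (rule berezin_mult_right)
  also have "berezin V (koszul v (gmonom V 1)) = 0"
  proof -
    have "berezin V (koszul_term v V 1) = (\<Sum>g\<in>V. berezin V (gmonom (V - {g}) (shuffle_sign {g} (V - {g}) * 1 * v g)))"
      unfolding koszul_term_def by (rule berezin_sum)
    also have "\<dots> = 0"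
      using assms by (intro sum.neutral) (auto simp: berezin_gmonom)
    finally show ?thesis using assms by (simp add: koszul_gmonom)
  qed
  finally have "berezin V (koszul v (gmonom V 1 * gmonom T c)) =
      (-1) ^ card V * koszul v (gmonom T c)"
    using berezin_volume[OF assms kT]
    by (simp add: koszul_leibniz[OF homogeneous_gmonom[of V "card V"]] berezin_add mult.assoc
        berezin_neg_one_power)
  then show ?case using berezin_volume[OF assms T]
    by (simp add: mult.assoc[symmetric] power_add[symmetric])
next
  case (missing S c)
  have "koszul v (gmonom S c) \<in> Lambda UNIV S" by (intro koszul_in_Lambda gmonom_in_Lambda) auto
  then show ?case using missing by (simp add: berezin_gmonom berezin_missing)
qed (simp_all add: berezin_add koszul_add distrib_left)

lemma homogeneous_berezin: "finite V \<Longrightarrow> homogeneous p w \<Longrightarrow> homogeneous (p + card V) (berezin V w)"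
  unfolding berezin_def
proof (intro homogeneous_sum)
  fix S assume V: "finite V" and w: "homogeneous p w" and S: "S \<in> supp w"
  show "homogeneous (p + card V)
      (if V \<subseteq> S then gmonom (S - V) (shuffle_sign V (S - V) * coef w S) else 0)"
  proof (cases "V \<subseteq> S")
    case True
    have "card S = card (S - V) + card V"
      using True V finite_of_supp[OF S] by (metis add.commute card_Diff_subset card_mono le_add_diff_inverse)
    moreover have "even (card S) = even p" using w S by (simp add: homogeneous_def)
    ultimately show ?thesis using True by (auto intro!: homogeneous_gmonom)
  qed simp
qed

text \<open>
  The sign is that of interchanging the two volume elements.
\<close>

lemma berezin_commute:
  fixes w :: "('g::linorder, ('v, 'r::comm_ring_1) mpoly) grassmann"
  assumes "finite U" "finite V" "U \<inter> V = {}"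
  shows "berezin U (berezin V w) = (-1) ^ (card U * card V) * berezin V (berezin U w)"
  using assms(1)
proof (induction w rule: berezin_induct)
  case (volume T c)
  have T: "gmonom T c \<in> Lambda UNIV (- U)" using volume by (intro gmonom_in_Lambda) auto
  show ?case
  proof (cases "V \<subseteq> T")
    case True
    define \<theta> where "\<theta> = gmonom (T - V) (shuffle_sign V (T - V) * c)"
    have eq: "gmonom T c = gmonom V 1 * \<theta>"
      using gmonom_factor[OF volume(1) True] by (simp add: \<theta>_def)
    have \<theta>: "\<theta> \<in> Lambda UNIV (- U)" "\<theta> \<in> Lambda UNIV (- V)"
      unfolding \<theta>_def using volume by (auto intro!: gmonom_in_Lambda)
    have U: "(gmonom U 1 :: ('g, ('v, 'r) mpoly) grassmann) \<in> Lambda UNIV (- V)" using assms by (intro gmonom_in_Lambda) auto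
    have "berezin V (gmonom U 1 * (gmonom V 1 * \<theta>)) = (-1) ^ (card U * card V) * (gmonom U 1 * \<theta>)"
      using berezin_mult_left[OF assms(2) U homogeneous_gmonom[of U "card U"]] berezin_volume[OF assms(2) \<theta>(2)] by simp
    then show ?thesis
      using berezin_volume[OF assms(1) T] berezin_volume[OF assms(1) \<theta>(1)]
        berezin_volume[OF assms(2) \<theta>(2)]
      by (simp add: berezin_neg_one_power eq)
  next
    case False
    have "gmonom U 1 * gmonom T c \<in> Lambda UNIV (U \<union> T)"
      by (intro mult_in_Lambda gmonom_in_Lambda) auto
    then have "berezin V (gmonom U 1 * gmonom T c) = 0"
      by (rule berezin_missing) (use False assms in auto)
    moreover have "berezin V (gmonom T c) = 0" using volume False by (simp add: berezin_gmonom)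
    ultimately show ?thesis using berezin_volume[OF assms(1) T] by simp
  qed
next
  case (missing S c)
  have "berezin V (gmonom S c) \<in> Lambda UNIV (S - V)" by (intro berezin_in_Lambda gmonom_in_Lambda) auto
  then have "berezin U (berezin V (gmonom S c)) = 0" by (rule berezin_missing) (use missing in auto)
  then show ?case using missing by (simp add: berezin_gmonom)
qed (simp_all add: berezin_add distrib_left)

lemma (in grassmann_substitution) gsubst_fixed_monomial:
  fixes \<rho> :: "'g \<Rightarrow> ('g, 'b) grassmann"
  assumes "finite V" "\<And>g. g \<in> V \<Longrightarrow> \<rho> g = gen g"
  shows "gsubst \<alpha> \<rho> (gmonom V c) = gmonom V (\<alpha> c)"
proof -
  have "gsubst \<alpha> \<rho> (gmonom V c) = gconst (\<alpha> c) * prod_list (map \<rho> (sorted_list_of_set V))"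
    unfolding gsubst_def using assms(1) by (intro linear_extension_gmonom) (simp_all add: map_zero)
  also have "map \<rho> (sorted_list_of_set V) = map gen (sorted_list_of_set V)"
    using assms by (intro map_cong) auto
  finally show ?thesis using gmonom_eq_prod[OF assms(1), of "\<alpha> c"] by simp
qed

text \<open>
  The images of the variables outside \<open>V\<close> avoid \<open>V\<close>, so a monomial lacking a variable of \<open>V\<close> still
  lacks it after the substitution.
\<close>

lemma gsubst_berezin:
  fixes \<alpha> :: "('v, 'r::comm_ring_1) mpoly \<Rightarrow> ('w, 'q::comm_ring_1) mpoly"
  assumes "grassmann_substitution \<alpha> \<sigma>" "finite V" and fixed: "\<And>g. g \<in> V \<Longrightarrow> \<sigma> g = gen g"
    and others: "\<And>g. g \<notin> V \<Longrightarrow> \<sigma> g \<in> Lambda UNIV (- V)"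
  shows "gsubst \<alpha> \<sigma> (berezin V w) = berezin V (gsubst \<alpha> \<sigma> w)"
proof -
  interpret grassmann_substitution \<alpha> \<sigma> by fact
  from \<open>finite V\<close> show ?thesis
  proof (induction w rule: berezin_induct)
    case (volume T c)
    have T: "gmonom T c \<in> Lambda UNIV (- V)" using volume by (intro gmonom_in_Lambda) auto
    then have "gsubst \<alpha> \<sigma> (gmonom T c) \<in> Lambda UNIV (- V)"
      by (rule gsubst_in_Lambda) (auto intro: others)
    moreover have "gsubst \<alpha> \<sigma> (gmonom V 1) = gmonom V 1"
      using gsubst_fixed_monomial[of V \<sigma> 1] assms(2) fixed by (simp add: map_one)
    ultimately show ?case using T assms(2) by (simp add: berezin_volume gsubst_mult)
  next
    case (missing S c)
    have "gsubst \<alpha> \<sigma> (gmonom S c) \<in> Lambda UNIV (S \<union> - V)"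
    proof (rule gsubst_in_Lambda[where P = UNIV and V = S])
      show "gmonom S c \<in> Lambda UNIV S" by (intro gmonom_in_Lambda) auto
      fix g assume "g \<in> S"
      then show "\<sigma> g \<in> Lambda UNIV (S \<union> - V)"
        using fixed others by (cases "g \<in> V") (auto intro: gen_in_Lambda Lambda_mono)
    qed auto
    then have "berezin V (gsubst \<alpha> \<sigma> (gmonom S c)) = 0" by (rule berezin_missing) (use missing in auto)
    then show ?case using missing by (simp add: berezin_gmonom)
  qed (simp_all add: berezin_add gsubst_add)
qed


section \<open>Determinants as Berezin integrals\<close>

abbreviation u_vars :: "nat \<Rightarrow> gvar set" where
  "u_vars n \<equiv> hat_u ` {..<n}"

lemma nabla_product_in_Lambda:
  assumes "\<And>j. j < m \<Longrightarrow> w j \<in> Lambda P V" "\<And>j k. j < m \<Longrightarrow> k < n \<Longrightarrow> D j k \<in> polys P"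
  shows "nabla_product n m D w \<in> Lambda P (u_vars n \<union> V)"
  unfolding nabla_product_def
proof (intro prod_list_in_Lambda)
  fix a assume "a \<in> set (map (\<lambda>j. (\<Sum>k<n. gen (hat_u k) * gconst (D j k)) + w j) [0..<m])"
  then obtain j where j: "j < m" "a = (\<Sum>k<n. gen (hat_u k) * gconst (D j k)) + w j" by auto
  then show "a \<in> Lambda P (u_vars n \<union> V)"
    unfolding j(2) using assms(2)
    by (intro add_in_Lambda sum_in_Lambda mult_in_Lambda gen_in_Lambda gconst_in_Lambda
        Lambda_mono[OF assms(1)]) auto
qed

lemma homogeneous_u_sum: "homogeneous (Suc 0) (\<Sum>k<n. gen (hat_u k) * gconst (d k))"
  by (intro homogeneous_sum homogeneous_mult_gconst homogeneous_gen)

lemma homogeneous_nabla_product: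
  assumes "\<And>j. j < m \<Longrightarrow> homogeneous (Suc 0) (w j)"
  shows "homogeneous m (nabla_product n m D w)"
proof -
  have "homogeneous (length (map (\<lambda>j. (\<Sum>k<n. gen (hat_u k) * gconst (D j k)) + w j) [0..<m]))
      (nabla_product n m D w)"
    unfolding nabla_product_def
    by (rule homogeneous_prod_list) (auto intro!: homogeneous_add homogeneous_u_sum assms)
  then show ?thesis by simp
qed

text \<open>
  Of the variables \<open>hat_u k\<close> only those with \<open>k < n\<close> occur in the product.  Having degree \<open>n\<close> in them,
  as the defining condition requires, means containing all of them, as the integral requires.
\<close>

lemma nabla_det_eq_berezin:
  fixes w :: "nat \<Rightarrow> 'r::comm_ring_1 elem"
  assumes "\<And>j. j < m \<Longrightarrow> w j \<in> Lambda UNIV (- range hat_u)"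
  shows "nabla_det n m D w = berezin (u_vars n) (nabla_product n m D w)"
proof -
  let ?P = "nabla_product n m D w" and ?U = "u_vars n"
  have fin: "finite ?U" by simp
  have P: "?P \<in> Lambda UNIV (?U \<union> - range hat_u)"
    using assms by (intro nabla_product_in_Lambda) auto
  then have B: "berezin ?U ?P \<in> Lambda UNIV (- range hat_u)"
    by (intro Lambda_mono[OF berezin_in_Lambda]) auto
  have "card ?U = n" by (simp add: card_image inj_on_def)
  have full: "?U \<subseteq> S \<longleftrightarrow> card (S \<inter> range hat_u) = n" if "S \<in> supp ?P" for S
  proof -
    have sub: "S \<inter> range hat_u \<subseteq> ?U" using P that by (auto simp: Lambda_def)
    show ?thesis
    proof
      assume "?U \<subseteq> S"
      then have "S \<inter> range hat_u = ?U" using sub by auto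
      then show "card (S \<inter> range hat_u) = n" using \<open>card ?U = n\<close> by simp
    next
      assume "card (S \<inter> range hat_u) = n"
      then have "S \<inter> range hat_u = ?U" using sub \<open>card ?U = n\<close> fin by (intro card_subset_eq) auto
      then show "?U \<subseteq> S" by auto
    qed
  qed
  have "u_product n * berezin ?U ?P =
      (\<Sum>S\<in>supp ?P. if ?U \<subseteq> S then gmonom S (coef ?P S) else 0)"
    unfolding u_product_eq berezin_def sum_distrib_left
    by (intro sum.cong) (auto simp: gmonom_factor[symmetric] finite_of_supp)
  also have "\<dots> = (\<Sum>S\<in>supp ?P. if card (S \<inter> range hat_u) = n then gmonom S (coef ?P S) else 0)"
    by (intro sum.cong refl) (simp add: full)
  also have "\<dots> = u_component n ?P"
    unfolding u_component_def by (simp add: sum.inter_filter)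
  finally have "u_product n * berezin ?U ?P = u_component n ?P" .
  then show ?thesis
    unfolding nabla_det_def using B nabla_det_ex1[of m w n D] assms
    by (intro the1_equality) auto
qed


section \<open>Extension of linear maps to parameters\<close>

definition additive_on :: "'a::plus set \<Rightarrow> ('a \<Rightarrow> 'b::plus) \<Rightarrow> bool" where
  "additive_on C \<phi> \<longleftrightarrow> (\<forall>a\<in>C. \<forall>b\<in>C. \<phi> (a + b) = \<phi> a + \<phi> b)"

lemma additive_onD: "additive_on C \<phi> \<Longrightarrow> a \<in> C \<Longrightarrow> b \<in> C \<Longrightarrow> \<phi> (a + b) = \<phi> a + \<phi> b"
  by (simp add: additive_on_def)

lemma additive_on_zero:
  assumes "additive_on (Lambda P V) \<phi>"
  shows "\<phi> 0 = (0 :: 'b::ab_group_add)"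
  using additive_onD[OF assms zero_in_Lambda zero_in_Lambda] by simp

lemma additive_on_uminus:
  assumes "additive_on (Lambda P V) \<phi>" "a \<in> Lambda P V"
  shows "\<phi> (- a) = - (\<phi> a :: 'b::ab_group_add)"
proof -
  have "\<phi> (- a) + \<phi> a = 0"
    using additive_onD[OF assms(1) uminus_in_Lambda[OF assms(2)] assms(2)] additive_on_zero[OF assms(1)]
    by simp
  then show ?thesis by (simp add: eq_neg_iff_add_eq_0)
qed

text \<open>
  The contribution of the terms with the Grassmann monomial \<open>S\<close> to \<open>extend_map P V p \<phi>\<close>, as a function
  of the coefficient \<open>q\<close>.  The additivity of the extension in its argument is additivity in \<open>q\<close>.
\<close>

definition extend_term where
  "extend_term P V p \<phi> S q = (\<Sum>m\<in>Poly_Mapping.keys q. (-1) ^ (p * card (S - V)) *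
    gmonom (S - V) (shuffle_sign (S - V) (S \<inter> V) * Poly_Mapping.single (mono_part (- P) m) 1) *
    \<phi> (gmonom (S \<inter> V) (Poly_Mapping.single (mono_part P m) (Poly_Mapping.lookup q m))))"

lemma extend_map_alt: "extend_map P V p \<phi> u = (\<Sum>S\<in>supp u. extend_term P V p \<phi> S (coef u S))"
  by (simp add: extend_map_def extend_term_def)

lemma extend_term_add:
  fixes \<phi> :: "('g::linorder, ('v, 'r::comm_ring_1) mpoly) grassmann \<Rightarrow> ('g, ('v, 'r) mpoly) grassmann"
  assumes "additive_on (Lambda P V) \<phi>"
  shows "extend_term P V p \<phi> S (q + q') = extend_term P V p \<phi> S q + extend_term P V p \<phi> S q'"
  unfolding extend_term_def
proof (rule setsum_keys_plus_distrib)
  fix m and c d :: 'r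
  have "gmonom (S \<inter> V) (Poly_Mapping.single (mono_part P m) c) \<in> Lambda P V" for c :: 'r
    by (intro gmonom_in_Lambda polys_single) (auto simp: keys_mono_part)
  then have "\<phi> (gmonom (S \<inter> V) (Poly_Mapping.single (mono_part P m) c + Poly_Mapping.single (mono_part P m) d)) =
      \<phi> (gmonom (S \<inter> V) (Poly_Mapping.single (mono_part P m) c)) +
      \<phi> (gmonom (S \<inter> V) (Poly_Mapping.single (mono_part P m) d))" for c d :: 'r
    using assms by (simp add: gmonom_add additive_onD)
  then show "(-1) ^ (p * card (S - V)) *
      gmonom (S - V) (shuffle_sign (S - V) (S \<inter> V) * Poly_Mapping.single (mono_part (- P) m) 1) *
      \<phi> (gmonom (S \<inter> V) (Poly_Mapping.single (mono_part P m)
        (Poly_Mapping.lookup q m + Poly_Mapping.lookup q' m))) =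
    (-1) ^ (p * card (S - V)) *
      gmonom (S - V) (shuffle_sign (S - V) (S \<inter> V) * Poly_Mapping.single (mono_part (- P) m) 1) *
      \<phi> (gmonom (S \<inter> V) (Poly_Mapping.single (mono_part P m) (Poly_Mapping.lookup q m))) +
    (-1) ^ (p * card (S - V)) *
      gmonom (S - V) (shuffle_sign (S - V) (S \<inter> V) * Poly_Mapping.single (mono_part (- P) m) 1) *
      \<phi> (gmonom (S \<inter> V) (Poly_Mapping.single (mono_part P m) (Poly_Mapping.lookup q' m)))"
    by (simp add: single_add distrib_left)
qed (simp add: additive_on_zero[OF assms])

lemma extend_map_add:
  assumes "additive_on (Lambda P V) \<phi>"
  shows "extend_map P V p \<phi> (a + b) = extend_map P V p \<phi> a + extend_map P V p \<phi> b"
  unfolding extend_map_alt by (rule linear_extension_add) (rule extend_term_add[OF assms])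

lemma extend_map_zero [simp]: "extend_map P V p \<phi> 0 = 0"
  by (simp add: extend_map_def supp_def)

lemma extend_map_tensor:
  fixes \<phi> :: "('g::linorder, ('v, 'r::comm_ring_1) mpoly) grassmann \<Rightarrow> ('g, ('v, 'r) mpoly) grassmann"
  assumes \<phi>: "additive_on (Lambda P V) \<phi>" and fin: "finite T" "finite S"
    and T: "T \<inter> V = {}" and S: "S \<subseteq> V"
    and m: "Poly_Mapping.keys m \<inter> P = {}" and m': "Poly_Mapping.keys m' \<subseteq> P"
  shows "extend_map P V p \<phi>
      (gmonom T (Poly_Mapping.single m 1) * gmonom S (Poly_Mapping.single m' c)) =
    (-1) ^ (p * card T) *
      (gmonom T (Poly_Mapping.single m 1) * \<phi> (gmonom S (Poly_Mapping.single m' c)))"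
proof -
  let ?e = "shuffle_sign T S :: 'r"
  have sign: "(shuffle_sign T S :: ('v, 'r) mpoly) = pconst ?e"
    by (simp add: shuffle_sign_def minus_one_power_iff pconst_def single_uminus)
  have TS: "T \<inter> S = {}" "(T \<union> S) - V = T" "(T \<union> S) \<inter> V = S" using T S by auto
  have parts: "mono_part P (m + m') = m'" "mono_part (- P) (m + m') = m"
  proof -
    have "mono_part P m' = m'" "mono_part P m = 0" "mono_part (- P) m' = 0" "mono_part (- P) m = m"
      using m m' by (auto intro!: mono_part_id mono_part_none)
    then show "mono_part P (m + m') = m'" "mono_part (- P) (m + m') = m"
      by (simp_all add: mono_part_add)
  qed
  have "extend_map P V p \<phi>
      (gmonom T (Poly_Mapping.single m 1) * gmonom S (Poly_Mapping.single m' c)) =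
    extend_map P V p \<phi> (gmonom (T \<union> S) (Poly_Mapping.single (m + m') (?e * c)))"
    using fin TS by (simp add: gmonom_mult sign pconst_def mult_single)
  also have "\<dots> = extend_term P V p \<phi> (T \<union> S) (Poly_Mapping.single (m + m') (?e * c))"
    unfolding extend_map_alt using fin
    by (intro linear_extension_gmonom) (simp_all add: extend_term_def)
  also have "\<dots> = (-1) ^ (p * card T) * gmonom T (shuffle_sign T S * Poly_Mapping.single m 1) *
      \<phi> (gmonom S (Poly_Mapping.single m' (?e * c)))"
    by (cases "?e * c = 0") (simp_all add: extend_term_def TS parts additive_on_zero[OF \<phi>])
  also have "\<dots> = (-1) ^ (p * card T) *
      (gmonom T (Poly_Mapping.single m 1) * \<phi> (gmonom S (Poly_Mapping.single m' c)))"
  proof -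
    have "gmonom S (Poly_Mapping.single m' c) \<in> Lambda P V"
      using S m' by (intro gmonom_in_Lambda polys_single)
    from additive_on_uminus[OF \<phi> this] show ?thesis
      unfolding sign
      by (cases "even (card {(a, b). a \<in> T \<and> b \<in> S \<and> b < a})")
        (simp_all add: shuffle_sign_def pconst_def single_uminus gmonom_uminus mult.assoc)
  qed
  finally show ?thesis .
qed

text \<open>
  An extension to parameters is determined by additivity and its values on the products of a monomial
  in the parameters with a monomial in the variables acted on.
\<close>

lemma extend_map_unique:
  fixes \<phi> :: "('g::linorder, ('v, 'r::comm_ring_1) mpoly) grassmann \<Rightarrow> ('g, ('v, 'r) mpoly) grassmann"
  assumes \<phi>: "additive_on (Lambda P V) \<phi>" and \<Phi>: "\<And>a b. \<Phi> (a + b) = \<Phi> a + \<Phi> b"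
    and tensor: "\<And>T m S m' c. finite T \<Longrightarrow> T \<inter> V = {} \<Longrightarrow> Poly_Mapping.keys m \<inter> P = {} \<Longrightarrow>
      finite S \<Longrightarrow> S \<subseteq> V \<Longrightarrow> Poly_Mapping.keys m' \<subseteq> P \<Longrightarrow>
      \<Phi> (gmonom T (Poly_Mapping.single m 1) * gmonom S (Poly_Mapping.single m' c)) =
      (-1) ^ (p * card T) *
      (gmonom T (Poly_Mapping.single m 1) * \<phi> (gmonom S (Poly_Mapping.single m' c)))"
  shows "extend_map P V p \<phi> u = \<Phi> u"
proof -
  have "u \<in> Lambda UNIV UNIV" by (simp add: Lambda_def)
  then show ?thesis
  proof (induction rule: tensor_induct[where P = P and V = V])
    case zero
    have "\<Phi> 0 + \<Phi> 0 = \<Phi> 0" using \<Phi>[of 0 0] by simp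
    then show ?case by simp
  next
    case (add a b)
    then show ?case by (simp add: extend_map_add[OF \<phi>] \<Phi>)
  next
    case (tensor T m S m' c)
    then have *: "T \<inter> V = {}" "S \<subseteq> V" "Poly_Mapping.keys m \<inter> P = {}" "Poly_Mapping.keys m' \<subseteq> P"
      by auto
    show ?case
      using extend_map_tensor[OF \<phi> tensor(1,4) *] assms(3)[OF tensor(1) *(1,3) tensor(4) *(2,4)]
      by simp
  qed
qed

text \<open>
  The functional takes \<open>w\<close> to \<open>1\<close> if \<open>w\<close> is the volume element, and its extension takes \<open>\<theta> w\<close> to
  \<open>(-1)\<^bsup>s |\<theta>|\<^esup> \<theta>\<close>; the sign turns \<open>\<theta> w\<close> into \<open>w \<theta>\<close>, which the integral sends to \<open>\<theta>\<close>.
\<close>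

lemma det_f_eq_berezin: "det_f c s = berezin (small_vars c s)"
proof
  fix w :: "'r::comm_ring_1 elem"
  let ?V = "small_vars c s"
  have fin: "finite ?V" and card: "card ?V = s"
    by (simp_all add: small_vars_def card_image inj_on_def)
  show "det_f c s w = berezin ?V w"
    unfolding det_f_def
  proof (rule extend_map_unique)
    show "additive_on (Lambda {} ?V) (\<lambda>w. gconst (coef w ?V))"
      by (simp add: additive_on_def gmonom_add)
  next
    fix T S :: "gvar set" and m m' :: "(side \<times> nat) \<Rightarrow>\<^sub>0 nat" and d :: 'r
    assume T: "finite T" "T \<inter> ?V = {}" and S: "finite S" "S \<subseteq> ?V"
    have "berezin ?V (gmonom T (Poly_Mapping.single m 1) * gmonom S (Poly_Mapping.single m' d)) =
        (-1) ^ (card T * card ?V) * (gmonom T (Poly_Mapping.single m 1) *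
          berezin ?V (gmonom S (Poly_Mapping.single m' d)))"
      using T fin by (intro berezin_mult_left gmonom_in_Lambda homogeneous_gmonom) auto
    moreover have "berezin ?V (gmonom S (Poly_Mapping.single m' d)) =
        gconst (coef (gmonom S (Poly_Mapping.single m' d)) ?V)"
    proof (cases "S = ?V")
      case False
      then have "\<not> ?V \<subseteq> S" using S by auto
      then show ?thesis using S False by (simp add: berezin_gmonom coef_gmonom)
    qed (use fin in \<open>simp add: berezin_gmonom coef_gmonom\<close>)
    ultimately show "berezin ?V (gmonom T (Poly_Mapping.single m 1) * gmonom S (Poly_Mapping.single m' d)) =
        (-1) ^ (s * card T) * (gmonom T (Poly_Mapping.single m 1) *
          gconst (coef (gmonom S (Poly_Mapping.single m' d)) ?V))"
      by (simp add: card mult.commute)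
  qed (rule berezin_add)
qed


section \<open>Contraction with functionals\<close>

lemma contract_map_homogeneous:
  "homogeneous q w \<Longrightarrow> \<phi> 0 = 0 \<Longrightarrow> contract_map p \<phi> w = (-1) ^ (q * p) * \<phi> w"
  by (cases "even q") (simp_all add: contract_map_def gpart_homogeneous minus_one_power_iff)

lemma contract_map_add:
  "(\<And>a b. \<phi> (a + b) = \<phi> a + \<phi> b) \<Longrightarrow> contract_map p \<phi> (a + b) = contract_map p \<phi> a + contract_map p \<phi> b"
  by (simp add: contract_map_def gpart_add distrib_left)

lemma scalar_add: "scalar (a + b) = scalar a + scalar b"
  by (simp add: scalar_def pconst_add gmonom_add)

lemma scalar_zero [simp]: "scalar 0 = 0"
  by (simp add: scalar_def)

lemma scalar_uminus: "scalar (- a) = - scalar a"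
  by (simp add: scalar_def pconst_def single_uminus gmonom_uminus)

lemma dual_complex_additive: "L \<in> dual_complex C \<Longrightarrow> additive_on C L"
  by (simp add: dual_complex_def additive_on_def)

lemma dual_complex_scalar: "L \<in> dual_complex C \<Longrightarrow> a \<in> C \<Longrightarrow> L (scalar r * a) = r * L a"
  by (simp add: dual_complex_def)

lemma functional_contract_zero [simp]: "functional_contract P V 0 L = 0"
  by (simp add: functional_contract_def contract_map_def)

context
  fixes P :: "'v set" and V :: "'g::linorder set"
    and L :: "('g, ('v, 'r::comm_ring_1) mpoly) grassmann \<Rightarrow> 'r"
  assumes L: "L \<in> dual_complex (Lambda P V)"
begin

lemma additive_on_functional: "additive_on (Lambda P V) (\<lambda>u. scalar (L (gpart p u)))"
  using additive_onD[OF dual_complex_additive[OF L]]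
  by (simp add: additive_on_def gpart_add gpart_in_Lambda scalar_add)

lemma functional_contract_add:
  "functional_contract P V (a + b) L = functional_contract P V a L + functional_contract P V b L"
  by (simp add: functional_contract_def contract_map_add[OF extend_map_add[OF additive_on_functional]])

lemma functional_contract_uminus: "functional_contract P V (- a) L = - functional_contract P V a L"
  using functional_contract_add[of "- a" a] by (simp add: eq_neg_iff_add_eq_0)

lemma functional_contract_diff:
  "functional_contract P V (a - b) L = functional_contract P V a L - functional_contract P V b L"
  using functional_contract_add[of a "- b"] by (simp add: functional_contract_uminus)

lemma functional_contract_tensor:
  assumes fin: "finite T" "finite S" and T: "T \<inter> V = {}" and S: "S \<subseteq> V"
    and m: "Poly_Mapping.keys m \<inter> P = {}" and m': "Poly_Mapping.keys m' \<subseteq> P"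
  shows "functional_contract P V
      (gmonom T (Poly_Mapping.single m 1) * gmonom S (Poly_Mapping.single m' c)) L =
    gmonom T (Poly_Mapping.single m 1) * scalar (L (grade_involution (gmonom S (Poly_Mapping.single m' c))))"
proof -
  let ?\<theta> = "gmonom T (Poly_Mapping.single m 1)" and ?w = "gmonom S (Poly_Mapping.single m' c)"
  have \<theta>: "homogeneous (card T) ?\<theta>" and w: "homogeneous (card S) ?w"
    by (simp_all add: homogeneous_gmonom)
  then have "contract_map p (extend_map P V p (\<lambda>u. scalar (L (gpart p u)))) (?\<theta> * ?w) =
      (-1) ^ ((card T + card S) * p) * ((-1) ^ (p * card T) * (?\<theta> * scalar (L (gpart p ?w))))" for p
    by (simp add: contract_map_homogeneous[OF homogeneous_mult[OF \<theta> w]]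
        extend_map_tensor[OF additive_on_functional fin T S m m'])
  moreover have "?w \<in> Lambda P V" using S m' by (intro gmonom_in_Lambda polys_single)
  then have "L (- ?w) = - L ?w" by (rule additive_on_uminus[OF dual_complex_additive[OF L]])
  moreover have "L 0 = 0" by (rule additive_on_zero[OF dual_complex_additive[OF L]])
  ultimately show ?thesis using w
    by (cases "even (card S)"; cases "even (card T)")
      (simp_all add: functional_contract_def gpart_homogeneous grade_involution_homogeneous scalar_uminus)
qed

text \<open>
  The contraction with a component of \<open>L\<close> of parity \<open>p\<close> has the sign \<open>(-1)\<^bsup>p (|\<theta>| + |w|)\<^esup>\<close>, of which the
  extension to the parameters \<open>\<theta>\<close> cancels \<open>(-1)\<^bsup>p |\<theta>|\<^esup>\<close>.  Only \<open>p = |w|\<close> contributes, and the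
  remaining sign \<open>(-1)\<^bsup>|w|\<^esup>\<close> is the effect of the grade involution.
\<close>

lemma functional_contract_mult:
  assumes "\<theta> \<in> Lambda (- P) (- V)" "w \<in> Lambda P V"
  shows "functional_contract P V (\<theta> * w) L = \<theta> * scalar (L (grade_involution w))"
  using assms(1)
proof (induction rule: Lambda_induct)
  case (gmonom T m c)
  from assms(2) show ?case
  proof (induction rule: Lambda_induct)
    case (add a b)
    then show ?case
      by (simp add: distrib_left functional_contract_add grade_involution_add scalar_add
          additive_onD[OF dual_complex_additive[OF L]] grade_involution_in_Lambda)
  next
    case (gmonom S m' d)
    let ?w = "gmonom S (Poly_Mapping.single m' d)"
    have w: "?w \<in> Lambda P V" using gmonom by (intro gmonom_in_Lambda polys_single)
    have sw: "scalar c * ?w = gmonom S (Poly_Mapping.single m' (c * d))"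
      using gmonom by (simp add: scalar_def pconst_def gmonom_mult mult_single)
    have \<theta>: "gmonom T (Poly_Mapping.single m c) = gmonom T (Poly_Mapping.single m 1) * scalar c"
      using \<open>finite T\<close> by (simp add: scalar_def pconst_def gmonom_mult mult_single)
    have "homogeneous (card S) ?w" "homogeneous (card S) (scalar c * ?w)"
      by (simp_all add: homogeneous_gmonom sw)
    then have "grade_involution (scalar c * ?w) = scalar c * grade_involution ?w"
      by (simp add: grade_involution_homogeneous)
    then have "L (grade_involution (scalar c * ?w)) = c * L (grade_involution ?w)"
      using w by (simp add: dual_complex_scalar[OF L] grade_involution_in_Lambda)
    moreover have "functional_contract P V (gmonom T (Poly_Mapping.single m 1) * (scalar c * ?w)) L =
        gmonom T (Poly_Mapping.single m 1) * scalar (L (grade_involution (scalar c * ?w)))"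
      unfolding sw using gmonom \<open>finite T\<close> \<open>T \<subseteq> - V\<close> \<open>Poly_Mapping.keys m \<subseteq> - P\<close>
      by (intro functional_contract_tensor) auto
    moreover have "(scalar (c * r) :: ('g, ('v, 'r) mpoly) grassmann) = scalar c * scalar r" for r
      by (simp add: scalar_def pconst_mult gmonom_mult)
    ultimately show ?case by (simp add: \<theta> mult.assoc)
  qed (simp add: additive_on_zero[OF dual_complex_additive[OF L]])
qed (simp_all add: distrib_right functional_contract_add)

end

section \<open>Products of odd elements\<close>

text \<open>
  Up to sign \<open>b\<close> can be moved next to its other occurrence, and its square is zero.
\<close>

lemma prod_list_odd_absorb:
  assumes "\<And>a. a \<in> set as \<Longrightarrow> homogeneous (Suc 0) a" "b \<in> set as"
  shows "prod_list as * b = 0"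
  using assms
proof (induction as)
  case (Cons a as)
  have as: "homogeneous (length as) (prod_list as)" by (intro homogeneous_prod_list Cons) auto
  show ?case
  proof (cases "b = a")
    case True
    have "prod_list as * a = (-1) ^ (length as * Suc 0) * (a * prod_list as)"
      using Cons by (intro graded_commute as) auto
    then have "a * (prod_list as * a) = (-1) ^ length as * ((a * a) * prod_list as)"
      by (simp add: mult.assoc minus_one_power_iff)
    moreover have "a * a = 0" using Cons by (intro odd_square) auto
    ultimately show ?thesis using True by (simp add: mult.assoc)
  next
    case False
    then have "prod_list as * b = 0" using Cons by auto
    then show ?thesis by (simp add: mult.assoc)
  qed
qed simp

lemma homogeneous_prod_upt:
  assumes "\<And>j. j < t \<Longrightarrow> homogeneous (Suc 0) (y j)"
  shows "homogeneous t (prod_list (map y [0..<t]))"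
proof -
  have "homogeneous (length (map y [0..<t])) (prod_list (map y [0..<t]))"
    by (rule homogeneous_prod_list) (auto intro: assms)
  then show ?thesis by simp
qed

text \<open>
  If the products of \<open>w\<close> with the odd elements \<open>d i\<close> vanish, they still do after \<open>w\<close> has been multiplied
  by further odd elements, which anticommute with the \<open>d i\<close>.  Hence the factors may be changed one after the other by combinations of the \<open>d i\<close>.
\<close>

lemma absorb_prod_list:
  fixes w :: "('g::linorder, 'a::comm_ring_1) grassmann"
  assumes y: "\<And>j. j < t \<Longrightarrow> homogeneous (Suc 0) (y j)"
    and d: "\<And>i. i < s \<Longrightarrow> homogeneous (Suc 0) (d i)" "\<And>i. i < s \<Longrightarrow> w * d i = 0"
    and diff: "\<And>j. j < t \<Longrightarrow> x j = y j + (\<Sum>i<s. d i * gconst (g i j))"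
  shows "w * prod_list (map x [0..<t]) = w * prod_list (map y [0..<t])"
  using y diff
proof (induction t)
  case (Suc t)
  let ?Y = "prod_list (map y [0..<t])"
  have Y: "homogeneous t ?Y"
    by (rule homogeneous_prod_upt) (simp add: Suc(2))
  have zero: "w * (?Y * d i) = 0" if "i < s" for i
  proof -
    have "?Y * d i = (-1) ^ (t * Suc 0) * (d i * ?Y)" by (rule graded_commute[OF Y d(1)[OF that]])
    then have "w * (?Y * d i) = (-1) ^ t * ((w * d i) * ?Y)"
      by (simp add: mult.assoc minus_one_power_iff)
    then show ?thesis using d(2)[OF that] by simp
  qed
  have "w * (?Y * (\<Sum>i<s. d i * gconst (g i t))) = (\<Sum>i<s. (w * (?Y * d i)) * gconst (g i t))"
    by (simp add: sum_distrib_left mult.assoc)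
  also have "\<dots> = 0" by (intro sum.neutral) (simp add: zero)
  finally have "w * (?Y * x t) = w * (?Y * y t)" using Suc(3)[of t] by (simp add: distrib_left)
  moreover have "w * prod_list (map x [0..<t]) = w * ?Y" using Suc by auto
  ultimately show ?case by (simp add: mult.assoc[symmetric])
qed simp

text \<open>
  Write \<open>\<alpha>\<^sub>0 \<cdots> \<alpha>\<^sub>t - \<beta>\<^sub>0 \<cdots> \<beta>\<^sub>t\<close> as
  \<open>(\<alpha>\<^sub>0 \<cdots> \<alpha>\<^sub>t\<^sub>-\<^sub>1 - \<beta>\<^sub>0 \<cdots> \<beta>\<^sub>t\<^sub>-\<^sub>1) \<alpha>\<^sub>t + \<beta>\<^sub>0 \<cdots> \<beta>\<^sub>t\<^sub>-\<^sub>1 (\<alpha>\<^sub>t - \<beta>\<^sub>t)\<close>: a boundary times a cycle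
  plus a cycle times a boundary.
\<close>

lemma prod_list_homotopic:
  assumes \<alpha>: "\<And>j. j < t \<Longrightarrow> \<alpha> j \<in> Lambda P V" "\<And>j. j < t \<Longrightarrow> koszul v (\<alpha> j) = 0"
    and \<beta>: "\<And>j. j < t \<Longrightarrow> \<beta> j \<in> Lambda P V" "\<And>j. j < t \<Longrightarrow> koszul v (\<beta> j) = 0"
      "\<And>j. j < t \<Longrightarrow> homogeneous (Suc 0) (\<beta> j)"
    and \<eta>: "\<And>j. j < t \<Longrightarrow> \<exists>\<eta>\<in>Lambda P V. \<alpha> j - \<beta> j = koszul v \<eta>"
  shows "\<exists>W\<in>Lambda P V. prod_list (map \<alpha> [0..<t]) - prod_list (map \<beta> [0..<t]) = koszul v W"
  using assms
proof (induction t)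
  case 0
  then show ?case by (intro bexI[of _ 0]) auto
next
  case (Suc t)
  let ?A = "prod_list (map \<alpha> [0..<t])" and ?B = "prod_list (map \<beta> [0..<t])"
  from Suc have "\<exists>W\<in>Lambda P V. ?A - ?B = koszul v W" by auto
  then obtain W where W: "W \<in> Lambda P V" "?A - ?B = koszul v W" by blast
  from Suc.prems(6)[of t] obtain \<eta> where \<eta>: "\<eta> \<in> Lambda P V" "\<alpha> t - \<beta> t = koszul v \<eta>" by auto
  have B: "homogeneous t ?B" by (rule homogeneous_prod_upt) (simp add: Suc.prems(5))
  have "koszul v ?B = 0" using Suc.prems(4) by (intro koszul_prod_list_cycle) auto
  then have "koszul v (?B * \<eta>) = (-1) ^ t * (?B * koszul v \<eta>)" by (rule koszul_cycle_mult[OF B])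
  then have B\<eta>: "koszul v ((-1) ^ t * (?B * \<eta>)) = ?B * koszul v \<eta>"
    by (simp add: minus_one_power_iff koszul_uminus)
  have "?A * \<alpha> t - ?B * \<beta> t = (?A - ?B) * \<alpha> t + ?B * (\<alpha> t - \<beta> t)" by (simp add: algebra_simps)
  also have "\<dots> = koszul v (W * \<alpha> t + (-1) ^ t * (?B * \<eta>))"
    using Suc.prems(2)[of t] by (simp add: W \<eta> B\<eta> koszul_add koszul_mult_cycle)
  finally have "?A * \<alpha> t - ?B * \<beta> t = koszul v (W * \<alpha> t + (-1) ^ t * (?B * \<eta>))" .
  moreover have "W * \<alpha> t + (-1) ^ t * (?B * \<eta>) \<in> Lambda P V"
    using W \<eta> Suc.prems by (intro add_in_Lambda mult_in_Lambda neg_one_power_in_Lambda prod_list_in_Lambda) auto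
  ultimately show ?case by (intro bexI) simp_all
qed


section \<open>Delta functions\<close>

lemma finite_small_vars [simp]: "finite (small_vars c s)"
  by (simp add: small_vars_def)

lemma card_small_vars [simp]: "card (small_vars c s) = s"
  by (simp add: small_vars_def card_image inj_on_def)

lemma card_u_vars [simp]: "card (u_vars n) = n"
  by (simp add: card_image inj_on_def)

lemma small_volume_Suc:
  "gmonom (small_vars c (Suc s)) 1 = gmonom (small_vars c s) 1 * (gen (hat_f c s) :: 'r::comm_ring_1 elem)"
proof -
  have "shuffle_sign (small_vars c s) {hat_f c s} = (1 :: 'r poly_xy)"
    by (intro shuffle_sign_ordered) (cases c; auto simp: less_gvar_def small_vars_def)
  moreover have "small_vars c s \<union> {hat_f c s} = small_vars c (Suc s)"
    by (auto simp: small_vars_def lessThan_Suc)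
  ultimately show ?thesis by (auto simp: gmonom_mult small_vars_def)
qed

text \<open>
  Expanding the product, one meets all the variables \<open>hat_f c i\<close> only by choosing \<open>- hat_f c i\<close> from
  every factor.
\<close>

lemma delta_leading_term:
  fixes a :: "nat \<Rightarrow> 'r::comm_ring_1 elem"
  assumes "\<And>i. i < s \<Longrightarrow> a i \<in> Lambda UNIV (- range (hat_f c))"
  shows "\<forall>S\<in>supp (prod_list (map (\<lambda>i. a i - gen (hat_f c i)) [0..<s]) -
    (-1) ^ s * gmonom (small_vars c s) 1). \<not> small_vars c s \<subseteq> S"
  using assms
proof (induction s)
  case 0
  then show ?case by (simp add: small_vars_def supp_def flip: one_grassmann_def)
next
  case (Suc s)
  let ?d = "\<lambda>s. prod_list (map (\<lambda>i. a i - gen (hat_f c i)) [0..<s]) :: 'r elem"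
  let ?r = "\<lambda>s. ?d s - (-1) ^ s * gmonom (small_vars c s) 1"
  have eq: "?r (Suc s) = ?d s * a s - ?r s * gen (hat_f c s)"
    by (simp add: small_volume_Suc algebra_simps)
  have "?d s \<in> Lambda UNIV (- {hat_f c s})"
  proof (intro prod_list_in_Lambda)
    fix b assume "b \<in> set (map (\<lambda>i. a i - gen (hat_f c i)) [0..<s])"
    then obtain i where "i < s" "b = a i - gen (hat_f c i)" by auto
    then show "b \<in> Lambda UNIV (- {hat_f c s})"
      by (auto intro!: diff_in_Lambda gen_in_Lambda Lambda_mono[OF Suc.prems])
  qed
  moreover have "a s \<in> Lambda UNIV (- {hat_f c s})"
    by (rule Lambda_mono[OF Suc.prems]) auto
  ultimately have da: "?d s * a s \<in> Lambda UNIV (- {hat_f c s})" by (rule mult_in_Lambda)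
  show ?case
  proof
    fix S assume "S \<in> supp (?r (Suc s))"
    then have "S \<in> supp (?d s * a s) \<or> S \<in> supp (?r s * gen (hat_f c s))"
      unfolding eq supp_iff by auto
    then show "\<not> small_vars c (Suc s) \<subseteq> S"
    proof
      assume "S \<in> supp (?d s * a s)"
      then have "hat_f c s \<notin> S" using da by (auto simp: Lambda_def)
      then show ?thesis by (auto simp: small_vars_def)
    next
      assume "S \<in> supp (?r s * gen (hat_f c s))"
      then obtain T T' where T: "T \<in> supp (?r s)" "T' \<in> supp (gen (hat_f c s) :: 'r elem)" "S = T \<union> T'"
        by (rule supp_multE)
      then have "T' = {hat_f c s}" by (auto simp: supp_def coef_gmonom split: if_splits)
      moreover obtain i where "i < s" "hat_f c i \<notin> T"
        using T(1) Suc by (fastforce simp: small_vars_def)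
      ultimately have "hat_f c i \<notin> S" "i < Suc s" using T(3) by auto
      then show ?thesis by (auto simp: small_vars_def)
    qed
  qed
qed

lemma berezin_delta:
  fixes a :: "nat \<Rightarrow> 'r::comm_ring_1 elem"
  assumes "\<And>i. i < s \<Longrightarrow> a i \<in> Lambda UNIV (- range (hat_f c))"
  shows "berezin (small_vars c s) (prod_list (map (\<lambda>i. a i - gen (hat_f c i)) [0..<s])) = (-1) ^ s"
proof -
  let ?V = "small_vars c s" and ?d = "prod_list (map (\<lambda>i. a i - gen (hat_f c i)) [0..<s])"
  have "berezin ?V (?d - (-1) ^ s * gmonom ?V 1) = 0"
    unfolding berezin_def[of _ "_ - _"] using delta_leading_term[OF assms]
    by (intro sum.neutral) auto
  then have "berezin ?V ?d = (-1) ^ s * berezin ?V (gmonom ?V 1)"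
    by (simp add: berezin_diff berezin_neg_one_power)
  then show ?thesis by (simp add: berezin_gmonom flip: one_grassmann_def)
qed

definition dual_product ::
    "side \<Rightarrow> nat \<Rightarrow> nat \<Rightarrow> (nat \<Rightarrow> nat \<Rightarrow> 'r poly_n) \<Rightarrow> 'r::comm_ring_1 elem" where
  "dual_product c s t G = prod_list (map (\<lambda>j. fG c s G j - gen (hat_F c j)) [0..<t])"

lemma dual_det_eq: "dual_det c s t G h = berezin (small_vars c s) (dual_product c s t G * h)"
  by (simp add: dual_det_def dual_product_def det_f_eq_berezin)

lemma homogeneous_fG: "homogeneous (Suc 0) (fG c s G j)"
  unfolding fG_def by (intro homogeneous_sum homogeneous_mult_gconst homogeneous_gen)

lemma fG_in_Lambda:
  assumes "\<And>i. i < s \<Longrightarrow> G i j \<in> polys {..<n}"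
  shows "fG c s G j \<in> Lambda (pvars c n) (small_vars c s)"
  unfolding fG_def using assms
  by (intro sum_in_Lambda mult_in_Lambda gen_in_Lambda gconst_in_Lambda at_side_polys)
    (auto simp: small_vars_def)

lemma homogeneous_dual_product: "homogeneous t (dual_product c s t G)"
  unfolding dual_product_def by (intro homogeneous_prod_upt homogeneous_diff homogeneous_fG homogeneous_gen)

lemma dual_product_in_Lambda:
  assumes "\<And>i j. i < s \<Longrightarrow> j < t \<Longrightarrow> G i j \<in> polys {..<n}"
  shows "dual_product c s t G \<in> Lambda (pvars c n) (small_vars c s \<union> big_vars c t)"
  unfolding dual_product_def
proof (rule prod_list_in_Lambda)
  fix b assume "b \<in> set (map (\<lambda>j. fG c s G j - gen (hat_F c j)) [0..<t])"
  then obtain j where j: "j < t" "b = fG c s G j - gen (hat_F c j)" by auto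
  have "fG c s G j \<in> Lambda (pvars c n) (small_vars c s)" using assms j by (intro fG_in_Lambda) auto
  then show "b \<in> Lambda (pvars c n) (small_vars c s \<union> big_vars c t)"
    unfolding j(2) using j(1)
    by (intro diff_in_Lambda gen_in_Lambda) (auto intro: Lambda_mono simp: big_vars_def)
qed

text \<open>
  The product of the \<open>a i - hat_f c i\<close> is, up to sign, the delta function at \<open>a\<close>: multiplication by it
  replaces every \<open>hat_f c i\<close> by \<open>a i\<close>.
\<close>

lemma delta_substitution:
  fixes a :: "nat \<Rightarrow> 'r::comm_ring_1 elem"
  assumes a: "\<And>i. i < s \<Longrightarrow> a i \<in> Lambda UNIV (- range (hat_f c))" "\<And>i. i < s \<Longrightarrow> homogeneous (Suc 0) (a i)"
  shows "berezin (small_vars c s)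
      (prod_list (map (\<lambda>i. a i - gen (hat_f c i)) [0..<s]) * dual_product c s t G) =
    (-1) ^ s * prod_list (map (\<lambda>j. (\<Sum>i<s. a i * gconst (at_side c (G i j))) - gen (hat_F c j)) [0..<t])"
proof -
  let ?d = "prod_list (map (\<lambda>i. a i - gen (hat_f c i)) [0..<s])"
  let ?y = "\<lambda>j. (\<Sum>i<s. a i * gconst (at_side c (G i j))) - gen (hat_F c j)"
  let ?Y = "prod_list (map ?y [0..<t])"
  have dodd: "homogeneous (Suc 0) (a i - gen (hat_f c i))" if "i < s" for i
    by (intro homogeneous_diff a that) simp
  have "?d * dual_product c s t G = ?d * ?Y"
    unfolding dual_product_def
  proof (rule absorb_prod_list)
    show "homogeneous (Suc 0) (?y j)" for j
      by (intro homogeneous_diff homogeneous_sum homogeneous_mult_gconst a) auto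
    show "homogeneous (Suc 0) (gen (hat_f c i) - a i)" if "i < s" for i
      by (intro homogeneous_diff a that) simp
    show "?d * (gen (hat_f c i) - a i) = 0" if "i < s" for i
    proof -
      have "?d * (a i - gen (hat_f c i)) = 0"
        using that dodd by (intro prod_list_odd_absorb) auto
      then show ?thesis by (simp add: right_diff_distrib)
    qed
    show "fG c s G j - gen (hat_F c j) = ?y j + (\<Sum>i<s. (gen (hat_f c i) - a i) * gconst (at_side c (G i j)))"
      for j by (simp add: fG_def left_diff_distrib sum_subtractf)
  qed
  moreover have "?Y \<in> Lambda UNIV (- small_vars c s)"
  proof (rule prod_list_in_Lambda)
    fix b assume "b \<in> set (map ?y [0..<t])"
    then obtain j where "b = ?y j" by auto
    moreover have "a i \<in> Lambda UNIV (- small_vars c s)" if "i < s" for i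
      by (rule Lambda_mono[OF a(1)[OF that]]) (auto simp: small_vars_def)
    ultimately show "b \<in> Lambda UNIV (- small_vars c s)"
      by (auto intro!: diff_in_Lambda sum_in_Lambda mult_in_Lambda gen_in_Lambda gconst_in_Lambda
          simp: small_vars_def)
  qed
  ultimately show ?thesis by (simp add: berezin_mult_right berezin_delta[OF a(1)])
qed


section \<open>The determinant with the dual column\<close>

lemma dual_product_in_Lambda_UNIV: "dual_product c s t G \<in> Lambda UNIV (range (hat_f c) \<union> range (hat_F c))"
  unfolding dual_product_def fG_def
  by (auto intro!: prod_list_in_Lambda diff_in_Lambda sum_in_Lambda mult_in_Lambda gen_in_Lambda gconst_in_Lambda)

lemma dual_det_add: "dual_det c s t G (a + b) = dual_det c s t G a + dual_det c s t G b"
  by (simp add: dual_det_eq distrib_left berezin_add)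

lemma dual_det_zero [simp]: "dual_det c s t G 0 = 0"
  by (simp add: dual_det_eq)

text \<open>
  The sign is that of moving \<open>\<theta>\<close> past the \<open>t\<close> odd factors and past the integral over \<open>s\<close>
  variables.
\<close>

lemma dual_det_parameter:
  assumes "\<theta> \<in> Lambda UNIV (- small_vars c s)" "homogeneous p \<theta>"
  shows "dual_det c s t G (\<theta> * w) = (-1) ^ ((s + t) * p) * (\<theta> * dual_det c s t G w)"
proof -
  have "dual_product c s t G * \<theta> = (-1) ^ (t * p) * (\<theta> * dual_product c s t G)"
    by (rule graded_commute[OF homogeneous_dual_product assms(2)])
  then have "dual_product c s t G * (\<theta> * w) = (-1) ^ (t * p) * (\<theta> * (dual_product c s t G * w))"
    by (simp add: mult.assoc[symmetric])
  then show ?thesis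
    by (simp add: dual_det_eq berezin_mult_left[OF _ assms] minus_one_power_iff berezin_uminus)
qed

text \<open>
  The formula for \<open>dual_det\<close> already obeys the sign rule for parameters.
\<close>

lemma extend_dual_det:
  fixes G :: "nat \<Rightarrow> nat \<Rightarrow> 'r::comm_ring_1 poly_n"
  shows "extend_map {} (small_vars c s) (s + t) (dual_det c s t G) = dual_det c s t G"
proof
  fix u :: "'r elem"
  show "extend_map {} (small_vars c s) (s + t) (dual_det c s t G) u = dual_det c s t G u"
  proof (rule extend_map_unique)
    show "additive_on (Lambda {} (small_vars c s)) (dual_det c s t G)"
      by (simp add: additive_on_def dual_det_add)
  next
    fix T S :: "gvar set" and m m' :: "(side \<times> nat) \<Rightarrow>\<^sub>0 nat" and d :: 'r
    assume "T \<inter> small_vars c s = {}"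
    then show "dual_det c s t G (gmonom T (Poly_Mapping.single m 1) * gmonom S (Poly_Mapping.single m' d)) =
        (-1) ^ ((s + t) * card T) * (gmonom T (Poly_Mapping.single m 1) *
          dual_det c s t G (gmonom S (Poly_Mapping.single m' d)))"
      by (intro dual_det_parameter gmonom_in_Lambda homogeneous_gmonom) auto
  qed (rule dual_det_add)
qed

lemma homogeneous_dual_det: "homogeneous p h \<Longrightarrow> homogeneous (p + s + t) (dual_det c s t G h)"
proof -
  assume "homogeneous p h"
  then have "homogeneous (t + p + card (small_vars c s)) (dual_det c s t G h)"
    unfolding dual_det_eq
    by (intro homogeneous_berezin homogeneous_mult homogeneous_dual_product) auto
  then show ?thesis by (auto elim: homogeneous_cong)
qed

lemma dual_det_in_Lambda:
  assumes "\<And>i j. i < s \<Longrightarrow> j < t \<Longrightarrow> G i j \<in> polys {..<n}" "h \<in> Lambda (pvars c n) (small_vars c s)"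
  shows "dual_det c s t G h \<in> Lambda (pvars c n) (big_vars c t)"
proof -
  have "dual_product c s t G * h \<in> Lambda (pvars c n) (small_vars c s \<union> big_vars c t)"
    by (intro mult_in_Lambda dual_product_in_Lambda assms(1) Lambda_mono[OF assms(2)]) auto
  then have "dual_det c s t G h \<in> Lambda (pvars c n) ((small_vars c s \<union> big_vars c t) - small_vars c s)"
    unfolding dual_det_eq by (rule berezin_in_Lambda)
  then show ?thesis by (rule Lambda_mono) auto
qed

text \<open>
  The values of the variables under a Koszul differential: \<open>z = 0\<close> gives \<open>differential f F\<close>, and
  \<open>z k = y\<^sub>k - x\<^sub>k\<close> the total differential.
\<close>

abbreviation gen_values :: "(nat \<Rightarrow> 'r poly_xy) \<Rightarrow> (nat \<Rightarrow> 'r poly_n) \<Rightarrow> (nat \<Rightarrow> 'r poly_n) \<Rightarrow>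
    gvar \<Rightarrow> 'r::comm_ring_1 poly_xy" where
  "gen_values z f F \<equiv> (\<lambda>g. case g of hat_u k \<Rightarrow> z k | hat_f c i \<Rightarrow> at_side c (f i) | hat_F c j \<Rightarrow> at_side c (F j))"

lemma koszul_fG: "koszul (gen_values z f F) (fG c s G j) = gconst (at_side c (\<Sum>i<s. f i * G i j))"
proof -
  have "koszul (gen_values z f F) (fG c s G j) = (\<Sum>i<s. gconst (at_side c (f i)) * gconst (at_side c (G i j)))"
    by (simp add: fG_def koszul_sum koszul_mult_cycle koszul_gen)
  then show ?thesis by (simp add: gmonom_mult gmonom_sum at_side_simps)
qed

text \<open>
  The factors are cycles because of the relation between \<open>F\<close>, \<open>f\<close> and \<open>G\<close>.  The differential passes \<open>t\<close>
  of them and the integral over \<open>s\<close> variables.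
\<close>

lemma dual_det_boundary:
  assumes "\<And>j. j < t \<Longrightarrow> F j = (\<Sum>i<s. f i * G i j)"
  shows "differential f F (dual_det c s t G h) = (-1) ^ (s + t) * dual_det c s t G (differential f F h)"
proof -
  have "differential f F (dual_product c s t G) = 0"
    unfolding dual_product_def differential_def
    by (rule koszul_prod_list_cycle) (auto simp: koszul_diff koszul_fG koszul_gen assms)
  then have "differential f F (dual_product c s t G * h) =
      (-1) ^ t * (dual_product c s t G * differential f F h)"
    unfolding differential_def by (rule koszul_cycle_mult[OF homogeneous_dual_product])
  then show ?thesis
    by (simp add: dual_det_eq differential_def koszul_berezin berezin_neg_one_power
        power_add mult.assoc)
qed


section \<open>The first homology of the differences \<open>x\<^sub>k - y\<^sub>k\<close>\<close>

text \<open>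
  This is the vanishing of the first Koszul homology of the regular sequence \<open>x\<^sub>k - y\<^sub>k\<close>, by induction on
  its length.  Putting \<open>x\<^sub>n = y\<^sub>n\<close> in the coefficients \<open>e k\<close> with \<open>k < n\<close> gives a relation of length \<open>n\<close>,
  covered by the induction hypothesis.  The coefficients change by \<open>(x\<^sub>n - y\<^sub>n) q k\<close>, which is
  compensated by the boundary of \<open>hat_u n * (\<Sum>k<n. hat_u k * q k)\<close>.  Then the coefficient of \<open>hat_u n\<close>
  is right as well, since \<open>x\<^sub>n - y\<^sub>n\<close> is not a zero divisor.
\<close>

lemma koszul_u_cycle_is_boundary:
  fixes e :: "nat \<Rightarrow> 'r::comm_ring_1 poly_xy"
  assumes "\<And>k. k < n \<Longrightarrow> e k \<in> polys W" "\<And>k. k < n \<Longrightarrow> (Xv, k) \<in> W \<and> (Yv, k) \<in> W"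
    and "(\<Sum>k<n. (pvar (Xv, k) - pvar (Yv, k)) * e k) = 0"
    and v: "\<And>k. k < n \<Longrightarrow> v (hat_u k) = - (pvar (Xv, k) - pvar (Yv, k))"
  shows "\<exists>\<eta>\<in>Lambda W (u_vars n). koszul v \<eta> = (\<Sum>k<n. gen (hat_u k) * gconst (e k))"
  using assms
proof (induction n arbitrary: e)
  case 0
  then show ?case by (intro bexI[of _ 0]) auto
next
  case (Suc n)
  let ?z = "\<lambda>k. pvar (Xv, k) - pvar (Yv, k) :: 'r poly_xy"
  let ?\<rho> = "psubst (\<lambda>v. if v = (Xv, n) then pvar (Yv, n) else pvar v) :: 'r poly_xy \<Rightarrow> 'r poly_xy"
  have "\<exists>q\<in>polys W. e k - ?\<rho> (e k) = ?z n * q" if "k < n" for k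
    using Suc.prems(1)[of k] Suc.prems(2)[of n] that by (intro difference_quotient_of_substitution) auto
  then have "\<forall>k\<in>{..<n}. \<exists>q. q \<in> polys W \<and> e k - ?\<rho> (e k) = ?z n * q" by blast
  from bchoice[OF this] obtain q
    where "\<forall>k\<in>{..<n}. q k \<in> polys W \<and> e k - ?\<rho> (e k) = ?z n * q k" by blast
  then have q: "\<And>k. k < n \<Longrightarrow> q k \<in> polys W" "\<And>k. k < n \<Longrightarrow> e k - ?\<rho> (e k) = ?z n * q k"
    by simp_all
  have \<rho>: "?\<rho> (?z k) = (if k = n then 0 else ?z k)" for k by (simp add: psubst_diff)
  have "(\<Sum>k<n. ?z k * ?\<rho> (e k)) = (\<Sum>k<n. ?\<rho> (?z k * e k))"
    by (intro sum.cong) (simp_all add: psubst_mult \<rho>)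
  also have "\<dots> = ?\<rho> (\<Sum>k<Suc n. ?z k * e k)" by (simp add: psubst_add psubst_sum psubst_mult \<rho>)
  finally have \<rho>0: "(\<Sum>k<n. ?z k * ?\<rho> (e k)) = 0" unfolding Suc.prems(3) by simp
  have "?\<rho> (e k) \<in> polys W" if "k < n" for k
    using Suc.prems(1)[of k] Suc.prems(2)[of n] that by (auto intro!: psubst_polys polys_pvar)
  then obtain \<eta> where \<eta>: "\<eta> \<in> Lambda W (u_vars n)" "koszul v \<eta> = (\<Sum>k<n. gen (hat_u k) * gconst (?\<rho> (e k)))"
    using Suc.IH[of "\<lambda>k. ?\<rho> (e k)"] Suc.prems(2,4) \<rho>0 by auto
  \<comment> \<open>The relation determines the last coefficient, as its factor can be cancelled.\<close>
  have "?z n * (e n + (\<Sum>k<n. ?z k * q k)) = 0"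
  proof -
    have "(\<Sum>k<n. ?z k * e k) = (\<Sum>k<n. ?z k * ?\<rho> (e k)) + (\<Sum>k<n. ?z k * (e k - ?\<rho> (e k)))"
      by (simp add: sum.distrib[symmetric] distrib_left[symmetric])
    also have "\<dots> = (\<Sum>k<n. ?z k * (?z n * q k))"
      using q(2) by (simp add: \<rho>0)
    also have "\<dots> = ?z n * (\<Sum>k<n. ?z k * q k)" by (simp add: sum_distrib_left mult.left_commute)
    finally have "(\<Sum>k<n. ?z k * e k) = ?z n * (\<Sum>k<n. ?z k * q k)" .
    moreover have "(\<Sum>k<n. ?z k * e k) + ?z n * e n = 0" using Suc.prems(3) by simp
    ultimately show ?thesis by (simp only: distrib_left add.commute)
  qed
  then have "e n + (\<Sum>k<n. ?z k * q k) = 0" by (rule pvar_difference_cancel[rotated]) simp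
  then have en: "e n = - (\<Sum>k<n. ?z k * q k)" by (simp only: eq_neg_iff_add_eq_0)
  let ?q = "\<Sum>k<n. gen (hat_u k) * gconst (q k) :: 'r elem"
  have kq: "koszul v ?q = gconst (e n)"
  proof -
    have "koszul v ?q = (\<Sum>k<n. gconst (- ?z k) * gconst (q k))"
      using Suc.prems(4) by (simp add: koszul_sum koszul_mult_cycle koszul_gen)
    also have "\<dots> = gconst (\<Sum>k<n. - ?z k * q k)" by (simp add: gmonom_mult gmonom_sum)
    also have "(\<Sum>k<n. - ?z k * q k) = e n" unfolding en by (simp only: sum_negf mult_minus_left)
    finally show ?thesis .
  qed
  have "koszul v (gen (hat_u n) * ?q) = gconst (- ?z n) * ?q - gen (hat_u n) * gconst (e n)"
    using Suc.prems(4)[of n] by (simp add: koszul_gen_mult kq)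
  also have "gconst (- ?z n) * ?q = - (\<Sum>k<n. gen (hat_u k) * gconst (?z n * q k))"
  proof -
    have "gconst (- z) * (gen (hat_u k) * gconst p) = - (gen (hat_u k) * gconst (z * p) :: 'r elem)"
      for z p k by (simp add: gmonom_mult gmonom_uminus[symmetric])
    then show ?thesis by (simp only: sum_distrib_left sum_negf)
  qed
  also have "(\<Sum>k<n. gen (hat_u k) * gconst (?z n * q k)) =
      (\<Sum>k<n. gen (hat_u k) * (gconst (e k) - gconst (?\<rho> (e k))) :: 'r elem)"
  proof (intro sum.cong refl)
    fix k assume "k \<in> {..<n}"
    then have "?z n * q k = e k - ?\<rho> (e k)" using q(2) by simp
    then show "gen (hat_u k) * gconst (?z n * q k) = gen (hat_u k) * (gconst (e k) - gconst (?\<rho> (e k)) :: 'r elem)"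
      by (simp only: diff_conv_add_uminus gmonom_add gmonom_uminus)
  qed
  finally have "koszul v (\<eta> - gen (hat_u n) * ?q) = (\<Sum>k<Suc n. gen (hat_u k) * gconst (e k))"
    by (simp add: koszul_diff \<eta>(2) right_diff_distrib sum_subtractf)
  moreover have "\<eta> - gen (hat_u n) * ?q \<in> Lambda W (u_vars (Suc n))"
    using q(1) by (intro diff_in_Lambda mult_in_Lambda sum_in_Lambda gen_in_Lambda gconst_in_Lambda
        Lambda_mono[OF \<eta>(1)]) auto
  ultimately show ?case by blast
qed

section \<open>Comparison of the determinants\<close>

lemma gmonom_diff: "gmonom S (c - d) = gmonom S c - gmonom S (d :: 'a::ab_group_add)"
  by (rule grassmann_eqI) (simp add: coef_gmonom)

definition u_form :: "nat \<Rightarrow> (nat \<Rightarrow> 'r poly_xy) \<Rightarrow> 'r::comm_ring_1 elem" where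
  "u_form n d = (\<Sum>k<n. gen (hat_u k) * gconst (d k))"

lemma homogeneous_u_form: "homogeneous (Suc 0) (u_form n d)"
  unfolding u_form_def by (rule homogeneous_u_sum)

lemma u_form_in_Lambda: "(\<And>k. k < n \<Longrightarrow> d k \<in> polys P) \<Longrightarrow> u_form n d \<in> Lambda P (u_vars n)"
  unfolding u_form_def by (intro sum_in_Lambda mult_in_Lambda gen_in_Lambda gconst_in_Lambda) auto

lemma u_form_diff: "u_form n (\<lambda>k. d k - d' k) = u_form n d - u_form n d'"
  by (simp add: u_form_def gmonom_diff right_diff_distrib sum_subtractf)

lemma u_form_mult_gconst: "u_form n d * gconst c = u_form n (\<lambda>k. d k * c)"
  by (simp add: u_form_def sum_distrib_right gmonom_mult mult.assoc)

lemma u_form_sum: "u_form n (\<lambda>k. \<Sum>i\<in>A. d i k) = (\<Sum>i\<in>A. u_form n (d i))"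
  by (simp add: u_form_def gmonom_sum sum_distrib_left) (rule sum.swap)

lemma koszul_u_form: "koszul v (u_form n d) = gconst (\<Sum>k<n. v (hat_u k) * d k)"
proof -
  have "koszul v (u_form n d) = (\<Sum>k<n. gconst (v (hat_u k)) * gconst (d k))"
    by (simp add: u_form_def koszul_sum koszul_mult_cycle koszul_gen)
  then show ?thesis by (simp add: gmonom_mult gmonom_sum)
qed

lemma nabla_product_alt: "nabla_product n m D w = prod_list (map (\<lambda>j. u_form n (D j) + w j) [0..<m])"
  by (simp add: nabla_product_def u_form_def)

text \<open>
  The sign of the contraction, the one of moving the integral over the \<open>hat_u k\<close> past the product
  \<open>dual_product Yv s t G\<close>, those of interchanging the two integrals and the two products, and the sign
  \<open>(-1)\<^sup>s\<close> of the delta function cancel.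
\<close>

lemma dual_contraction_nabla_det:
  fixes D :: "nat \<Rightarrow> nat \<Rightarrow> 'r::comm_ring_1 poly_xy"
  shows "contract_map (s + t) (dual_det Yv s t G)
      (nabla_det n s D (\<lambda>i. gen (hat_f Xv i) - gen (hat_f Yv i))) =
    nabla_det n t (\<lambda>j k. \<Sum>i<s. D i k * at_side Yv (G i j))
      (\<lambda>j. (\<Sum>i<s. gen (hat_f Xv i) * gconst (at_side Yv (G i j))) - gen (hat_F Yv j))"
proof -
  let ?w = "\<lambda>i. gen (hat_f Xv i) - gen (hat_f Yv i) :: 'r elem" and ?U = "u_vars n" and ?V = "small_vars Yv s"
  let ?D = "\<lambda>j k. \<Sum>i<s. D i k * at_side Yv (G i j)"
  let ?w' = "\<lambda>j. (\<Sum>i<s. gen (hat_f Xv i) * gconst (at_side Yv (G i j))) - gen (hat_F Yv j)"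
  let ?P = "nabla_product n s D ?w" and ?B = "dual_product Yv s t G"
  define a where "a i = u_form n (D i) + gen (hat_f Xv i)" for i
  have w: "?w i \<in> Lambda UNIV (- range hat_u)" for i
    by (intro diff_in_Lambda gen_in_Lambda) auto
  have P: "homogeneous s ?P"
    by (intro homogeneous_nabla_product homogeneous_diff homogeneous_gen)
  have Q: "nabla_det n s D ?w = berezin ?U ?P" using w by (rule nabla_det_eq_berezin)
  have "homogeneous (s + n) (berezin ?U ?P)"
    using homogeneous_berezin[of ?U s ?P] P by simp
  then have "contract_map (s + t) (dual_det Yv s t G) (nabla_det n s D ?w) =
      (-1) ^ ((s + n) * (s + t)) * berezin ?V (?B * berezin ?U ?P)"
    unfolding Q by (simp add: contract_map_homogeneous dual_det_eq)
  also have "berezin ?V (?B * berezin ?U ?P) = (-1) ^ (t * n) * berezin ?V (berezin ?U (?B * ?P))"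
  proof -
    have "?B \<in> Lambda UNIV (- ?U)" by (rule Lambda_mono[OF dual_product_in_Lambda_UNIV]) auto
    then have "berezin ?U (?B * ?P) = (-1) ^ (t * n) * (?B * berezin ?U ?P)"
      using berezin_mult_left[of ?U ?B t ?P] homogeneous_dual_product[of t Yv s G] by simp
    then have "?B * berezin ?U ?P = (-1) ^ (t * n) * berezin ?U (?B * ?P)"
      by (simp add: minus_one_power_iff)
    then show ?thesis by (simp add: berezin_neg_one_power)
  qed
  also have "?B * ?P = (-1) ^ (t * s) * (?P * ?B)"
    by (rule graded_commute[OF homogeneous_dual_product P])
  also have "berezin ?V (berezin ?U ((-1) ^ (t * s) * (?P * ?B))) =
      (-1) ^ (t * s) * ((-1) ^ (s * n) * berezin ?U (berezin ?V (?P * ?B)))"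
  proof -
    have "berezin ?V (berezin ?U (?P * ?B)) = (-1) ^ (s * n) * berezin ?U (berezin ?V (?P * ?B))"
      using berezin_commute[of ?V ?U "?P * ?B"] by (auto simp: small_vars_def card_image inj_on_def)
    then show ?thesis by (simp add: berezin_neg_one_power)
  qed
  also have "berezin ?V (?P * ?B) = (-1) ^ s * nabla_product n t ?D ?w'"
  proof -
    have "a i \<in> Lambda UNIV (- range (hat_f Yv))" for i
      unfolding a_def
      by (intro add_in_Lambda gen_in_Lambda Lambda_mono[OF u_form_in_Lambda[of n "D i" UNIV]]) auto
    moreover have "homogeneous (Suc 0) (a i)" for i
      unfolding a_def by (intro homogeneous_add homogeneous_u_form homogeneous_gen)
    ultimately have "berezin ?V (prod_list (map (\<lambda>i. a i - gen (hat_f Yv i)) [0..<s]) * ?B) =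
        (-1) ^ s * prod_list (map (\<lambda>j. (\<Sum>i<s. a i * gconst (at_side Yv (G i j))) - gen (hat_F Yv j)) [0..<t])"
      by (intro delta_substitution)
    moreover have "?P = prod_list (map (\<lambda>i. a i - gen (hat_f Yv i)) [0..<s])"
      by (simp add: nabla_product_alt a_def algebra_simps)
    moreover have "nabla_product n t ?D ?w' =
        prod_list (map (\<lambda>j. (\<Sum>i<s. a i * gconst (at_side Yv (G i j))) - gen (hat_F Yv j)) [0..<t])"
      by (simp add: nabla_product_alt a_def distrib_right sum.distrib u_form_mult_gconst u_form_sum
          add_diff_eq)
    ultimately show ?thesis by simp
  qed
  also have "(-1) ^ ((s + n) * (s + t)) * ((-1) ^ (t * n) * ((-1) ^ (t * s) * ((-1) ^ (s * n) *
      berezin ?U ((-1) ^ s * nabla_product n t ?D ?w')))) = berezin ?U (nabla_product n t ?D ?w')"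
    by (cases "even s"; cases "even t"; cases "even n") (simp_all add: berezin_uminus)
  also have "\<dots> = nabla_det n t ?D ?w'"
    by (intro nabla_det_eq_berezin[symmetric] diff_in_Lambda sum_in_Lambda mult_in_Lambda
        gen_in_Lambda gconst_in_Lambda) auto
  finally show ?thesis .
qed

locale koszul_transformation =
  fixes n s t :: nat
    and f F :: "nat \<Rightarrow> 'r::comm_ring_1 poly_n"
    and G :: "nat \<Rightarrow> nat \<Rightarrow> 'r poly_n"
    and nabla :: "'r poly_n \<Rightarrow> nat \<Rightarrow> 'r poly_xy"
  assumes f: "\<forall>i<s. f i \<in> polys {..<n}"
    and F: "\<forall>j<t. F j \<in> polys {..<n}"
    and G: "\<forall>i<s. \<forall>j<t. G i j \<in> polys {..<n}"
    and F_eq: "\<forall>j<t. F j = (\<Sum>i<s. f i * G i j)"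
    and nabla: "difference_quotients n nabla"
begin

abbreviation xy :: "(side \<times> nat) set" where
  "xy \<equiv> pvars Xv n \<union> pvars Yv n"

abbreviation total_values :: "gvar \<Rightarrow> 'r poly_xy" where
  "total_values \<equiv> gen_values (\<lambda>k. pvar (Yv, k) - pvar (Xv, k)) f F"

lemma nabla_polys: "H \<in> polys {..<n} \<Longrightarrow> k < n \<Longrightarrow> nabla H k \<in> polys xy"
  using nabla by (simp add: difference_quotients_def)

lemma nabla_sum: "H \<in> polys {..<n} \<Longrightarrow>
    (\<Sum>k<n. (pvar (Xv, k) - pvar (Yv, k)) * nabla H k) = at_side Xv H - at_side Yv H"
  using nabla by (simp add: difference_quotients_def)

lemma at_side_xy: "H \<in> polys {..<n} \<Longrightarrow> at_side c H \<in> polys xy"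
  using polys_mono[OF at_side_polys[of H n c], of xy] by (cases c) auto

lemma differential_eq_total:
  assumes "w \<in> Lambda P V" "V \<inter> range hat_u = {}"
  shows "differential f F w = koszul total_values w"
  unfolding differential_def using assms by (intro koszul_cong[OF assms(1)]) (auto split: gvar.split)

lemma koszul_total_u_form: "koszul total_values (u_form n d) =
    - gconst (\<Sum>k<n. (pvar (Xv, k) - pvar (Yv, k)) * d k)"
proof -
  have "(\<Sum>k<n. (pvar (Yv, k) - pvar (Xv, k)) * d k) = - (\<Sum>k<n. (pvar (Xv, k) - pvar (Yv, k)) * d k)"
    by (simp add: sum_negf[symmetric] mult_minus_left[symmetric] del: mult_minus_left)
  then show ?thesis by (simp add: koszul_u_form gmonom_uminus)
qed

text \<open>
  The factors of the products behind the two sides of the first equivalence: \<open>upper_row\<close> for the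
  determinant on the left, \<open>lower_row\<close> for the contraction on the right once the delta function has
  been integrated out.
\<close>

definition upper_row :: "nat \<Rightarrow> 'r elem" where
  "upper_row j = u_form n (nabla (F j)) + (fG Xv s G j - gen (hat_F Yv j))"

definition lower_row :: "nat \<Rightarrow> 'r elem" where
  "lower_row j = u_form n (\<lambda>k. \<Sum>i<s. nabla (f i) k * at_side Yv (G i j)) +
    ((\<Sum>i<s. gen (hat_f Xv i) * gconst (at_side Yv (G i j))) - gen (hat_F Yv j))"

abbreviation ambient :: "gvar set" where
  "ambient \<equiv> u_vars n \<union> (small_vars Xv s \<union> big_vars Yv t)"

lemma fG_difference_in_Lambda: "j < t \<Longrightarrow>
    fG Xv s G j - gen (hat_F Yv j) \<in> Lambda xy (small_vars Xv s \<union> big_vars Yv t)"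
  using G by (intro diff_in_Lambda Lambda_mono[OF fG_in_Lambda[of s G j n Xv]] gen_in_Lambda)
    (auto simp: big_vars_def)

lemma mixed_difference_in_Lambda: "j < t \<Longrightarrow>
    (\<Sum>i<s. gen (hat_f Xv i) * gconst (at_side Yv (G i j))) - gen (hat_F Yv j)
      \<in> Lambda xy (small_vars Xv s \<union> big_vars Yv t)"
  using G by (intro diff_in_Lambda sum_in_Lambda mult_in_Lambda gen_in_Lambda gconst_in_Lambda at_side_xy)
    (auto simp: big_vars_def small_vars_def)

lemma mixed_quotient_polys: "j < t \<Longrightarrow> k < n \<Longrightarrow> (\<Sum>i<s. nabla (f i) k * at_side Yv (G i j)) \<in> polys xy"
  using f G by (intro polys_sum polys_mult nabla_polys at_side_xy) auto

lemma upper_row_in_Lambda: "j < t \<Longrightarrow> upper_row j \<in> Lambda xy ambient"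
  unfolding upper_row_def using F
  by (intro add_in_Lambda Lambda_mono[OF u_form_in_Lambda[of n _ xy]]
      Lambda_mono[OF fG_difference_in_Lambda] nabla_polys) auto

lemma lower_row_in_Lambda: "j < t \<Longrightarrow> lower_row j \<in> Lambda xy ambient"
  unfolding lower_row_def
  by (intro add_in_Lambda Lambda_mono[OF u_form_in_Lambda[of n _ xy]]
      Lambda_mono[OF mixed_difference_in_Lambda] mixed_quotient_polys) auto

lemma koszul_upper_row:
  assumes "j < t"
  shows "koszul total_values (upper_row j) = 0"
proof -
  have "at_side Xv (\<Sum>i<s. f i * G i j) = at_side Xv (F j)" using F_eq assms by simp
  then show ?thesis
    using F assms
    by (simp add: upper_row_def koszul_add koszul_diff koszul_total_u_form koszul_fG koszul_gen
        nabla_sum gmonom_diff)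
qed

lemma at_side_F: "j < t \<Longrightarrow> at_side c (F j) = (\<Sum>i<s. at_side c (f i) * at_side c (G i j))"
  using F_eq by (simp add: at_side_simps)

lemma mixed_quotient_sum:
  assumes "j < t"
  shows "(\<Sum>k<n. (pvar (Xv, k) - pvar (Yv, k)) * (\<Sum>i<s. nabla (f i) k * at_side Yv (G i j))) =
    (\<Sum>i<s. at_side Xv (f i) * at_side Yv (G i j)) - at_side Yv (F j)"
proof -
  have "(\<Sum>k<n. (pvar (Xv, k) - pvar (Yv, k)) * (\<Sum>i<s. nabla (f i) k * at_side Yv (G i j))) =
      (\<Sum>i<s. (\<Sum>k<n. (pvar (Xv, k) - pvar (Yv, k)) * nabla (f i) k) * at_side Yv (G i j))"
    by (simp add: sum_distrib_left sum_distrib_right mult.assoc) (rule sum.swap)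
  also have "\<dots> = (\<Sum>i<s. (at_side Xv (f i) - at_side Yv (f i)) * at_side Yv (G i j))"
    using f by (intro sum.cong) (simp_all add: nabla_sum)
  finally show ?thesis using assms by (simp add: at_side_F left_diff_distrib sum_subtractf)
qed

lemma koszul_lower_row:
  assumes "j < t"
  shows "koszul total_values (lower_row j) = 0"
proof -
  have "koszul total_values (\<Sum>i<s. gen (hat_f Xv i) * gconst (at_side Yv (G i j))) =
      (\<Sum>i<s. gconst (at_side Xv (f i)) * gconst (at_side Yv (G i j)))"
    by (simp add: koszul_sum koszul_mult_cycle koszul_gen)
  also have "\<dots> = gconst (\<Sum>i<s. at_side Xv (f i) * at_side Yv (G i j))"
    by (simp add: gmonom_mult gmonom_sum)
  finally show ?thesis
    unfolding lower_row_def koszul_add koszul_diff koszul_total_u_form mixed_quotient_sum[OF assms]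
    by (simp add: koszul_gen gmonom_diff)
qed

text \<open>
  The boundary of \<open>\<gamma>\<close> accounts for the difference of \<open>G i j\<close> at \<open>x\<close> and at \<open>y\<close> in the coefficients of the
  \<open>hat_f Xv i\<close>.  The form \<open>e\<close> in the \<open>hat_u k\<close> that remains is a cycle, by the difference quotient
  identities for \<open>F j\<close>, the \<open>f i\<close> and the \<open>G i j\<close>.
\<close>

lemma rows_homologous:
  assumes j: "j < t"
  shows "\<exists>\<eta>\<in>Lambda xy ambient. upper_row j - lower_row j = koszul total_values \<eta>"
proof -
  let ?z = "\<lambda>k. pvar (Xv, k) - pvar (Yv, k) :: 'r poly_xy"
  define e where "e k = nabla (F j) k - (\<Sum>i<s. nabla (f i) k * at_side Yv (G i j))
    - (\<Sum>i<s. nabla (G i j) k * at_side Xv (f i))" for k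
  define \<gamma> where "\<gamma> = (\<Sum>i<s. u_form n (nabla (G i j)) * gen (hat_f Xv i))"
  have e_polys: "e k \<in> polys xy" if "k < n" for k
    unfolding e_def using that F f G j
    by (intro polys_diff mixed_quotient_polys polys_sum polys_mult nabla_polys at_side_xy) auto
  have "(\<Sum>k<n. ?z k * (\<Sum>i<s. nabla (G i j) k * at_side Xv (f i))) =
      (\<Sum>i<s. (\<Sum>k<n. ?z k * nabla (G i j) k) * at_side Xv (f i))"
    by (simp add: sum_distrib_left sum_distrib_right mult.assoc) (rule sum.swap)
  also have "\<dots> = (\<Sum>i<s. (at_side Xv (G i j) - at_side Yv (G i j)) * at_side Xv (f i))"
    using G j by (intro sum.cong) (simp_all add: nabla_sum)
  also have "\<dots> = at_side Xv (F j) - (\<Sum>i<s. at_side Xv (f i) * at_side Yv (G i j))"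
    using j by (simp add: at_side_F left_diff_distrib right_diff_distrib sum_subtractf mult.commute)
  finally have "(\<Sum>k<n. ?z k * e k) = 0"
    using F j unfolding e_def
    by (simp only: right_diff_distrib[of "?z _"] sum_subtractf nabla_sum mixed_quotient_sum) simp
  then obtain \<zeta> where \<zeta>: "\<zeta> \<in> Lambda xy (u_vars n)" "koszul total_values \<zeta> = u_form n e"
    using koszul_u_cycle_is_boundary[of n e xy total_values, folded u_form_def] e_polys
    by (auto simp: pvars_def)
  have \<gamma>: "koszul total_values \<gamma> =
      - (\<Sum>i<s. gen (hat_f Xv i) * (gconst (at_side Xv (G i j)) - gconst (at_side Yv (G i j))))
      - u_form n (\<lambda>k. \<Sum>i<s. nabla (G i j) k * at_side Xv (f i))"
  proof -
    have "koszul total_values (u_form n (nabla (G i j)) * gen (hat_f Xv i)) =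
        - (gen (hat_f Xv i) * (gconst (at_side Xv (G i j)) - gconst (at_side Yv (G i j))))
        - u_form n (\<lambda>k. nabla (G i j) k * at_side Xv (f i))" if "i < s" for i
    proof -
      have "G i j \<in> polys {..<n}" using G j that by auto
      then have "koszul total_values (u_form n (nabla (G i j))) =
          - (gconst (at_side Xv (G i j)) - gconst (at_side Yv (G i j)))"
        by (simp only: koszul_total_u_form nabla_sum gmonom_diff)
      then show ?thesis
        by (simp add: koszul_leibniz[OF homogeneous_u_form] koszul_gen u_form_mult_gconst
            right_diff_distrib left_diff_distrib gconst_commute)
    qed
    then show ?thesis
      by (simp add: \<gamma>_def koszul_sum u_form_sum sum_subtractf sum_negf)
  qed
  have "upper_row j - lower_row j = u_form n e - koszul total_values \<gamma>"
    unfolding \<gamma> upper_row_def lower_row_def e_def fG_def u_form_diff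
    by (simp add: right_diff_distrib sum_subtractf)
  then have "upper_row j - lower_row j = koszul total_values (\<zeta> - \<gamma>)"
    by (simp add: koszul_diff \<zeta>)
  moreover have "\<zeta> - \<gamma> \<in> Lambda xy ambient"
    unfolding \<gamma>_def using G j
    by (intro diff_in_Lambda Lambda_mono[OF \<zeta>(1)] sum_in_Lambda mult_in_Lambda gen_in_Lambda
        Lambda_mono[OF u_form_in_Lambda[of n _ xy]] nabla_polys) (auto simp: small_vars_def)
  ultimately show ?thesis by blast
qed

definition upper_det :: "'r elem" where
  "upper_det = nabla_det n t (\<lambda>j. nabla (F j)) (\<lambda>j. fG Xv s G j - gen (hat_F Yv j))"

definition small_det :: "'r elem" where
  "small_det = nabla_det n s (\<lambda>i. nabla (f i)) (\<lambda>i. gen (hat_f Xv i) - gen (hat_f Yv i))"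

definition lower_det :: "'r elem" where
  "lower_det = contract_map (s + t) (dual_det Yv s t G) small_det"

lemma upper_det_eq: "upper_det = berezin (u_vars n) (prod_list (map upper_row [0..<t]))"
proof -
  have "upper_det = berezin (u_vars n)
      (nabla_product n t (\<lambda>j. nabla (F j)) (\<lambda>j. fG Xv s G j - gen (hat_F Yv j)))"
    unfolding upper_det_def
    by (rule nabla_det_eq_berezin, rule Lambda_mono[OF fG_difference_in_Lambda])
      (auto simp: small_vars_def big_vars_def)
  then show ?thesis by (simp add: nabla_product_alt upper_row_def[abs_def])
qed

lemma lower_det_eq: "lower_det = berezin (u_vars n) (prod_list (map lower_row [0..<t]))"
proof -
  have "lower_det = berezin (u_vars n) (nabla_product n t (\<lambda>j k. \<Sum>i<s. nabla (f i) k * at_side Yv (G i j))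
      (\<lambda>j. (\<Sum>i<s. gen (hat_f Xv i) * gconst (at_side Yv (G i j))) - gen (hat_F Yv j)))"
    unfolding lower_det_def small_det_def dual_contraction_nabla_det
    by (rule nabla_det_eq_berezin, rule Lambda_mono[OF mixed_difference_in_Lambda])
      (auto simp: small_vars_def big_vars_def)
  then show ?thesis by (simp add: nabla_product_alt lower_row_def[abs_def])
qed

lemma berezin_u_in_Lambda:
  assumes "w \<in> Lambda xy ambient"
  shows "berezin (u_vars n) w \<in> Lambda xy (small_vars Xv s \<union> big_vars Yv t)"
  by (rule Lambda_mono[OF berezin_in_Lambda[OF assms]]) auto

lemma upper_product_in_Lambda: "prod_list (map upper_row [0..<t]) \<in> Lambda xy ambient"
  and lower_product_in_Lambda: "prod_list (map lower_row [0..<t]) \<in> Lambda xy ambient"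
  by (auto intro!: prod_list_in_Lambda upper_row_in_Lambda lower_row_in_Lambda)

text \<open>
  The integral does not involve the \<open>hat_u k\<close>, so their values under the differential may be changed
  from \<open>0\<close> to \<open>y\<^sub>k - x\<^sub>k\<close> before the integral is interchanged with it.
\<close>

lemma differential_berezin:
  assumes "w \<in> Lambda xy ambient"
  shows "differential f F (berezin (u_vars n) w) = (-1) ^ n * berezin (u_vars n) (koszul total_values w)"
proof -
  have "differential f F (berezin (u_vars n) w) = koszul total_values (berezin (u_vars n) w)"
    by (rule differential_eq_total[OF berezin_u_in_Lambda[OF assms]])
      (auto simp: small_vars_def big_vars_def)
  then show ?thesis by (simp only: koszul_berezin finite_imageI finite_lessThan card_u_vars)
qed

lemma upper_det_cycle: "differential f F upper_det = 0"
proof -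
  have "koszul total_values (prod_list (map upper_row [0..<t])) = 0"
    by (rule koszul_prod_list_cycle) (auto simp: koszul_upper_row)
  then show ?thesis
    by (simp add: upper_det_eq differential_berezin[OF upper_product_in_Lambda])
qed

lemma dets_homologous:
  "homologous (Lambda xy (small_vars Xv s \<union> big_vars Yv t)) (differential f F) upper_det lower_det"
proof -
  have "homogeneous (Suc 0) (lower_row j)" for j
    unfolding lower_row_def
    by (intro homogeneous_add homogeneous_diff homogeneous_u_form homogeneous_sum
        homogeneous_mult_gconst homogeneous_gen)
  then obtain W where W: "W \<in> Lambda xy ambient"
      "prod_list (map upper_row [0..<t]) - prod_list (map lower_row [0..<t]) = koszul total_values W"
    using prod_list_homotopic[of t upper_row xy ambient total_values lower_row]
      upper_row_in_Lambda lower_row_in_Lambda koszul_upper_row koszul_lower_row rows_homologous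
    by blast
  have "upper_det - lower_det = berezin (u_vars n) (koszul total_values W)"
    by (simp add: upper_det_eq lower_det_eq W(2)[symmetric] berezin_diff)
  also have "\<dots> = differential f F ((-1) ^ n * berezin (u_vars n) W)"
    using differential_berezin[OF W(1)]
    by (simp add: minus_one_power_iff differential_def koszul_uminus)
  finally show ?thesis
    unfolding homologous_def upper_det_eq lower_det_eq
    using berezin_u_in_Lambda upper_product_in_Lambda lower_product_in_Lambda W(1) neg_one_power_in_Lambda
    by blast
qed

end

section \<open>The substitution of \<open>f G\<close> for \<open>F\<close>\<close>

definition big_substitution :: "nat \<Rightarrow> nat \<Rightarrow> (nat \<Rightarrow> nat \<Rightarrow> 'r poly_n) \<Rightarrow> gvar \<Rightarrow> 'r::comm_ring_1 elem" where
  "big_substitution s t G g = (case g of hat_F Xv j \<Rightarrow> if j < t then fG Xv s G j else gen g | _ \<Rightarrow> gen g)"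

lemma big_substitution_hom:
  "grassmann_substitution (id :: 'r::comm_ring_1 poly_xy \<Rightarrow> 'r poly_xy) (big_substitution s t G)"
proof
  fix g show "homogeneous (Suc 0) (big_substitution s t G g)"
    by (auto simp: big_substitution_def homogeneous_fG split: gvar.split side.split)
qed auto

lemma substitution_all_hom:
  "grassmann_substitution (id :: 'r::comm_ring_1 poly_xy \<Rightarrow> 'r poly_xy)
    (\<lambda>g. case g of hat_F Xv j \<Rightarrow> fG Xv s G j | _ \<Rightarrow> gen g)"
proof
  fix g show "homogeneous (Suc 0) (case g of hat_F Xv j \<Rightarrow> fG Xv s G j | _ \<Rightarrow> gen g)"
    by (auto simp: homogeneous_fG split: gvar.split side.split)
qed auto

lemma big_substitution_fixed: "g \<notin> big_vars Xv t \<Longrightarrow> big_substitution s t G g = gen g"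
  by (auto simp: big_substitution_def big_vars_def split: gvar.split side.split)

text \<open>
  The extension of a homomorphism by the identity on parameters is a homomorphism.  It keeps the
  variables \<open>hat_F Xv j\<close> with \<open>j \<ge> t\<close>, which count as parameters.
\<close>

lemma exp_fG_eq:
  fixes G :: "nat \<Rightarrow> nat \<Rightarrow> 'r::comm_ring_1 poly_n"
  shows "exp_fG s t G = gsubst id (big_substitution s t G)"
proof
  fix u :: "'r elem"
  let ?\<sigma> = "\<lambda>g. case g of hat_F Xv j \<Rightarrow> fG Xv s G j | _ \<Rightarrow> gen g"
  let ?V = "big_vars Xv t"
  interpret all: grassmann_substitution "id :: 'r poly_xy \<Rightarrow> 'r poly_xy" ?\<sigma>
    by (rule substitution_all_hom)
  interpret big: grassmann_substitution "id :: 'r poly_xy \<Rightarrow> 'r poly_xy" "big_substitution s t G"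
    by (rule big_substitution_hom)
  show "exp_fG s t G u = gsubst id (big_substitution s t G) u"
    unfolding exp_fG_def
  proof (rule extend_map_unique)
    show "additive_on (Lambda {} ?V) (gsubst id ?\<sigma>)"
      by (simp add: additive_on_def all.gsubst_add)
  next
    fix T S :: "gvar set" and m m' :: "(side \<times> nat) \<Rightarrow>\<^sub>0 nat" and d :: 'r
    assume T: "finite T" "T \<inter> ?V = {}" and S: "finite S" "S \<subseteq> ?V"
    have "gsubst id (big_substitution s t G) (gmonom T (Poly_Mapping.single m 1)) =
        (gmonom T (Poly_Mapping.single m 1) :: 'r elem)"
      using big.gsubst_fixed_monomial[of T "big_substitution s t G"] T
      by (auto simp: big_substitution_fixed disjoint_iff)
    moreover have "map (big_substitution s t G) (sorted_list_of_set S) = map ?\<sigma> (sorted_list_of_set S)"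
      using S by (intro map_cong) (auto simp: big_substitution_def big_vars_def)
    then have "gsubst id (big_substitution s t G) (gmonom S (Poly_Mapping.single m' d)) =
        gsubst id ?\<sigma> (gmonom S (Poly_Mapping.single m' d))"
      using S by (simp only: big.gsubst_gmonom all.gsubst_gmonom)
    ultimately show "gsubst id (big_substitution s t G)
        (gmonom T (Poly_Mapping.single m 1) * gmonom S (Poly_Mapping.single m' d)) =
      (-1) ^ (0 * card T) * (gmonom T (Poly_Mapping.single m 1) *
        gsubst id ?\<sigma> (gmonom S (Poly_Mapping.single m' d)))"
      by (simp add: big.gsubst_mult)
  qed (rule big.gsubst_add)
qed

lemma exp_fG_nabla_det:
  fixes G :: "nat \<Rightarrow> nat \<Rightarrow> 'r::comm_ring_1 poly_n"
  shows "exp_fG s t G (nabla_det n t D (\<lambda>j. gen (hat_F Xv j) - gen (hat_F Yv j))) =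
    nabla_det n t D (\<lambda>j. fG Xv s G j - gen (hat_F Yv j))"
proof -
  let ?\<sigma> = "big_substitution s t G" and ?U = "u_vars n"
  interpret grassmann_substitution "id :: 'r poly_xy \<Rightarrow> 'r poly_xy" ?\<sigma>
    by (rule big_substitution_hom)
  have fG: "fG Xv s G j \<in> Lambda UNIV (- range hat_u)" for j
    unfolding fG_def by (intro sum_in_Lambda mult_in_Lambda gen_in_Lambda gconst_in_Lambda) auto
  have \<sigma>: "?\<sigma> g \<in> Lambda UNIV (- ?U)" if "g \<notin> ?U" for g
  proof (cases "g \<in> big_vars Xv t")
    case True
    then show ?thesis
      by (auto simp: big_substitution_def big_vars_def intro!: Lambda_mono[OF fG])
  next
    case False
    then show ?thesis using that by (simp add: big_substitution_fixed gen_in_Lambda)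
  qed
  have \<sigma>u: "?\<sigma> g = gen g" if "g \<in> ?U" for g
    using that by (intro big_substitution_fixed) (auto simp: big_vars_def)
  have image: "gsubst id ?\<sigma> (gen (hat_F Xv j) - gen (hat_F Yv j)) = fG Xv s G j - gen (hat_F Yv j)"
    if "j < t" for j
    using that by (simp only: gsubst_diff gsubst_gen) (simp add: big_substitution_def)
  have form: "gsubst id ?\<sigma> (u_form n d) = u_form n d" for d
    by (simp only: u_form_def gsubst_sum gsubst_mult gsubst_gen gsubst_gconst)
      (simp add: big_substitution_def)
  have "nabla_det n t D (\<lambda>j. gen (hat_F Xv j) - gen (hat_F Yv j)) =
      berezin ?U (nabla_product n t D (\<lambda>j. gen (hat_F Xv j) - gen (hat_F Yv j)))"
    by (intro nabla_det_eq_berezin diff_in_Lambda gen_in_Lambda) auto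
  then have "exp_fG s t G (nabla_det n t D (\<lambda>j. gen (hat_F Xv j) - gen (hat_F Yv j))) =
      berezin ?U (gsubst id ?\<sigma> (nabla_product n t D (\<lambda>j. gen (hat_F Xv j) - gen (hat_F Yv j))))"
    unfolding exp_fG_eq using gsubst_berezin[OF big_substitution_hom, of ?U s t G] \<sigma> \<sigma>u by simp
  also have "gsubst id ?\<sigma> (nabla_product n t D (\<lambda>j. gen (hat_F Xv j) - gen (hat_F Yv j))) =
      nabla_product n t D (\<lambda>j. fG Xv s G j - gen (hat_F Yv j))"
    unfolding nabla_product_alt gsubst_prod_list map_map
    by (intro arg_cong[of _ _ prod_list] map_cong refl) (simp add: gsubst_add form image del: gsubst_diff)
  also have "berezin ?U \<dots> = nabla_det n t D (\<lambda>j. fG Xv s G j - gen (hat_F Yv j))"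
    by (intro nabla_det_eq_berezin[symmetric] diff_in_Lambda fG gen_in_Lambda) auto
  finally show ?thesis .
qed


section \<open>Closed functionals\<close>

lemma differential_in_Lambda:
  assumes "w \<in> Lambda P V" "\<And>c i. hat_f c i \<in> V \<Longrightarrow> at_side c (f i) \<in> polys P"
    "\<And>c j. hat_F c j \<in> V \<Longrightarrow> at_side c (F j) \<in> polys P"
  shows "differential f F w \<in> Lambda P V"
  unfolding differential_def using assms by (intro koszul_in_Lambda) (auto split: gvar.split)

text \<open>
  Applied to \<open>gpart q h\<close>, only one of the two components of \<open>L\<close> in \<open>functional_boundary\<close> survives, so
  their relative sign does not matter.
\<close>

lemma functional_boundary_zero_iff:
  fixes L :: "'r::comm_ring_1 elem \<Rightarrow> 'r"
  assumes L: "L \<in> dual_complex (Lambda P V)"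
    and d: "\<And>w :: 'r elem. w \<in> Lambda P V \<Longrightarrow> differential f F w \<in> Lambda P V"
  shows "(\<forall>h\<in>Lambda P V. functional_boundary (differential f F) L h = 0) \<longleftrightarrow>
    (\<forall>h\<in>Lambda P V. L (differential f F h) = 0)"
proof
  note additive = dual_complex_additive[OF L]
  assume *: "\<forall>h\<in>Lambda P V. functional_boundary (differential f F) L h = 0"
  have hom: "L (differential f F (gpart q h)) = 0" if "h \<in> Lambda P V" for q and h :: "'r elem"
  proof -
    have "homogeneous (Suc q) (differential f F (gpart q h))"
      unfolding differential_def by (intro homogeneous_koszul homogeneous_gpart)
    moreover have "functional_boundary (differential f F) L (gpart q h) = 0"
      using * that by (simp add: gpart_in_Lambda)
    ultimately show ?thesis
      by (cases "even q") (simp_all add: functional_boundary_def gpart_homogeneous additive_on_zero[OF additive])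
  qed
  show "\<forall>h\<in>Lambda P V. L (differential f F h) = 0"
  proof
    fix h :: "'r elem" assume h: "h \<in> Lambda P V"
    have "differential f F h = differential f F (gpart 0 h) + differential f F (gpart 1 h)"
      unfolding differential_def koszul_add[symmetric] gpart_split[symmetric] ..
    then have "L (differential f F h) = L (differential f F (gpart 0 h)) + L (differential f F (gpart 1 h))"
      using h by (simp add: additive_onD[OF additive] d gpart_in_Lambda)
    then show "L (differential f F h) = 0" by (simp add: hom h)
  qed
next
  assume *: "\<forall>h\<in>Lambda P V. L (differential f F h) = 0"
  then show "\<forall>h\<in>Lambda P V. functional_boundary (differential f F) L h = 0"
    by (simp add: functional_boundary_def differential_def gpart_koszul gpart_in_Lambda)
qed

lemma coef_gconst_mult: "coef (gconst c * w) S = c * coef w S"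
proof (induction w rule: grassmann_induct)
  case (gmonom T d)
  then show ?case by (simp add: gmonom_mult coef_gmonom)
qed (simp_all add: distrib_left)

lemma gpart_scalar_mult: "gpart p (scalar r * w) = scalar r * gpart p w"
  by (rule grassmann_eqI) (simp add: coef_gpart coef_gconst_mult scalar_def)

lemma dual_det_scalar_mult: "dual_det c s t G (scalar r * w) = scalar r * dual_det c s t G w"
  using dual_det_parameter[of "scalar r" c s 0 t G w] by (simp add: scalar_def homogeneous_gmonom gmonom_in_Lambda)

lemma dual_det_functional_dual_complex:
  fixes L :: "'r::comm_ring_1 elem \<Rightarrow> 'r"
  assumes G: "\<And>i j. i < s \<Longrightarrow> j < t \<Longrightarrow> G i j \<in> polys {..<n}"
    and L: "L \<in> dual_complex (Lambda (pvars c n) (big_vars c t))"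
  shows "dual_det_functional c s t G L \<in> dual_complex (Lambda (pvars c n) (small_vars c s))"
  unfolding dual_complex_def mem_Collect_eq
proof (intro conjI ballI allI)
  note B = dual_det_in_Lambda[OF G, where c = c]
  fix a :: "'r elem" assume a: "a \<in> Lambda (pvars c n) (small_vars c s)"
  {
    fix b :: "'r elem" assume b: "b \<in> Lambda (pvars c n) (small_vars c s)"
    show "dual_det_functional c s t G L (a + b) = dual_det_functional c s t G L a + dual_det_functional c s t G L b"
      using a b
      by (simp add: dual_det_functional_def dual_det_add gpart_add gpart_in_Lambda B
          additive_onD[OF dual_complex_additive[OF L]] algebra_simps)
  next
    fix r
    show "dual_det_functional c s t G L (scalar r * a) = r * dual_det_functional c s t G L a"
      using a
      by (simp add: dual_det_functional_def dual_det_scalar_mult gpart_scalar_mult gpart_in_Lambda B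
          dual_complex_scalar[OF L] algebra_simps)
  }
qed

lemma dual_det_functional_closed:
  assumes F_eq: "\<And>j. j < t \<Longrightarrow> F j = (\<Sum>i<s. f i * G i j)"
    and G: "\<And>i j. i < s \<Longrightarrow> j < t \<Longrightarrow> G i j \<in> polys {..<n}"
    and F: "\<And>j. j < t \<Longrightarrow> F j \<in> polys {..<n}"
    and L: "L \<in> dual_complex (Lambda (pvars c n) (big_vars c t))"
    and closed: "\<forall>h\<in>Lambda (pvars c n) (big_vars c t). L (differential f F h) = 0"
    and h: "h \<in> Lambda (pvars c n) (small_vars c s)"
  shows "dual_det_functional c s t G L (differential f F h) = 0"
proof -
  have "L (gpart p (dual_det c s t G (differential f F h))) = 0" for p
  proof -
    have "differential f F (dual_det c s t G h) = (-1) ^ (s + t) * dual_det c s t G (differential f F h)"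
      using F_eq by (rule dual_det_boundary)
    then have "dual_det c s t G (differential f F h) = differential f F ((-1) ^ (s + t) * dual_det c s t G h)"
      by (simp add: minus_one_power_iff differential_def koszul_uminus)
    then have "gpart p (dual_det c s t G (differential f F h)) =
        differential f F (gpart (Suc p) ((-1) ^ (s + t) * dual_det c s t G h))"
      by (simp add: differential_def gpart_koszul)
    moreover have "gpart (Suc p) ((-1) ^ (s + t) * dual_det c s t G h) \<in> Lambda (pvars c n) (big_vars c t)"
      by (intro gpart_in_Lambda neg_one_power_in_Lambda dual_det_in_Lambda G h)
    ultimately show ?thesis using closed by simp
  qed
  then show ?thesis by (simp add: dual_det_functional_def)
qed


section \<open>Renaming \<open>y\<close> to \<open>x\<close>\<close>

definition rename :: "'r elem \<Rightarrow> 'r::comm_ring_1 elem" where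
  "rename = gsubst (psubst (\<lambda>(c, k). pvar (Xv, k))) (\<lambda>g. gen (y_to_x g))"

lemma rename_hom: "grassmann_substitution
    (psubst (\<lambda>(c, k). pvar (Xv, k)) :: 'r::comm_ring_1 poly_xy \<Rightarrow> 'r poly_xy) (\<lambda>g. gen (y_to_x g))"
  by standard (simp_all add: psubst_add psubst_mult)

lemma rename_in_Lambda:
  assumes "w \<in> Lambda (pvars Yv n) (big_vars Yv t)"
  shows "rename w \<in> Lambda (pvars Xv n) (big_vars Xv t)"
  unfolding rename_def using assms
proof (rule gsubst_in_Lambda)
  show "psubst (\<lambda>(c, k). pvar (Xv, k)) p \<in> polys (pvars Xv n)" if "p \<in> polys (pvars Yv n)" for p :: "'a poly_xy"
    using that by (rule psubst_polys) (auto simp: pvars_def intro: polys_pvar)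
qed (auto simp: big_vars_def intro!: gen_in_Lambda)

lemma rename_at_side: "psubst (\<lambda>(c, k). pvar (Xv, k)) (at_side c p) = at_side Xv p"
  by (simp add: at_side_def psubst_psubst)

lemma rename_differential: "rename (differential f F w) = differential f F (rename w)"
proof -
  interpret grassmann_substitution
    "psubst (\<lambda>(c, k). pvar (Xv, k)) :: 'a poly_xy \<Rightarrow> 'a poly_xy" "\<lambda>g. gen (y_to_x g)"
    by (rule rename_hom)
  show ?thesis
  proof (induction w rule: gen_mult_induct)
    case zero
    then show ?case by (simp add: rename_def differential_def)
  next
    case (add a b)
    then show ?case by (simp add: rename_def differential_def gsubst_add koszul_add)
  next
    case (const c)
    then show ?case by (simp add: rename_def differential_def gsubst_gconst)
  next
    case (gen g w)
    have "rename (differential f F (gen g * w)) =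
        gconst (psubst (\<lambda>(c, k). pvar (Xv, k)) (gen_values (\<lambda>k. 0) f F g)) * rename w -
        gen (y_to_x g) * differential f F (rename w)"
      using gen
      by (simp add: differential_def koszul_gen_mult rename_def gsubst_diff gsubst_mult gsubst_gconst gsubst_gen)
    also have "psubst (\<lambda>(c, k). pvar (Xv, k)) (gen_values (\<lambda>k. 0) f F g) = gen_values (\<lambda>k. 0) f F (y_to_x g)"
      by (cases g) (simp_all add: rename_at_side)
    also have "gconst (gen_values (\<lambda>k. 0) f F (y_to_x g)) * rename w - gen (y_to_x g) * differential f F (rename w) =
        differential f F (rename (gen g * w))"
      by (simp add: differential_def koszul_gen_mult rename_def gsubst_mult gsubst_gen)
    finally show ?case .
  qed
qed

lemma in_y_eq: "in_y L w = L (rename w)"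
  by (simp add: in_y_def rename_def)

lemma in_y_dual_complex:
  assumes "L \<in> dual_complex (Lambda (pvars Xv n) (big_vars Xv t))"
  shows "in_y L \<in> dual_complex (Lambda (pvars Yv n) (big_vars Yv t))"
proof -
  interpret grassmann_substitution
    "psubst (\<lambda>(c, k). pvar (Xv, k)) :: 'a poly_xy \<Rightarrow> 'a poly_xy" "\<lambda>g. gen (y_to_x g)"
    by (rule rename_hom)
  have "rename (a + b) = rename a + (rename b :: 'a elem)" for a b
    by (simp add: rename_def gsubst_add)
  moreover have "rename (scalar r * a) = scalar r * (rename a :: 'a elem)" for r a
    by (simp add: rename_def gsubst_mult scalar_def gsubst_gconst)
  ultimately show ?thesis
    using assms unfolding dual_complex_def in_y_eq by (simp add: rename_in_Lambda)
qed


section \<open>Contraction of the determinants with a closed functional\<close>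

context koszul_transformation
begin

lemma differential_F_complex: "w \<in> Lambda (pvars c n) (big_vars c t) \<Longrightarrow>
    differential f F w \<in> Lambda (pvars c n) (big_vars c t)"
  using F by (intro differential_in_Lambda) (auto simp: big_vars_def intro: at_side_polys)

lemma differential_f_complex: "w \<in> Lambda (pvars c n) (small_vars c s) \<Longrightarrow>
    differential f F w \<in> Lambda (pvars c n) (small_vars c s)"
  using f by (intro differential_in_Lambda) (auto simp: small_vars_def intro: at_side_polys)

lemma in_y_closed:
  assumes "\<forall>h\<in>Lambda (pvars Xv n) (big_vars Xv t). L (differential f F h) = 0"
  shows "\<forall>h\<in>Lambda (pvars Yv n) (big_vars Yv t). in_y L (differential f F h) = 0"
  using assms by (simp add: in_y_eq rename_differential rename_in_Lambda)

context
  fixes L :: "'r elem \<Rightarrow> 'r"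
  assumes L: "L \<in> dual_complex (Lambda (pvars Yv n) (big_vars Yv t))"
begin

abbreviation integrate :: "'r elem \<Rightarrow> 'r elem" where
  "integrate w \<equiv> functional_contract (pvars Yv n) (big_vars Yv t) w L"

lemma x_parameters:
  assumes "\<theta> \<in> Lambda (pvars Xv n) V" "V \<inter> big_vars Yv t = {}"
  shows "\<theta> \<in> Lambda (- pvars Yv n) (- big_vars Yv t)"
  using assms by (intro Lambda_mono[OF assms(1)]) (auto simp: pvars_def)

lemma integrate_in_Lambda:
  assumes "w \<in> Lambda xy (V \<union> big_vars Yv t)"
  shows "integrate w \<in> Lambda (pvars Xv n) V"
  using assms
proof (induction rule: tensor_induct[where P = "pvars Yv n" and V = "big_vars Yv t"])
  case (tensor T m S m' c)
  let ?\<theta> = "gmonom T (Poly_Mapping.single m 1) :: 'r elem" and ?w = "gmonom S (Poly_Mapping.single m' c)"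
  have "integrate (?\<theta> * ?w) = ?\<theta> * scalar (L (grade_involution ?w))"
    using tensor by (intro functional_contract_tensor[OF L]) auto
  moreover have "?\<theta> \<in> Lambda (pvars Xv n) V"
    using tensor by (intro gmonom_in_Lambda polys_single) auto
  ultimately show ?case by (simp add: mult_in_Lambda)
qed (simp_all add: functional_contract_add[OF L] add_in_Lambda)

text \<open>
  The contraction acts on the variables with index \<open>y\<close> and the substitution on those with index \<open>x\<close>,
  which are parameters of the contraction.
\<close>

lemma exp_fG_integrate:
  assumes "w \<in> Lambda xy (big_vars Xv t \<union> big_vars Yv t)"
  shows "exp_fG s t G (integrate w) = integrate (exp_fG s t G w)"
  unfolding exp_fG_eq using assms
proof (induction rule: tensor_induct[where P = "pvars Yv n" and V = "big_vars Yv t"])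
  case zero
  interpret grassmann_substitution "id :: 'r poly_xy \<Rightarrow> 'r poly_xy" "big_substitution s t G"
    by (rule big_substitution_hom)
  show ?case by (simp only: gsubst_zero functional_contract_zero)
next
  case (add a b)
  interpret grassmann_substitution "id :: 'r poly_xy \<Rightarrow> 'r poly_xy" "big_substitution s t G"
    by (rule big_substitution_hom)
  show ?case using add by (simp only: functional_contract_add[OF L] gsubst_add)
next
  case (tensor T m S m' c)
  interpret grassmann_substitution "id :: 'r poly_xy \<Rightarrow> 'r poly_xy" "big_substitution s t G"
    by (rule big_substitution_hom)
  let ?\<sigma> = "gsubst id (big_substitution s t G)"
  let ?\<theta> = "gmonom T (Poly_Mapping.single m 1) :: 'r elem" and ?w = "gmonom S (Poly_Mapping.single m' c)"
  have "integrate (?\<theta> * ?w) = ?\<theta> * scalar (L (grade_involution ?w))"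
    using tensor by (intro functional_contract_tensor[OF L]) auto
  then have "?\<sigma> (integrate (?\<theta> * ?w)) = ?\<sigma> ?\<theta> * scalar (L (grade_involution ?w))"
    by (simp only: gsubst_mult scalar_def gsubst_gconst id_apply)
  moreover have "?\<sigma> ?w = ?w"
  proof -
    have "big_substitution s t G g = gen g" if "g \<in> S" for g
      using tensor that by (intro big_substitution_fixed) (auto simp: big_vars_def)
    from gsubst_fixed_monomial[OF tensor(4) this] show ?thesis by (simp only: id_apply)
  qed
  moreover have "integrate (?\<sigma> ?\<theta> * ?w) = ?\<sigma> ?\<theta> * scalar (L (grade_involution ?w))"
  proof (rule functional_contract_mult[OF L x_parameters])
    have "?\<theta> \<in> Lambda (pvars Xv n) (big_vars Xv t)"
      using tensor by (intro gmonom_in_Lambda polys_single) auto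
    then show "?\<sigma> ?\<theta> \<in> Lambda (pvars Xv n) (small_vars Xv s)"
    proof (rule gsubst_in_Lambda)
      fix g assume "g \<in> big_vars Xv t"
      then show "big_substitution s t G g \<in> Lambda (pvars Xv n) (small_vars Xv s)"
        using G by (auto simp: big_substitution_def big_vars_def intro!: fG_in_Lambda)
    qed auto
    show "?w \<in> Lambda (pvars Yv n) (big_vars Yv t)"
      using tensor by (intro gmonom_in_Lambda polys_single) auto
  qed (auto simp: small_vars_def big_vars_def)
  ultimately show ?case by (simp only: gsubst_mult)
qed

text \<open>
  On \<open>\<theta> w\<close> the term of the Leibniz rule with the differential of \<open>w\<close> is killed by \<open>L\<close>.
\<close>

lemma differential_integrate:
  assumes closed: "\<forall>h\<in>Lambda (pvars Yv n) (big_vars Yv t). L (differential f F h) = 0"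
    and w: "w \<in> Lambda xy (small_vars Xv s \<union> big_vars Yv t)"
  shows "differential f F (integrate w) = integrate (differential f F w)"
  using w
proof (induction rule: tensor_induct[where P = "pvars Yv n" and V = "big_vars Yv t"])
  case zero
  then show ?case by (simp add: differential_def)
next
  case (add a b)
  then show ?case by (simp add: functional_contract_add[OF L] differential_def koszul_add)
next
  case (tensor T m S m' c)
  let ?\<theta> = "gmonom T (Poly_Mapping.single m 1) :: 'r elem" and ?w = "gmonom S (Poly_Mapping.single m' c)"
  have \<theta>: "?\<theta> \<in> Lambda (pvars Xv n) (small_vars Xv s)"
    using tensor by (intro gmonom_in_Lambda polys_single) auto
  have disj: "small_vars Xv s \<inter> big_vars Yv t = {}" by (auto simp: small_vars_def big_vars_def)
  have w: "?w \<in> Lambda (pvars Yv n) (big_vars Yv t)"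
    using tensor by (intro gmonom_in_Lambda polys_single) auto
  have hom: "homogeneous (card T) ?\<theta>" by (rule homogeneous_gmonom) simp
  have "L (grade_involution (differential f F ?w)) = 0"
  proof -
    have "grade_involution (differential f F ?w) = differential f F (- grade_involution ?w)"
      by (simp add: differential_def grade_involution_koszul koszul_uminus)
    then show ?thesis using closed w by (simp add: uminus_in_Lambda grade_involution_in_Lambda)
  qed
  then have zero: "integrate (?\<theta> * differential f F ?w) = 0"
    using functional_contract_mult[OF L x_parameters[OF \<theta> disj] differential_F_complex[OF w]] by simp
  have "integrate (differential f F (?\<theta> * ?w)) =
      integrate (differential f F ?\<theta> * ?w) + integrate ((-1) ^ card T * (?\<theta> * differential f F ?w))"
    by (simp add: differential_def koszul_leibniz[OF hom] functional_contract_add[OF L] mult.assoc)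
  also have "integrate ((-1) ^ card T * (?\<theta> * differential f F ?w)) = 0"
    using zero by (simp add: minus_one_power_iff functional_contract_uminus[OF L])
  also have "integrate (differential f F ?\<theta> * ?w) + 0 =
      differential f F ?\<theta> * scalar (L (grade_involution ?w))"
    using functional_contract_mult[OF L x_parameters[OF differential_f_complex[OF \<theta>] disj] w] by simp
  also have "\<dots> = differential f F (?\<theta> * scalar (L (grade_involution ?w)))"
    by (simp add: differential_def koszul_mult_cycle scalar_def)
  also have "?\<theta> * scalar (L (grade_involution ?w)) = integrate (?\<theta> * ?w)"
    using functional_contract_mult[OF L x_parameters[OF \<theta> disj] w] by simp
  finally show ?case by simp
qed

text \<open>
  Contracting with \<open>h \<mapsto> \<plusminus> L (B h)\<close> is contracting with \<open>B\<close> first and with \<open>L\<close> afterwards.  For \<open>\<theta> w\<close>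
  with \<open>|w| = q\<close> and \<open>|B| = r\<close> the signs are \<open>(-1)\<^bsup>q + (q + r) r\<^esup>\<close> and \<open>(-1)\<^bsup>q r + (q + r)\<^esup>\<close>, which agree.
\<close>

lemma contract_dual_det_functional:
  assumes "w \<in> Lambda xy (small_vars Xv s \<union> small_vars Yv s)"
  shows "functional_contract (pvars Yv n) (small_vars Yv s) w (dual_det_functional Yv s t G L) =
    integrate (contract_map (s + t) (dual_det Yv s t G) w)"
  using assms
proof (induction rule: tensor_induct[where P = "pvars Yv n" and V = "small_vars Yv s"])
  case zero
  then show ?case by (simp add: contract_map_def)
next
  case (add a b)
  have "dual_det_functional Yv s t G L \<in> dual_complex (Lambda (pvars Yv n) (small_vars Yv s))"
    using G by (intro dual_det_functional_dual_complex[OF _ L]) auto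
  then show ?case using add
    by (simp add: functional_contract_add[OF L] functional_contract_add contract_map_add dual_det_add)
next
  case (tensor T m S m' c)
  let ?\<theta> = "gmonom T (Poly_Mapping.single m 1) :: 'r elem" and ?w = "gmonom S (Poly_Mapping.single m' c)"
  let ?B = "dual_det Yv s t G" and ?M = "dual_det_functional Yv s t G L"
  have M: "?M \<in> dual_complex (Lambda (pvars Yv n) (small_vars Yv s))"
    using G by (intro dual_det_functional_dual_complex[OF _ L]) auto
  have \<theta>: "?\<theta> \<in> Lambda (pvars Xv n) (small_vars Xv s)" "?\<theta> \<in> Lambda UNIV (- small_vars Yv s)"
    using tensor by (auto intro!: gmonom_in_Lambda polys_single)
  have disj: "small_vars Xv s \<inter> big_vars Yv t = {}" by (auto simp: small_vars_def big_vars_def)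
  have w: "?w \<in> Lambda (pvars Yv n) (small_vars Yv s)"
    using tensor by (intro gmonom_in_Lambda polys_single) auto
  have hom: "homogeneous (card T) ?\<theta>" "homogeneous (card S) ?w"
    by (simp_all add: homogeneous_gmonom)
  have Bw: "?B ?w \<in> Lambda (pvars Yv n) (big_vars Yv t)" "homogeneous (card S + s + t) (?B ?w)"
    using G w hom by (auto intro!: dual_det_in_Lambda homogeneous_dual_det)
  have Mw: "?M ?w = (-1) ^ ((card S + s + t) * (s + t)) * L (?B ?w)"
    using Bw(2) by (cases "even (card S + s + t)")
      (simp_all add: dual_det_functional_def gpart_homogeneous minus_one_power_iff
        additive_on_zero[OF dual_complex_additive[OF L]])
  have "functional_contract (pvars Yv n) (small_vars Yv s) (?\<theta> * ?w) ?M =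
      ?\<theta> * scalar (?M (grade_involution ?w))"
    using tensor by (intro functional_contract_tensor[OF M]) auto
  also have "?M (grade_involution ?w) = (-1) ^ card S * ?M ?w"
    using additive_on_uminus[OF dual_complex_additive[OF M] w]
    by (simp add: grade_involution_homogeneous[OF hom(2)])
  finally have lhs: "functional_contract (pvars Yv n) (small_vars Yv s) (?\<theta> * ?w) ?M =
      ?\<theta> * scalar ((-1) ^ card S * ((-1) ^ ((card S + s + t) * (s + t)) * L (?B ?w)))"
    unfolding Mw .
  have "contract_map (s + t) ?B (?\<theta> * ?w) =
      (-1) ^ ((card T + card S) * (s + t)) * ((-1) ^ ((s + t) * card T) * (?\<theta> * ?B ?w))"
    using contract_map_homogeneous[OF homogeneous_mult[OF hom], of ?B "s + t"]
      dual_det_parameter[OF \<theta>(2) hom(1), of t G ?w] by simp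
  also have "\<dots> = (-1) ^ (card S * (s + t)) * (?\<theta> * ?B ?w)"
    by (cases "even (card T)") (simp_all add: minus_one_power_iff)
  finally have "integrate (contract_map (s + t) ?B (?\<theta> * ?w)) =
      (-1) ^ (card S * (s + t)) * integrate (?\<theta> * ?B ?w)"
    by (simp add: minus_one_power_iff functional_contract_uminus[OF L])
  also have "integrate (?\<theta> * ?B ?w) = ?\<theta> * scalar (L (grade_involution (?B ?w)))"
    by (rule functional_contract_mult[OF L x_parameters[OF \<theta>(1) disj] Bw(1)])
  also have "L (grade_involution (?B ?w)) = (-1) ^ (card S + s + t) * L (?B ?w)"
    using additive_on_uminus[OF dual_complex_additive[OF L] Bw(1)]
    by (simp add: grade_involution_homogeneous[OF Bw(2)])
  finally show ?case unfolding lhs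
    by (cases "even (card S)"; cases "even (s + t)") (simp_all add: minus_one_power_iff scalar_uminus)
qed

lemma small_det_in_Lambda: "small_det \<in> Lambda xy (small_vars Xv s \<union> small_vars Yv s)"
proof -
  let ?P = "nabla_product n s (\<lambda>i. nabla (f i)) (\<lambda>i. gen (hat_f Xv i) - gen (hat_f Yv i))"
  have "small_det = berezin (u_vars n) ?P"
    unfolding small_det_def by (intro nabla_det_eq_berezin diff_in_Lambda gen_in_Lambda) auto
  moreover have P: "?P \<in> Lambda xy (u_vars n \<union> (small_vars Xv s \<union> small_vars Yv s))"
    using f by (intro nabla_product_in_Lambda diff_in_Lambda gen_in_Lambda nabla_polys)
      (auto simp: small_vars_def)
  moreover have "berezin (u_vars n) ?P \<in> Lambda xy (small_vars Xv s \<union> small_vars Yv s)"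
    by (rule Lambda_mono[OF berezin_in_Lambda[OF P]]) auto
  ultimately show ?thesis by simp
qed

lemma integrals_homologous:
  assumes closed: "\<forall>h\<in>Lambda (pvars Yv n) (big_vars Yv t). L (differential f F h) = 0"
  shows "homologous (Lambda (pvars Xv n) (small_vars Xv s)) (differential f F) (integrate upper_det)
    (functional_contract (pvars Yv n) (small_vars Yv s) small_det (dual_det_functional Yv s t G L))"
proof -
  have *: "functional_contract (pvars Yv n) (small_vars Yv s) small_det (dual_det_functional Yv s t G L) =
      integrate lower_det"
    unfolding lower_det_def by (rule contract_dual_det_functional[OF small_det_in_Lambda])
  from dets_homologous obtain c where c: "c \<in> Lambda xy (small_vars Xv s \<union> big_vars Yv t)"
      "upper_det - lower_det = differential f F c"
    and dets: "upper_det \<in> Lambda xy (small_vars Xv s \<union> big_vars Yv t)"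
      "lower_det \<in> Lambda xy (small_vars Xv s \<union> big_vars Yv t)"
    by (auto simp: homologous_def)
  have "integrate upper_det - integrate lower_det = differential f F (integrate c)"
    by (simp add: functional_contract_diff[OF L, symmetric] c(2) differential_integrate[OF closed c(1)])
  then show ?thesis
    unfolding homologous_def * using integrate_in_Lambda c(1) dets by blast
qed

end

definition big_det :: "'r elem" where
  "big_det = nabla_det n t (\<lambda>j. nabla (F j)) (\<lambda>j. gen (hat_F Xv j) - gen (hat_F Yv j))"

lemma big_det_in_Lambda: "big_det \<in> Lambda xy (big_vars Xv t \<union> big_vars Yv t)"
proof -
  let ?P = "nabla_product n t (\<lambda>j. nabla (F j)) (\<lambda>j. gen (hat_F Xv j) - gen (hat_F Yv j))"
  have "big_det = berezin (u_vars n) ?P"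
    unfolding big_det_def by (intro nabla_det_eq_berezin diff_in_Lambda gen_in_Lambda) auto
  moreover have P: "?P \<in> Lambda xy (u_vars n \<union> (big_vars Xv t \<union> big_vars Yv t))"
    using F by (intro nabla_product_in_Lambda diff_in_Lambda gen_in_Lambda nabla_polys)
      (auto simp: big_vars_def)
  moreover have "berezin (u_vars n) ?P \<in> Lambda xy (big_vars Xv t \<union> big_vars Yv t)"
    by (rule Lambda_mono[OF berezin_in_Lambda[OF P]]) auto
  ultimately show ?thesis by simp
qed

lemma exp_fG_big_det: "exp_fG s t G big_det = upper_det"
  unfolding big_det_def upper_det_def by (rule exp_fG_nabla_det)

end

theorem theorem3:
  fixes n s t :: nat
    and f F :: "nat \<Rightarrow> 'r::comm_ring_1 poly_n"
    and G :: "nat \<Rightarrow> nat \<Rightarrow> 'r poly_n"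
    and nabla :: "'r poly_n \<Rightarrow> nat \<Rightarrow> 'r poly_xy"
  assumes f: "\<forall>i<s. f i \<in> polys {..<n}"
    and F: "\<forall>j<t. F j \<in> polys {..<n}"
    and G: "\<forall>i<s. \<forall>j<t. G i j \<in> polys {..<n}"
    and F_eq: "\<forall>j<t. F j = (\<Sum>i<s. f i * G i j)"
    and nabla: "difference_quotients n nabla"
  shows
    "exp_fG s t G (nabla_det n t (\<lambda>j. nabla (F j)) (\<lambda>j. gen (hat_F Xv j) - gen (hat_F Yv j))) =
      nabla_det n t (\<lambda>j. nabla (F j)) (\<lambda>j. fG Xv s G j - gen (hat_F Yv j)) \<and>
     homologous (Lambda (pvars Xv n \<union> pvars Yv n) (small_vars Xv s \<union> big_vars Yv t))
      (differential f F)
      (nabla_det n t (\<lambda>j. nabla (F j)) (\<lambda>j. fG Xv s G j - gen (hat_F Yv j)))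
      (contract_map (s + t) (extend_map {} (small_vars Yv s) (s + t) (dual_det Yv s t G))
        (nabla_det n s (\<lambda>i. nabla (f i)) (\<lambda>i. gen (hat_f Xv i) - gen (hat_f Yv i)))) \<and>
     differential f F (nabla_det n t (\<lambda>j. nabla (F j)) (\<lambda>j. fG Xv s G j - gen (hat_F Yv j))) = 0 \<and>
     (\<forall>h\<in>Lambda (pvars Yv n) (small_vars Yv s).
      map_boundary (differential f F) (s + t) (dual_det Yv s t G) h = 0) \<and>
     (\<forall>L\<in>dual_complex (Lambda (pvars Xv n) (big_vars Xv t)).
      (\<forall>h\<in>Lambda (pvars Xv n) (big_vars Xv t). functional_boundary (differential f F) L h = 0) \<longrightarrow>
      (\<forall>h\<in>Lambda (pvars Xv n) (small_vars Xv s).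
        functional_boundary (differential f F) (dual_det_functional Xv s t G L) h = 0) \<and>
      exp_fG s t G (functional_contract (pvars Yv n) (big_vars Yv t)
          (nabla_det n t (\<lambda>j. nabla (F j)) (\<lambda>j. gen (hat_F Xv j) - gen (hat_F Yv j))) (in_y L)) =
        functional_contract (pvars Yv n) (big_vars Yv t)
          (nabla_det n t (\<lambda>j. nabla (F j)) (\<lambda>j. fG Xv s G j - gen (hat_F Yv j))) (in_y L) \<and>
      homologous (Lambda (pvars Xv n) (small_vars Xv s)) (differential f F)
        (functional_contract (pvars Yv n) (big_vars Yv t)
          (nabla_det n t (\<lambda>j. nabla (F j)) (\<lambda>j. fG Xv s G j - gen (hat_F Yv j))) (in_y L))
        (functional_contract (pvars Yv n) (small_vars Yv s)
          (nabla_det n s (\<lambda>i. nabla (f i)) (\<lambda>i. gen (hat_f Xv i) - gen (hat_f Yv i)))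
          (dual_det_functional Yv s t G (in_y L))))"
proof -
  interpret koszul_transformation n s t f F G nabla
    by (rule koszul_transformation.intro) (fact f F G F_eq nabla)+
  have F_eq': "\<And>j. j < t \<Longrightarrow> F j = (\<Sum>i<s. f i * G i j)"
    and G': "\<And>i j. i < s \<Longrightarrow> j < t \<Longrightarrow> G i j \<in> polys {..<n}"
    and F': "\<And>j. j < t \<Longrightarrow> F j \<in> polys {..<n}"
    using F_eq G F by auto
  show ?thesis
    unfolding extend_dual_det upper_det_def[symmetric] small_det_def[symmetric] big_det_def[symmetric]
      lower_det_def[symmetric]
  proof (intro conjI ballI impI)
    show "exp_fG s t G big_det = upper_det" by (rule exp_fG_big_det)
    show "homologous (Lambda xy (small_vars Xv s \<union> big_vars Yv t)) (differential f F) upper_det lower_det"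
      by (rule dets_homologous)
    show "differential f F upper_det = 0" by (rule upper_det_cycle)
    show "map_boundary (differential f F) (s + t) (dual_det Yv s t G) h = 0" for h
      unfolding map_boundary_def using dual_det_boundary[where c = Yv, OF F_eq'] by simp
  next
    fix L assume L: "L \<in> dual_complex (Lambda (pvars Xv n) (big_vars Xv t))"
      and "\<forall>h\<in>Lambda (pvars Xv n) (big_vars Xv t). functional_boundary (differential f F) L h = 0"
    then have closed: "\<forall>h\<in>Lambda (pvars Xv n) (big_vars Xv t). L (differential f F h) = 0"
      using functional_boundary_zero_iff[OF L differential_F_complex] by blast
    note Ly = in_y_dual_complex[OF L] and closed_y = in_y_closed[OF closed]
    have M: "dual_det_functional Xv s t G L \<in> dual_complex (Lambda (pvars Xv n) (small_vars Xv s))"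
      by (rule dual_det_functional_dual_complex[OF G' L])
    have "\<forall>h\<in>Lambda (pvars Xv n) (small_vars Xv s). dual_det_functional Xv s t G L (differential f F h) = 0"
      using dual_det_functional_closed[OF F_eq' G' F' L closed] by blast
    then show "functional_boundary (differential f F) (dual_det_functional Xv s t G L) h = 0"
      if "h \<in> Lambda (pvars Xv n) (small_vars Xv s)" for h
      using that functional_boundary_zero_iff[OF M differential_f_complex] by blast
    show "exp_fG s t G (functional_contract (pvars Yv n) (big_vars Yv t) big_det (in_y L)) =
        functional_contract (pvars Yv n) (big_vars Yv t) upper_det (in_y L)"
      by (simp add: exp_fG_integrate[OF Ly big_det_in_Lambda] exp_fG_big_det)
    show "homologous (Lambda (pvars Xv n) (small_vars Xv s)) (differential f F)
        (functional_contract (pvars Yv n) (big_vars Yv t) upper_det (in_y L))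
        (functional_contract (pvars Yv n) (small_vars Yv s) small_det (dual_det_functional Yv s t G (in_y L)))"
      by (rule integrals_homologous[OF Ly closed_y])
  qed
qed


end
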